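(* The function $S(\gamma;x,\lambda)$ is a simultaneous eigenfunction of the Askey-Wilson second order difference operators $\mathcal{L}_\gamma^x$, $\widetilde{\mathcal{L}}_\gamma^x$, $\mathcal{L}_{\hat\gamma}^\lambda$ and $\widetilde{\mathcal{L}}_{\hat\gamma}^\lambda$ with eigenvalues $v(w_1,w_2,\gamma;\lambda)$, $v(w_2,w_1,\gamma;\lambda)$, $v(w_1,w_2,\hat\gamma;x)$ and $v(w_2,w_1,\hat\gamma;x)$ respectively.
   Context: Convention: $\pm$ inside the argument of a function means a product over both signs, e.g. $f(z\pm a)=f(z+a)f(z-a)$; square roots are the principal branch. $\mathbb{C}_+=\{z\in\mathbb{C}:\Re(z)>0\}$; for $w_1,w_2\in\mathbb{C}_+$ set $w=(w_1+w_2)/2$. Hyperbolic gamma function: for $|\Im(z)|<\Re(w)$, $G(z)=G(w_1,w_2;z)=\exp\Big(i\int_0^\infty\Big(\frac{\sin(2yz)}{2\sinh(w_1y)\sinh(w_2y)}-\frac{z}{w_1w_2y}\Big)\frac{dy}{y}\Big)$, continued meromorphically to $z\in\mathbb{C}$ by $G(z+iw_1/2)=2\cosh(\pi z/w_2)G(z-iw_1/2)$ and $G(z+iw_2/2)=2\cosh(\pi z/w_1)G(z-iw_2/2)$. Parameters: $\gamma=(\gamma_0,\gamma_1,\gamma_2,\gamma_3)\in\mathbb{C}^4$ corresponds to $(\rho,\sigma,\tau,\upsilon)\in\mathbb{C}^4$ via $\gamma_0=-\rho+\sigma$, $\gamma_1=\rho+\sigma$, $\gamma_2=-\tau-\upsilon$,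 $\gamma_3=\tau-\upsilon$. Dual parameters $\hat\gamma$: $\hat\gamma_0=\frac12(\gamma_0+\gamma_1+\gamma_2+\gamma_3)$, $\hat\gamma_1=\frac12(\gamma_0+\gamma_1-\gamma_2-\gamma_3)$, $\hat\gamma_2=\frac12(\gamma_0-\gamma_1+\gamma_2-\gamma_3)$, $\hat\gamma_3=\frac12(\gamma_0-\gamma_1-\gamma_2+\gamma_3)$; duality is an involution. The function $S$: let $\xi=\max(|\Re\rho|,|\Re\sigma|,|\Re\tau|,|\Re\upsilon|)$ and $\zeta=w/2-\xi-|\Im(\lambda/2)|$. For $w_1,w_2>0$, $\zeta>0$, $|\Im x|<\zeta$ put $$\psi(\gamma;x,\lambda)=\int_{\mathbb{R}}\frac{G(z+x+\lambda/2-iw/2\pm i\tau)\,G(z-\lambda/2-iw/2\pm i\sigma)}{G(z+x-\lambda/2+iw/2\pm i\rho)\,G(z+\lambda/2+iw/2\pm i\upsilon)}\,dz ;$$ $\psi$ extends to a meromorphic function on $\mathcal{O}=\{(w_1,w_2,\rho,\sigma,\tau,\upsilon,x,\lambda)\in\mathbb{C}_+^2\times\mathbb{C}^6\}$. With $\Delta(\gamma;x)=\frac{G(x+i\gamma_2)G(x+i\gamma_3)}{G(x-i\gamma_0)G(x-i\gamma_1)}$ and $N(\gamma)=\prod_{j=1}^3G(i\gamma_0+i\gamma_j+iw)$, define the meromorphic function on $\mathcal{O}$ $$S(\gamma;x,\lambda)=\frac{N(\gamma)\,\psi(\gamma;x,\lambda)}{\sqrt{w_1w_2}\,\Delta(\gamma;x)\,\Delta(\hat\gamma;\lambda)}.$$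 Askey-Wilson operator: with $$A(w_1,w_2,\gamma;x)=\frac{\prod_{j=0}^3\big(1-e^{2\pi(iw+i\gamma_j+x)/w_2}\big)}{(1-e^{4\pi x/w_2})(1-e^{4\pi(x+iw)/w_2})},$$ $$\mathcal{L}_\gamma^xf(x)=A(w_1,w_2,\gamma;x)\big(f(x+iw_1)-f(x)\big)+A(w_1,w_2,\gamma;-x)\big(f(x-iw_1)-f(x)\big).$$ The superscript indicates the variable acted on; $\mathcal{L}_{\hat\gamma}^\lambda$ is the same operator with $x$ replaced by $\lambda$ and $\gamma$ by $\hat\gamma$. A tilde means that $w_1$ and $w_2$ are interchanged. Finally $$v(w_1,w_2,\gamma;\lambda)=-2e^{\pi iw_1/w_2+2\pi i\hat\gamma_0/w_2}\Big(\cosh(2\pi\lambda/w_2)+\cosh(\pi iw_1/w_2+2\pi i\hat\gamma_0/w_2)\Big),$$ so that $v(w_1,w_2,\hat\gamma;x)$ is given by the same formula with $\lambda$ replaced by $x$ and $\hat\gamma_0$ replaced by $\gamma_0$. Identities are between meromorphic functions. *)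

theory Defs
  imports "HOL-Complex_Analysis.Complex_Analysis" "HOL-Library.Numeral_Type"
begin

section \<open>Meromorphic functions of several complex variables\<close>

definition holomorphic_several_on :: "(complex ^ 'n \<Rightarrow> complex) \<Rightarrow> (complex ^ 'n) set \<Rightarrow> bool" where
  "holomorphic_several_on f U \<longleftrightarrow>
     (\<forall>p\<in>U. \<exists>D. (f has_derivative D) (at p) \<and> (\<forall>c v. D (c *s v) = c * D v))"

text \<open>\<open>h\<close> represents a non-zero-divisor: it vanishes identically on no non-empty open subset
  of \<open>V\<close>, that is, on no connected component of the open set \<open>V\<close>.\<close>

definition nowhere_identically_zero_on :: "(complex ^ 'n \<Rightarrow> complex) \<Rightarrow> (complex ^ 'n) set \<Rightarrow> bool" where
  "nowhere_identically_zero_on h V \<longleftrightarrow>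
     (\<forall>W. open W \<and> W \<subseteq> V \<and> W \<noteq> {} \<longrightarrow> (\<exists>q\<in>W. h q \<noteq> 0))"

text \<open>As with the one-variable \<open>meromorphic_on\<close>, meromorphic functions are represented by total
  functions whose values on a thin set (locally contained in the zero set of a holomorphic function
  that is not identically zero) are irrelevant. Accordingly, identities between meromorphic
  functions are identities off a thin set.\<close>

definition generically_on :: "(complex ^ 'n \<Rightarrow> bool) \<Rightarrow> (complex ^ 'n) set \<Rightarrow> bool" where
  "generically_on P U \<longleftrightarrow>
     (\<forall>p\<in>U. \<exists>V h. open V \<and> p \<in> V \<and> V \<subseteq> U \<and>
        holomorphic_several_on h V \<and> nowhere_identically_zero_on h V \<and>
        (\<forall>q\<in>V. h q \<noteq> 0 \<longrightarrow> P q))"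

definition meromorphic_several_on :: "(complex ^ 'n \<Rightarrow> complex) \<Rightarrow> (complex ^ 'n) set \<Rightarrow> bool" where
  "meromorphic_several_on f U \<longleftrightarrow>
     (\<forall>p\<in>U. \<exists>V g h. open V \<and> p \<in> V \<and> V \<subseteq> U \<and>
        holomorphic_several_on g V \<and> holomorphic_several_on h V \<and> nowhere_identically_zero_on h V \<and>
        (\<forall>q\<in>V. h q \<noteq> 0 \<longrightarrow> f q = g q / h q))"


section \<open>Functions of \<open>(w\<^sub>1, w\<^sub>2, \<rho>, \<sigma>, \<tau>, \<upsilon>, x, \<lambda>)\<close>\<close>

text \<open>The argument order is \<open>w\<^sub>1, w\<^sub>2, \<rho>, \<sigma>, \<tau>, \<upsilon>, x, \<lambda>\<close> throughout; the bound variable for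
  \<open>\<lambda>\<close> is called \<open>l\<close>. In the vector type the index \<open>8\<close> is the same as \<open>0\<close>.\<close>

type_synonym cfun8 =
  "complex \<Rightarrow> complex \<Rightarrow> complex \<Rightarrow> complex \<Rightarrow> complex \<Rightarrow> complex \<Rightarrow> complex \<Rightarrow> complex \<Rightarrow> complex"

definition uncurry8 :: "cfun8 \<Rightarrow> complex ^ 8 \<Rightarrow> complex" where
  "uncurry8 f p = f (p $ 1) (p $ 2) (p $ 3) (p $ 4) (p $ 5) (p $ 6) (p $ 7) (p $ 8)"

definition domain_O :: "(complex ^ 8) set" where
  "domain_O = {p. 0 < Re (p $ 1) \<and> 0 < Re (p $ 2)}"

definition meromorphic_on_O :: "cfun8 \<Rightarrow> bool" where
  "meromorphic_on_O f \<longleftrightarrow> meromorphic_several_on (uncurry8 f) domain_O"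

definition meromorphic_eq :: "cfun8 \<Rightarrow> cfun8 \<Rightarrow> bool" where
  "meromorphic_eq f g \<longleftrightarrow> generically_on (\<lambda>p. uncurry8 f p = uncurry8 g p) domain_O"

definition is_eigenfunction :: "(cfun8 \<Rightarrow> cfun8) \<Rightarrow> cfun8 \<Rightarrow> cfun8 \<Rightarrow> bool" where
  "is_eigenfunction L f \<mu> \<longleftrightarrow>
     meromorphic_on_O f \<and>
     \<not> meromorphic_eq f (\<lambda>w1 w2 \<rho> \<sigma> \<tau> \<upsilon> x l. 0) \<and>
     meromorphic_eq (L f)
       (\<lambda>w1 w2 \<rho> \<sigma> \<tau> \<upsilon> x l. \<mu> w1 w2 \<rho> \<sigma> \<tau> \<upsilon> x l * f w1 w2 \<rho> \<sigma> \<tau> \<upsilon> x l)"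


section \<open>The hyperbolic gamma function\<close>

definition wmean :: "complex \<Rightarrow> complex \<Rightarrow> complex" where
  "wmean w1 w2 = (w1 + w2) / 2"

definition hyp_gamma_strip :: "complex \<Rightarrow> complex \<Rightarrow> complex \<Rightarrow> complex" where
  "hyp_gamma_strip w1 w2 z =
     exp (\<i> * (LINT y:{0<..}|lborel.
       (sin (2 * complex_of_real y * z) /
          (2 * sinh (w1 * complex_of_real y) * sinh (w2 * complex_of_real y))
        - z / (w1 * w2 * complex_of_real y)) / complex_of_real y))"

text \<open>The meromorphic continuation in \<open>z\<close> is unique; \<open>nicely_meromorphic_on\<close> fixes the value
  \<open>0\<close> at the poles. The difference equations by which the continuation is usually carried out
  are consequences.\<close>

definition hyp_gamma :: "complex \<Rightarrow> complex \<Rightarrow> complex \<Rightarrow> complex" where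
  "hyp_gamma w1 w2 =
     (THE f. f nicely_meromorphic_on UNIV \<and>
        (\<forall>z. \<bar>Im z\<bar> < Re (wmean w1 w2) \<longrightarrow> f z = hyp_gamma_strip w1 w2 z))"

definition hyp_gamma_pm :: "complex \<Rightarrow> complex \<Rightarrow> complex \<Rightarrow> complex \<Rightarrow> complex" where
  "hyp_gamma_pm w1 w2 z a = hyp_gamma w1 w2 (z + a) * hyp_gamma w1 w2 (z - a)"


section \<open>Parameters\<close>

text \<open>A quadruple \<open>\<gamma>\<close> is a function on \<open>nat\<close> of which only the values at \<open>0, 1, 2, 3\<close> are used.\<close>

definition gamma_par :: "complex \<Rightarrow> complex \<Rightarrow> complex \<Rightarrow> complex \<Rightarrow> nat \<Rightarrow> complex" where
  "gamma_par \<rho> \<sigma> \<tau> \<upsilon> j = [- \<rho> + \<sigma>, \<rho> + \<sigma>, - \<tau> - \<upsilon>, \<tau> - \<upsilon>] ! j"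

definition dual_par :: "(nat \<Rightarrow> complex) \<Rightarrow> nat \<Rightarrow> complex" where
  "dual_par \<gamma> j =
     [(\<gamma> 0 + \<gamma> 1 + \<gamma> 2 + \<gamma> 3) / 2,
      (\<gamma> 0 + \<gamma> 1 - \<gamma> 2 - \<gamma> 3) / 2,
      (\<gamma> 0 - \<gamma> 1 + \<gamma> 2 - \<gamma> 3) / 2,
      (\<gamma> 0 - \<gamma> 1 - \<gamma> 2 + \<gamma> 3) / 2] ! j"


section \<open>The function \<open>S\<close>\<close>

definition psi_integral :: cfun8 where
  "psi_integral w1 w2 \<rho> \<sigma> \<tau> \<upsilon> x l =
     (LINT t|lborel.
        (let z = complex_of_real t; w = wmean w1 w2 in
          (hyp_gamma_pm w1 w2 (z + x + l / 2 - \<i> * w / 2) (\<i> * \<tau>) *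
           hyp_gamma_pm w1 w2 (z - l / 2 - \<i> * w / 2) (\<i> * \<sigma>)) /
          (hyp_gamma_pm w1 w2 (z + x - l / 2 + \<i> * w / 2) (\<i> * \<rho>) *
           hyp_gamma_pm w1 w2 (z + l / 2 + \<i> * w / 2) (\<i> * \<upsilon>))))"

definition psi_zeta :: "real \<Rightarrow> real \<Rightarrow> complex \<Rightarrow> complex \<Rightarrow> complex \<Rightarrow> complex \<Rightarrow> complex \<Rightarrow> real" where
  "psi_zeta w1 w2 \<rho> \<sigma> \<tau> \<upsilon> l =
     (w1 + w2) / 2 / 2 - Max {\<bar>Re \<rho>\<bar>, \<bar>Re \<sigma>\<bar>, \<bar>Re \<tau>\<bar>, \<bar>Re \<upsilon>\<bar>} - \<bar>Im (l / 2)\<bar>"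

text \<open>\<open>\<psi>\<close> is a meromorphic continuation to \<open>\<O>\<close> of the function given by the integral. The integral
  is only prescribed for real positive \<open>w\<^sub>1, w\<^sub>2\<close>, but as it is prescribed there on an
  open set in the remaining variables, this still determines \<open>\<psi>\<close> as a meromorphic function.\<close>

definition psi_continuation :: "cfun8 \<Rightarrow> bool" where
  "psi_continuation \<psi> \<longleftrightarrow>
     meromorphic_on_O \<psi> \<and>
     (\<forall>(w1 :: real) (w2 :: real) \<rho> \<sigma> \<tau> \<upsilon> x l.
        0 < w1 \<and> 0 < w2 \<and>
        0 < psi_zeta w1 w2 \<rho> \<sigma> \<tau> \<upsilon> l \<and> \<bar>Im x\<bar> < psi_zeta w1 w2 \<rho> \<sigma> \<tau> \<upsilon> l \<longrightarrow>
        \<psi> (complex_of_real w1) (complex_of_real w2) \<rho> \<sigma> \<tau> \<upsilon> x l =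
        psi_integral (complex_of_real w1) (complex_of_real w2) \<rho> \<sigma> \<tau> \<upsilon> x l)"

definition Delta_fun :: "complex \<Rightarrow> complex \<Rightarrow> (nat \<Rightarrow> complex) \<Rightarrow> complex \<Rightarrow> complex" where
  "Delta_fun w1 w2 \<gamma> x =
     (hyp_gamma w1 w2 (x + \<i> * \<gamma> 2) * hyp_gamma w1 w2 (x + \<i> * \<gamma> 3)) /
     (hyp_gamma w1 w2 (x - \<i> * \<gamma> 0) * hyp_gamma w1 w2 (x - \<i> * \<gamma> 1))"

definition N_fun :: "complex \<Rightarrow> complex \<Rightarrow> (nat \<Rightarrow> complex) \<Rightarrow> complex" where
  "N_fun w1 w2 \<gamma> =
     (\<Prod>j\<in>{1..3}. hyp_gamma w1 w2 (\<i> * \<gamma> 0 + \<i> * \<gamma> j + \<i> * wmean w1 w2))"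

definition S_fun :: "cfun8 \<Rightarrow> cfun8" where
  "S_fun \<psi> w1 w2 \<rho> \<sigma> \<tau> \<upsilon> x l =
     (let \<gamma> = gamma_par \<rho> \<sigma> \<tau> \<upsilon> in
       (N_fun w1 w2 \<gamma> * \<psi> w1 w2 \<rho> \<sigma> \<tau> \<upsilon> x l) /
       (csqrt (w1 * w2) * Delta_fun w1 w2 \<gamma> x * Delta_fun w1 w2 (dual_par \<gamma>) l))"


section \<open>Askey-Wilson operators\<close>

definition AW_coeff :: "complex \<Rightarrow> complex \<Rightarrow> (nat \<Rightarrow> complex) \<Rightarrow> complex \<Rightarrow> complex" where
  "AW_coeff w1 w2 \<gamma> x =
     (let w = wmean w1 w2 in
       (\<Prod>j\<in>{0..3}. 1 - exp (2 * of_real pi * (\<i> * w + \<i> * \<gamma> j + x) / w2)) /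
       ((1 - exp (4 * of_real pi * x / w2)) *
        (1 - exp (4 * of_real pi * (x + \<i> * w) / w2))))"

definition AW_op ::
  "complex \<Rightarrow> complex \<Rightarrow> (nat \<Rightarrow> complex) \<Rightarrow> (complex \<Rightarrow> complex) \<Rightarrow> complex \<Rightarrow> complex" where
  "AW_op w1 w2 \<gamma> f x =
     AW_coeff w1 w2 \<gamma> x * (f (x + \<i> * w1) - f x) +
     AW_coeff w1 w2 \<gamma> (- x) * (f (x - \<i> * w1) - f x)"

definition AW_eigenvalue :: "complex \<Rightarrow> complex \<Rightarrow> (nat \<Rightarrow> complex) \<Rightarrow> complex \<Rightarrow> complex" where
  "AW_eigenvalue w1 w2 \<gamma> l =
     (let a = of_real pi * \<i> * w1 / w2 + 2 * of_real pi * \<i> * dual_par \<gamma> 0 / w2 in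
       - 2 * exp a * (cosh (2 * of_real pi * l / w2) + cosh a))"

definition AW_x :: "cfun8 \<Rightarrow> cfun8" where
  "AW_x f w1 w2 \<rho> \<sigma> \<tau> \<upsilon> x l =
     AW_op w1 w2 (gamma_par \<rho> \<sigma> \<tau> \<upsilon>) (\<lambda>y. f w1 w2 \<rho> \<sigma> \<tau> \<upsilon> y l) x"

definition AW_x_tilde :: "cfun8 \<Rightarrow> cfun8" where
  "AW_x_tilde f w1 w2 \<rho> \<sigma> \<tau> \<upsilon> x l =
     AW_op w2 w1 (gamma_par \<rho> \<sigma> \<tau> \<upsilon>) (\<lambda>y. f w1 w2 \<rho> \<sigma> \<tau> \<upsilon> y l) x"

definition AW_lambda :: "cfun8 \<Rightarrow> cfun8" where
  "AW_lambda f w1 w2 \<rho> \<sigma> \<tau> \<upsilon> x l =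
     AW_op w1 w2 (dual_par (gamma_par \<rho> \<sigma> \<tau> \<upsilon>)) (\<lambda>m. f w1 w2 \<rho> \<sigma> \<tau> \<upsilon> x m) l"

definition AW_lambda_tilde :: "cfun8 \<Rightarrow> cfun8" where
  "AW_lambda_tilde f w1 w2 \<rho> \<sigma> \<tau> \<upsilon> x l =
     AW_op w2 w1 (dual_par (gamma_par \<rho> \<sigma> \<tau> \<upsilon>)) (\<lambda>m. f w1 w2 \<rho> \<sigma> \<tau> \<upsilon> x m) l"

end

theory Submission
  imports Defs
begin

no_notation fps_nth (infixl "$" 75)

text \<open>All identities are between meromorphic functions on the connected set \<open>domain_O\<close>, so they need only
  be checked near one point of a totally real subspace. Take the real points at which \<open>w\<^sub>2\<close> is much larger
  than \<open>w\<^sub>1\<close> and all other variables are small. There \<open>\<psi>\<close> and its shifts by \<open>\<plusminus> \<i> w\<^sub>1\<close> in \<open>x\<close> are given by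
  the integral, and the combination of the three integrands that occurs in the Askey-Wilson equation is
  \<open>D (z + \<i> w\<^sub>1) - D z\<close> for an explicit holomorphic, exponentially decaying \<open>D\<close>; shifting the contour
  shows that its integral is zero. The other three equations follow because \<open>S\<close> is invariant under exchanging
  \<open>w\<^sub>1\<close> and \<open>w\<^sub>2\<close>, and under exchanging \<open>\<rho>\<close> with \<open>\<upsilon>\<close> and \<open>x\<close> with \<open>\<lambda>\<close> (a translation of the integration
  variable), which maps \<open>\<gamma>\<close> to its dual. Finally \<open>S\<close> is not identically zero, since on another totally real
  subspace the integrand of \<open>\<psi>\<close> is positive.\<close>

section \<open>Holomorphic functions of several variables\<close>

text \<open>\<open>psi_continuation\<close> prescribes \<open>\<psi>\<close> only for real periods,
  so no open set of the eight complex variables is available for comparison; this forces identity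
  theorems on totally real subspaces. The integral represents \<open>\<psi>\<close> only for |Im x|
  < \<open>psi_zeta\<close>, which is at most (w1 + w2) / 4, so a shift of a real x by \<i> w1 stays
  in range only if w2 > 3 w1. The stronger condition 40 w1 \<le> w2 is a convenience: all gamma
  factors of the integrand, also on the shifted contour, then lie well inside the strip where
  \<open>hyp_gamma\<close> is given by its integral, and each decays at least like exp (- pi |Re z|
  / w2). Eight such factors beat the growth exp (2 pi |Re z| / w2) of the Laurent polynomial in
  \<open>D\<close>, so no sharp asymptotics of \<open>hyp_gamma\<close> enter. Since
  \<open>hyp_gamma\<close> is characterised by continuation alone, its existence and uniqueness, its
  difference equation and its joint meromorphy in periods and argument are all derived from the
  integral.\<close>

lemma holomorphic_several_onI:
  assumes "\<And>p. p \<in> U \<Longrightarrow> \<exists>D. (f has_derivative D) (at p) \<and> (\<forall>c v. D (c *s v) = c * D v)"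
  shows "holomorphic_several_on f U"
  using assms by (auto simp: holomorphic_several_on_def)

lemma holomorphic_several_on_subset:
  "holomorphic_several_on f U \<Longrightarrow> V \<subseteq> U \<Longrightarrow> holomorphic_several_on f V"
  by (auto simp: holomorphic_several_on_def)

lemma holomorphic_several_on_const [intro]: "holomorphic_several_on (\<lambda>_. c) U"
  unfolding holomorphic_several_on_def by (auto intro!: exI[of _ "\<lambda>_. 0"] derivative_eq_intros)

lemma holomorphic_several_on_nth [intro]: "holomorphic_several_on (\<lambda>p. p $ i) U"
  unfolding holomorphic_several_on_def
  by (auto intro!: exI[of _ "\<lambda>v. v $ i"] bounded_linear_imp_has_derivative bounded_linear_vec_nth)

lemma holomorphic_several_on_add [intro]:
  assumes "holomorphic_several_on f U" "holomorphic_several_on g U"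
  shows "holomorphic_several_on (\<lambda>p. f p + g p) U"
proof (rule holomorphic_several_onI)
  fix p assume "p \<in> U"
  with assms obtain D E where "(f has_derivative D) (at p)" "\<forall>c v. D (c *s v) = c * D v"
    "(g has_derivative E) (at p)" "\<forall>c v. E (c *s v) = c * E v"
    unfolding holomorphic_several_on_def by meson
  then show "\<exists>D. ((\<lambda>p. f p + g p) has_derivative D) (at p) \<and> (\<forall>c v. D (c *s v) = c * D v)"
    by (intro exI[of _ "\<lambda>v. D v + E v"]) (auto intro!: derivative_eq_intros simp: algebra_simps)
qed

lemma holomorphic_several_on_mult [intro]:
  assumes "holomorphic_several_on f U" "holomorphic_several_on g U"
  shows "holomorphic_several_on (\<lambda>p. f p * g p) U"
proof (rule holomorphic_several_onI)
  fix p assume "p \<in> U"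
  with assms obtain D E where "(f has_derivative D) (at p)" "\<forall>c v. D (c *s v) = c * D v"
    "(g has_derivative E) (at p)" "\<forall>c v. E (c *s v) = c * E v"
    unfolding holomorphic_several_on_def by meson
  then show "\<exists>D. ((\<lambda>p. f p * g p) has_derivative D) (at p) \<and> (\<forall>c v. D (c *s v) = c * D v)"
    by (intro exI[of _ "\<lambda>v. f p * E v + D v * g p"]) (auto intro!: derivative_eq_intros simp: algebra_simps)
qed

lemma holomorphic_several_on_compose1:
  assumes "holomorphic_several_on f U" "g holomorphic_on T" "open T" "\<And>p. p \<in> U \<Longrightarrow> f p \<in> T"
  shows "holomorphic_several_on (\<lambda>p. g (f p)) U"
proof (rule holomorphic_several_onI)
  fix p assume p: "p \<in> U"
  with assms(1) obtain D where D: "(f has_derivative D) (at p)" "\<forall>c v. D (c *s v) = c * D v"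
    unfolding holomorphic_several_on_def by meson
  have "(g has_field_derivative deriv g (f p)) (at (f p))"
    using assms p by (simp add: holomorphic_derivI)
  then have "(g has_derivative (*) (deriv g (f p))) (at (f p))"
    by (simp add: has_field_derivative_def)
  from has_derivative_compose[OF D(1) this]
  show "\<exists>D. ((\<lambda>p. g (f p)) has_derivative D) (at p) \<and> (\<forall>c v. D (c *s v) = c * D v)"
    using D(2) by (intro exI[of _ "\<lambda>v. deriv g (f p) * D v"]) auto
qed

lemma holomorphic_several_on_compose:
  fixes \<Phi> :: "complex ^ 'n \<Rightarrow> complex ^ 'm"
  assumes "holomorphic_several_on f V" "\<And>i. holomorphic_several_on (\<lambda>p. \<Phi> p $ i) U" "\<Phi> ` U \<subseteq> V"
  shows "holomorphic_several_on (\<lambda>p. f (\<Phi> p)) U"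
proof (rule holomorphic_several_onI)
  fix p assume p: "p \<in> U"
  have "\<forall>i. \<exists>E. ((\<lambda>p. \<Phi> p $ i) has_derivative E) (at p) \<and> (\<forall>c v. E (c *s v) = c * E v)"
    using assms(2) p unfolding holomorphic_several_on_def by meson
  then obtain E where E: "\<And>i. ((\<lambda>p. \<Phi> p $ i) has_derivative E i) (at p)"
    "\<And>i c v. E i (c *s v) = c * E i v" by metis
  from assms(1,3) p obtain D where D: "(f has_derivative D) (at (\<Phi> p))" "\<forall>c v. D (c *s v) = c * D v"
    unfolding holomorphic_several_on_def by (meson image_subset_iff)
  have "(\<Phi> has_derivative (\<lambda>v. \<chi> i. E i v)) (at p)"
  proof (subst has_derivative_componentwise_within, intro ballI)
    fix b :: "complex ^ 'm" assume "b \<in> Basis"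
    then obtain i c where b: "b = axis i c" by (auto simp: Basis_vec_def)
    have "((\<lambda>x. \<Phi> x $ i \<bullet> c) has_derivative (\<lambda>x. E i x \<bullet> c)) (at p)"
      using E(1)[of i] by (rule has_derivative_inner_left)
    then show "((\<lambda>x. \<Phi> x \<bullet> b) has_derivative (\<lambda>x. (\<chi> i. E i x) \<bullet> b)) (at p)"
      by (simp add: b inner_axis)
  qed
  from has_derivative_compose[OF this D(1)]
  have "((\<lambda>p. f (\<Phi> p)) has_derivative (\<lambda>v. D (\<chi> i. E i v))) (at p)" .
  moreover have "D (\<chi> i. E i (c *s v)) = c * D (\<chi> i. E i v)" for c v
  proof -
    have "(\<chi> i. E i (c *s v)) = c *s (\<chi> i. E i v)" by (simp add: vec_eq_iff E(2))
    then show ?thesis by (simp add: D(2))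
  qed
  ultimately show "\<exists>D. ((\<lambda>p. f (\<Phi> p)) has_derivative D) (at p) \<and> (\<forall>c v. D (c *s v) = c * D v)"
    by blast
qed

lemma holomorphic_several_on_uminus [intro]:
  assumes "holomorphic_several_on f U" shows "holomorphic_several_on (\<lambda>p. - f p) U"
  using holomorphic_several_on_mult[OF holomorphic_several_on_const[of "-1" U] assms] by simp

lemma holomorphic_several_on_diff [intro]:
  assumes "holomorphic_several_on f U" "holomorphic_several_on g U"
  shows "holomorphic_several_on (\<lambda>p. f p - g p) U"
  using holomorphic_several_on_add[OF assms(1) holomorphic_several_on_uminus[OF assms(2)]] by simp

lemma holomorphic_several_on_inverse:
  assumes "holomorphic_several_on f U" "\<And>p. p \<in> U \<Longrightarrow> f p \<noteq> 0"
  shows "holomorphic_several_on (\<lambda>p. inverse (f p)) U"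
  using assms(2) by (intro holomorphic_several_on_compose1[OF assms(1), of inverse "-{0}"])
    (auto intro!: holomorphic_intros)

lemma holomorphic_several_on_divide:
  assumes "holomorphic_several_on f U" "holomorphic_several_on g U" "\<And>p. p \<in> U \<Longrightarrow> g p \<noteq> 0"
  shows "holomorphic_several_on (\<lambda>p. f p / g p) U"
  using holomorphic_several_on_mult[OF assms(1) holomorphic_several_on_inverse[OF assms(2,3)]]
  by (simp add: field_simps)

lemma holomorphic_several_on_imp_continuous_on:
  "holomorphic_several_on f U \<Longrightarrow> continuous_on U f"
  unfolding holomorphic_several_on_def
  by (meson continuous_at_imp_continuous_on has_derivative_continuous)

text \<open>Complex homogeneity of the derivative is exactly what makes \<open>D v\<close> a complex
  derivative along the line. The identity theorems and the Taylor estimate below are obtained from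
  one-variable theorems on such lines.\<close>

lemma holomorphic_several_on_line:
  fixes p v :: "complex ^ 'n"
  assumes "holomorphic_several_on f U"
  shows "(\<lambda>t. f (p + t *s v)) holomorphic_on {t. p + t *s v \<in> U}"
proof -
  have "\<exists>D. ((\<lambda>t. f (p + t *s v)) has_field_derivative D) (at t)" if t: "p + t *s v \<in> U" for t
  proof -
    obtain D where D: "(f has_derivative D) (at (p + t *s v))" "\<forall>c v. D (c *s v) = c * D v"
      using assms t unfolding holomorphic_several_on_def by meson
    have "linear (\<lambda>s::complex. s *s v)"
      by (rule linearI) (simp_all add: vec_eq_iff algebra_simps)
    then have "bounded_linear (\<lambda>s::complex. s *s v)" by (simp add: linear_conv_bounded_linear)
    then have "((\<lambda>s. p + s *s v) has_derivative (\<lambda>s. s *s v)) (at t)"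
      by (auto intro!: derivative_eq_intros bounded_linear_imp_has_derivative)
    from has_derivative_compose[OF this D(1)]
    have "((\<lambda>t. f (p + t *s v)) has_field_derivative D v) (at t)"
      using D(2) by (simp add: has_field_derivative_def mult.commute[of "D v"] mult_commute_abs)
    then show ?thesis ..
  qed
  then show ?thesis
    by (auto simp: holomorphic_on_def field_differentiable_def intro: has_field_derivative_at_within)
qed

lemma continuous_on_line: "continuous_on A (\<lambda>t. p + t *s (v :: complex ^ 'n))"
proof -
  have "linear (\<lambda>s::complex. s *s v)"
    by (rule linearI) (simp_all add: vec_eq_iff algebra_simps)
  then show ?thesis
    by (intro continuous_intros linear_continuous_on) (simp add: linear_conv_bounded_linear)
qed

text \<open>Supplies the connected parameter domain that analytic continuation along a line
  requires.\<close>

lemma convex_line: 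
  assumes "convex B" shows "convex {t. p + t *s (v :: complex ^ 'n) \<in> B}"
proof (rule convexI)
  fix x y :: complex and a b :: real
  assume h: "x \<in> {t. p + t *s v \<in> B}" "y \<in> {t. p + t *s v \<in> B}" "0 \<le> a" "0 \<le> b" "a + b = 1"
  have "p + (a *\<^sub>R x + b *\<^sub>R y) *s v = a *\<^sub>R (p + x *s v) + b *\<^sub>R (p + y *s v)"
  proof -
    have "p = (a + b) *\<^sub>R p" using h by simp
    then have "p = a *\<^sub>R p + b *\<^sub>R p" by (simp add: scaleR_add_left)
    then show ?thesis by (simp add: vec_eq_iff algebra_simps) 
  qed
  also have "\<dots> \<in> B" using h by (intro convexD[OF assms]) auto
  finally show "a *\<^sub>R x + b *\<^sub>R y \<in> {t. p + t *s v \<in> B}" by simp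
qed

text \<open>Two points are joined by the complex line through them, on which the one-variable identity
  theorem applies.\<close>

lemma holomorphic_several_identity:
  assumes g: "holomorphic_several_on g B" and B: "convex B" "open B"
    and W: "open W" "W \<subseteq> B" "W \<noteq> {}" "\<And>p. p \<in> W \<Longrightarrow> g p = 0" and q: "q \<in> B"
  shows "g q = 0"
proof -
  obtain p where p: "p \<in> W" using W by blast
  define L where "L = (\<lambda>t. p + t *s (q - p))"
  have cL: "continuous_on UNIV L" unfolding L_def by (rule continuous_on_line)
  have o: "open (L -` B)" "open (L -` W)"
    using cL B(2) W(1) by (auto intro!: open_vimage)
  have L0: "L 0 = p" "L 1 = q" by (auto simp: L_def)
  have "(\<lambda>t. g (L t)) 1 = 0"
  proof (rule analytic_continuation_open[where f = "\<lambda>t. g (L t)" and g = "\<lambda>_. 0" and s' = "L -` B" and s = "L -` W"])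
    show "connected (L -` B)"
      using convex_line[OF B(1), of p "q - p"] by (simp add: L_def vimage_def convex_connected)
    show "(\<lambda>t. g (L t)) holomorphic_on L -` B"
      using holomorphic_several_on_line[OF g, of p "q - p"] by (simp add: L_def vimage_def)
  qed (use o L0 p q W in auto)
  then show ?thesis by (simp add: L0)
qed

text \<open>If \<open>K\<close> is an antilinear involution, every point is \<open>a + \<i> b\<close> with \<open>a\<close>, \<open>b\<close> fixed by \<open>K\<close>;
  on the complex line through \<open>a\<close> in direction \<open>b\<close> the function vanishes for real times.\<close>

lemma holomorphic_several_identity_real_form:
  fixes g :: "complex ^ 'n \<Rightarrow> complex" and K :: "complex ^ 'n \<Rightarrow> complex ^ 'n"
  assumes g: "holomorphic_several_on g (ball p r)" 
    and K: "\<And>p q. K (p + q) = K p + K q" "\<And>c p. K (c *s p) = cnj c *s K p" "\<And>p. K (K p) = p"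
      "\<And>p. norm (K p) = norm p"
    and Kp: "K p = p" 
    and z: "\<And>q. q \<in> ball p r \<Longrightarrow> K q = q \<Longrightarrow> g q = 0" and q: "q \<in> ball p r"
  shows "g q = 0"
proof -
  have Kdiff: "K (u - v) = K u - K v" for u v
    using K(1)[of u "-1 *s v"] K(2)[of "-1" v] by simp
  define a where "a = (1/2) *s (q + K q)"
  define b where "b = (-\<i>/2) *s (q - K q)"
  have Ka: "K a = a" unfolding a_def by (simp add: K add.commute)
  have Kb: "K b = b" unfolding b_def by (simp add: K Kdiff vec_eq_iff algebra_simps)
  have qab: "q = a + \<i> *s b" by (simp add: a_def b_def vec_eq_iff field_simps)
  have r0: "r > 0" using q by (smt (verit) mem_ball zero_le_dist)
  \<comment> \<open>\<open>K\<close> is an isometry fixing \<open>p\<close>, so \<open>q\<close> and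
    \<open>K q\<close> are equally far from \<open>p\<close> and their midpoint \<open>a\<close>
    stays in the ball. The line thus starts inside the ball at parameter 0 and reaches
    \<open>q\<close> at parameter \<i>.\<close>
  have aB: "a \<in> ball p r"
  proof -
    have "a - p = (1/2) *s ((q - p) + K (q - p))"
      by (simp add: a_def Kdiff Kp vec_eq_iff field_simps)
    then have "a - p = (1/2) *\<^sub>R ((q - p) + K (q - p))"
      by (simp add: vec_eq_iff complex_eq_iff)
    also have "norm \<dots> \<le> (1/2) * (norm (q - p) + norm (K (q - p)))"
      by (simp add: norm_triangle_ineq)
    also have "\<dots> = norm (q - p)" by (simp add: K)
    finally show ?thesis using q by (simp add: dist_norm norm_minus_commute)
  qed
  define L where "L = (\<lambda>t. a + t *s b)"
  have cL: "continuous_on UNIV L" unfolding L_def by (rule continuous_on_line)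
  have o: "open (L -` ball p r)" using cL by (auto intro!: open_vimage)
  have "L 0 \<in> ball p r" using aB by (simp add: L_def)
  then obtain e where e: "e > 0" "ball 0 e \<subseteq> L -` ball p r"
    using o by (meson openE vimageI2)
  have real0: "g (L (of_real t)) = 0" if "\<bar>t\<bar> < e" for t
  proof (rule z)
    show "L (of_real t) \<in> ball p r" using that e(2) by (auto simp: subset_iff)
    show "K (L (of_real t)) = L (of_real t)" by (simp add: L_def K Ka Kb)
  qed
  have "(\<lambda>t. g (L t)) \<i> = 0"
  proof (rule analytic_continuation[where S = "L -` ball p r" and U = "of_real ` {-e<..<e}" and \<xi> = 0 and f = "\<lambda>t. g (L t)"])
    show "(\<lambda>t. g (L t)) holomorphic_on L -` ball p r"
      using holomorphic_several_on_line[OF g, of a b] by (simp add: L_def vimage_def)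
    show "connected (L -` ball p r)"
      using convex_line[OF convex_ball, of a b p r] by (simp add: L_def vimage_def convex_connected)
    have "complex_of_real ` {-e<..<e} \<subseteq> ball 0 e" by auto
    then show "complex_of_real ` {-e<..<e} \<subseteq> L -` ball p r" using e(2) by (rule subset_trans)
    show "(0::complex) islimpt complex_of_real ` {-e<..<e}"
    proof (subst islimpt_approachable, intro allI impI)
      fix d :: real assume d: "d > 0"
      show "\<exists>x'\<in>complex_of_real ` {-e<..<e}. x' \<noteq> 0 \<and> dist x' 0 < d"
        by (rule bexI[of _ "of_real (min (e/2) (d/2))"]) (use d e in auto)
    qed
    show "\<i> \<in> L -` ball p r" using q by (simp add: L_def qab[symmetric])
  qed (use o \<open>L 0 \<in> ball p r\<close> real0 in auto)
  then show ?thesis by (simp add: L_def qab[symmetric])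
qed

section \<open>Thin sets and meromorphic functions of several variables\<close>

lemma nowhere_identically_zero_on_subset:
  "nowhere_identically_zero_on h V \<Longrightarrow> W \<subseteq> V \<Longrightarrow> nowhere_identically_zero_on h W"
  by (auto simp: nowhere_identically_zero_on_def) 

lemma open_nonzero:
  assumes "holomorphic_several_on h V" "open V"
  shows "open {q \<in> V. h q \<noteq> 0}"
proof -
  have "open (V \<inter> h -` (-{0}))"
    using assms by (intro continuous_open_preimage holomorphic_several_on_imp_continuous_on) auto
  moreover have "V \<inter> h -` (-{0}) = {q \<in> V. h q \<noteq> 0}" by auto
  ultimately show ?thesis by simp
qed

text \<open>On a given open set first pass to the part where \<open>g\<close> is nonzero, which is
  open by continuity, and then use \<open>h\<close> there.\<close>

lemma nowhere_identically_zero_on_mult: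
  assumes "holomorphic_several_on g V" "open V"
    "nowhere_identically_zero_on g V" "nowhere_identically_zero_on h V"
  shows "nowhere_identically_zero_on (\<lambda>p. g p * h p) V"
  unfolding nowhere_identically_zero_on_def
proof (intro allI impI)
  fix W assume W: "open W \<and> W \<subseteq> V \<and> W \<noteq> {}" 
  then obtain q where q: "q \<in> W" "g q \<noteq> 0" 
    using assms(3) unfolding nowhere_identically_zero_on_def by blast
  have "open {q \<in> W. g q \<noteq> 0}" 
    using open_nonzero[of g W] assms W holomorphic_several_on_subset by blast
  moreover have "{q \<in> W. g q \<noteq> 0} \<subseteq> V" "{q \<in> W. g q \<noteq> 0} \<noteq> {}" using W q by auto
  ultimately have "\<exists>q\<in>{q \<in> W. g q \<noteq> 0}. h q \<noteq> 0"
    using assms(4) unfolding nowhere_identically_zero_on_def by blast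
  then show "\<exists>q\<in>W. g q * h q \<noteq> 0" by auto
qed

text \<open>Convexity rules out that the two behaviours occur on different components; for this
  reason neighbourhoods are shrunk to balls.\<close>

lemma holomorphic_several_dichotomy:
  assumes "holomorphic_several_on g B" "convex B" "open B"
  obtains "\<And>q. q \<in> B \<Longrightarrow> g q = 0" | "nowhere_identically_zero_on g B"
  using holomorphic_several_identity[OF assms] unfolding nowhere_identically_zero_on_def by blast

lemma nowhere_identically_zero_on_const: "c \<noteq> 0 \<Longrightarrow> nowhere_identically_zero_on (\<lambda>_. c) V"
  by (auto simp: nowhere_identically_zero_on_def)

lemma generically_on_mono:
  assumes "generically_on P U" "\<And>p. p \<in> U \<Longrightarrow> P p \<Longrightarrow> Q p"
  shows "generically_on Q U"
  unfolding generically_on_def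
proof
  fix p assume "p \<in> U"
  then obtain V h where "open V \<and> p \<in> V \<and> V \<subseteq> U \<and>
        holomorphic_several_on h V \<and> nowhere_identically_zero_on h V \<and>
        (\<forall>q\<in>V. h q \<noteq> 0 \<longrightarrow> P q)"
    using assms(1) unfolding generically_on_def by blast
  then show "\<exists>V h. open V \<and> p \<in> V \<and> V \<subseteq> U \<and> holomorphic_several_on h V \<and>
      nowhere_identically_zero_on h V \<and> (\<forall>q\<in>V. h q \<noteq> 0 \<longrightarrow> Q q)"
    using assms(2) by (intro exI[of _ V] exI[of _ h]) (meson subsetD)
qed

lemma generically_on_conj:
  assumes "generically_on P U" "generically_on Q U"
  shows "generically_on (\<lambda>p. P p \<and> Q p) U"
  unfolding generically_on_def
proof
  fix p assume p: "p \<in> U"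
  obtain V h where V: "open V" "p \<in> V" "V \<subseteq> U" 
        "holomorphic_several_on h V" "nowhere_identically_zero_on h V"
        "\<And>q. q \<in> V \<Longrightarrow> h q \<noteq> 0 \<Longrightarrow> P q"
    using assms(1) p unfolding generically_on_def by metis
  obtain V' h' where V': "open V'" "p \<in> V'" "V' \<subseteq> U" 
        "holomorphic_several_on h' V'" "nowhere_identically_zero_on h' V'"
        "\<And>q. q \<in> V' \<Longrightarrow> h' q \<noteq> 0 \<Longrightarrow> Q q"
    using assms(2) p unfolding generically_on_def by metis
  show "\<exists>V h. open V \<and> p \<in> V \<and> V \<subseteq> U \<and> holomorphic_several_on h V \<and>
      nowhere_identically_zero_on h V \<and> (\<forall>q\<in>V. h q \<noteq> 0 \<longrightarrow> P q \<and> Q q)"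
    using V V' by (intro exI[of _ "V \<inter> V'"] exI[of _ "\<lambda>p. h p * h' p"] conjI ballI impI
        holomorphic_several_on_mult nowhere_identically_zero_on_mult)
      (auto elim: holomorphic_several_on_subset nowhere_identically_zero_on_subset)
qed

lemma generically_on_locally:
  assumes "generically_on P U" "p \<in> U"
  obtains r h where "r > 0" "ball p r \<subseteq> U" "holomorphic_several_on h (ball p r)" 
    "nowhere_identically_zero_on h (ball p r)" "\<And>q. q \<in> ball p r \<Longrightarrow> h q \<noteq> 0 \<Longrightarrow> P q"
proof -
  obtain V h where V: "open V" "p \<in> V" "V \<subseteq> U" 
        "holomorphic_several_on h V" "nowhere_identically_zero_on h V"
        "\<And>q. q \<in> V \<Longrightarrow> h q \<noteq> 0 \<Longrightarrow> P q"
    using assms unfolding generically_on_def by metis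
  obtain r where r: "r > 0" "ball p r \<subseteq> V" using V(1,2) by (meson openE)
  show ?thesis
    by (rule that[OF r(1), of h]) (use r V in \<open>auto elim: holomorphic_several_on_subset nowhere_identically_zero_on_subset\<close>)
qed

lemma meromorphic_several_on_locally:
  assumes "meromorphic_several_on f U" "p \<in> U"
  obtains r g h where "r > 0" "ball p r \<subseteq> U" "holomorphic_several_on g (ball p r)"
    "holomorphic_several_on h (ball p r)" "nowhere_identically_zero_on h (ball p r)" 
    "\<And>q. q \<in> ball p r \<Longrightarrow> h q \<noteq> 0 \<Longrightarrow> f q = g q / h q"
proof -
  obtain V g h where V: "open V" "p \<in> V" "V \<subseteq> U" "holomorphic_several_on g V" 
        "holomorphic_several_on h V" "nowhere_identically_zero_on h V"
        "\<And>q. q \<in> V \<Longrightarrow> h q \<noteq> 0 \<Longrightarrow> f q = g q / h q"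
    using assms unfolding meromorphic_several_on_def by metis
  obtain r where r: "r > 0" "ball p r \<subseteq> V" using V(1,2) by (meson openE)
  show ?thesis
    by (rule that[OF r(1), of g h]) (use r V in \<open>auto elim: holomorphic_several_on_subset nowhere_identically_zero_on_subset\<close>)
qed

lemma meromorphic_several_onI:
  assumes "\<And>p. p \<in> U \<Longrightarrow> \<exists>V g h. open V \<and> p \<in> V \<and> V \<subseteq> U \<and>
        holomorphic_several_on g V \<and> holomorphic_several_on h V \<and> nowhere_identically_zero_on h V \<and>
        (\<forall>q\<in>V. h q \<noteq> 0 \<longrightarrow> f q = g q / h q)"
  shows "meromorphic_several_on f U"
  using assms by (auto simp: meromorphic_several_on_def)

lemma holomorphic_imp_meromorphic_several:
  assumes "holomorphic_several_on f U" "open U" shows "meromorphic_several_on f U"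
  by (rule meromorphic_several_onI)
     (rule exI[of _ U], rule exI[of _ f], rule exI[of _ "\<lambda>_. 1"],
      use assms in \<open>auto intro!: nowhere_identically_zero_on_const\<close>)

text \<open>Meromorphy is a local property. This is needed because \<open>hyp_gamma\<close> is
  represented by a different product formula near each point.\<close>

lemma meromorphic_several_on_cong_locally:
  assumes "\<And>p. p \<in> U \<Longrightarrow> \<exists>V f'. open V \<and> p \<in> V \<and> meromorphic_several_on f' V \<and> (\<forall>q\<in>V. f q = f' q)"
    and "open U"
  shows "meromorphic_several_on f U"
proof (rule meromorphic_several_onI)
  fix p assume p: "p \<in> U"
  obtain V f' where V: "open V" "p \<in> V" "meromorphic_several_on f' V" "\<And>q. q \<in> V \<Longrightarrow> f q = f' q"
    using assms(1)[OF p] by metis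
  obtain r g h where r: "r > 0" "ball p r \<subseteq> V" "holomorphic_several_on g (ball p r)"
    "holomorphic_several_on h (ball p r)" "nowhere_identically_zero_on h (ball p r)" 
    "\<And>q. q \<in> ball p r \<Longrightarrow> h q \<noteq> 0 \<Longrightarrow> f' q = g q / h q"
    using meromorphic_several_on_locally[OF V(3,2)] by metis
  show "\<exists>V g h. open V \<and> p \<in> V \<and> V \<subseteq> U \<and>
        holomorphic_several_on g V \<and> holomorphic_several_on h V \<and> nowhere_identically_zero_on h V \<and>
        (\<forall>q\<in>V. h q \<noteq> 0 \<longrightarrow> f q = g q / h q)"
    using r V p assms(2)
    by (intro exI[of _ "ball p r \<inter> U"] exI[of _ g] exI[of _ h])
       (auto elim: holomorphic_several_on_subset nowhere_identically_zero_on_subset)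
qed

lemma meromorphic_several_on_locally2:
  assumes "meromorphic_several_on f U" "meromorphic_several_on g U" "p \<in> U"
  obtains V a b c d where "open V" "p \<in> V" "V \<subseteq> U" "holomorphic_several_on a V" "holomorphic_several_on b V" 
    "holomorphic_several_on c V" "holomorphic_several_on d V" "nowhere_identically_zero_on (\<lambda>q. b q * d q) V" 
    "\<And>q. q \<in> V \<Longrightarrow> b q * d q \<noteq> 0 \<Longrightarrow> f q = a q / b q \<and> g q = c q / d q"
proof -
  obtain r a b where r: "r > 0" "ball p r \<subseteq> U" "holomorphic_several_on a (ball p r)"
    "holomorphic_several_on b (ball p r)" "nowhere_identically_zero_on b (ball p r)" 
    "\<And>q. q \<in> ball p r \<Longrightarrow> b q \<noteq> 0 \<Longrightarrow> f q = a q / b q"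
    using meromorphic_several_on_locally[OF assms(1,3)] by metis
  obtain s c d where s: "s > 0" "ball p s \<subseteq> U" "holomorphic_several_on c (ball p s)"
    "holomorphic_several_on d (ball p s)" "nowhere_identically_zero_on d (ball p s)" 
    "\<And>q. q \<in> ball p s \<Longrightarrow> d q \<noteq> 0 \<Longrightarrow> g q = c q / d q"
    using meromorphic_several_on_locally[OF assms(2,3)] by metis
  define V where "V = ball p r \<inter> ball p s"
  have V: "open V" "p \<in> V" "V \<subseteq> U" using r s by (auto simp: V_def)
  have h: "holomorphic_several_on a V" "holomorphic_several_on b V" "holomorphic_several_on c V"
    "holomorphic_several_on d V" "nowhere_identically_zero_on b V" "nowhere_identically_zero_on d V"
    using r s unfolding V_def by (auto elim: holomorphic_several_on_subset nowhere_identically_zero_on_subset)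
  show ?thesis
  proof (rule that[OF V h(1-4)])
    show "nowhere_identically_zero_on (\<lambda>q. b q * d q) V" using h V by (auto intro!: nowhere_identically_zero_on_mult)
    show "f q = a q / b q \<and> g q = c q / d q" if "q \<in> V" "b q * d q \<noteq> 0" for q
      using r(6)[of q] s(6)[of q] that by (auto simp: V_def)
  qed
qed

lemma meromorphic_several_on_add:
  assumes "meromorphic_several_on f U" "meromorphic_several_on g U" 
  shows "meromorphic_several_on (\<lambda>p. f p + g p) U"
proof (rule meromorphic_several_onI, goal_cases)
  case (1 p)
  show ?case
  proof (rule meromorphic_several_on_locally2[OF assms 1], goal_cases)
    case (1 V a b c d)
    show ?case by (rule exI[of _ V], rule exI[of _ "\<lambda>q. a q * d q + c q * b q"], rule exI[of _ "\<lambda>q. b q * d q"])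
      (use 1 in \<open>auto simp: field_simps\<close>)
  qed
qed

lemma meromorphic_several_on_mult:
  assumes "meromorphic_several_on f U" "meromorphic_several_on g U" 
  shows "meromorphic_several_on (\<lambda>p. f p * g p) U"
proof (rule meromorphic_several_onI, goal_cases)
  case (1 p)
  show ?case
  proof (rule meromorphic_several_on_locally2[OF assms 1], goal_cases)
    case (1 V a b c d)
    show ?case by (rule exI[of _ V], rule exI[of _ "\<lambda>q. a q * c q"], rule exI[of _ "\<lambda>q. b q * d q"])
      (use 1 in \<open>auto simp: field_simps\<close>)
  qed
qed

text \<open>Where \<open>f\<close> vanishes identically, so does \<open>inverse f\<close>, because \<open>inverse 0 = 0\<close>.\<close>

lemma meromorphic_several_on_inverse:
  assumes "meromorphic_several_on f U" 
  shows "meromorphic_several_on (\<lambda>p. inverse (f p)) U"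
proof (rule meromorphic_several_onI)
  fix p assume p: "p \<in> U"
  obtain r a b where r: "r > 0" "ball p r \<subseteq> U" "holomorphic_several_on a (ball p r)"
    "holomorphic_several_on b (ball p r)" "nowhere_identically_zero_on b (ball p r)" 
    "\<And>q. q \<in> ball p r \<Longrightarrow> b q \<noteq> 0 \<Longrightarrow> f q = a q / b q"
    using meromorphic_several_on_locally[OF assms(1) p] by metis
  show "\<exists>V g' h. open V \<and> p \<in> V \<and> V \<subseteq> U \<and>
        holomorphic_several_on g' V \<and> holomorphic_several_on h V \<and> nowhere_identically_zero_on h V \<and>
        (\<forall>q\<in>V. h q \<noteq> 0 \<longrightarrow> inverse (f q) = g' q / h q)"
  proof (rule holomorphic_several_dichotomy[OF r(3) convex_ball open_ball])
    assume a0: "\<And>q. q \<in> ball p r \<Longrightarrow> a q = 0"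
    show ?thesis
    proof (rule exI[of _ "ball p r"], rule exI[of _ "\<lambda>_. 0"], rule exI[of _ b], intro conjI ballI impI)
      fix q assume "q \<in> ball p r" "b q \<noteq> 0"
      then show "inverse (f q) = 0 / b q" using r(6) a0 by simp
    qed (use r in auto)
  next
    assume a: "nowhere_identically_zero_on a (ball p r)"
    show ?thesis
    proof (rule exI[of _ "ball p r"], rule exI[of _ "\<lambda>q. b q * b q"], rule exI[of _ "\<lambda>q. a q * b q"],
        intro conjI ballI impI)
      fix q assume "q \<in> ball p r" "a q * b q \<noteq> 0"
      then show "inverse (f q) = b q * b q / (a q * b q)" using r(6) by simp
    qed (use r a in \<open>auto intro!: nowhere_identically_zero_on_mult\<close>)
  qed
qed

lemma meromorphic_several_on_divide:
  assumes "meromorphic_several_on f U" "meromorphic_several_on g U" 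
  shows "meromorphic_several_on (\<lambda>p. f p / g p) U"
  using meromorphic_several_on_mult[OF assms(1) meromorphic_several_on_inverse[OF assms(2)]]
  by (simp add: field_simps)

lemma meromorphic_several_on_const: "open U \<Longrightarrow> meromorphic_several_on (\<lambda>_. c) U"
  by (intro holomorphic_imp_meromorphic_several) auto

lemma meromorphic_several_on_diff:
  assumes "meromorphic_several_on f U" "meromorphic_several_on g U" "open U"
  shows "meromorphic_several_on (\<lambda>p. f p - g p) U"
  using meromorphic_several_on_add[OF assms(1) meromorphic_several_on_mult[OF
      meromorphic_several_on_const[OF assms(3), of "-1"] assms(2)]] by simp

lemma meromorphic_several_on_prod:
  assumes "\<And>i. i \<in> A \<Longrightarrow> meromorphic_several_on (f i) U" "open U"
  shows "meromorphic_several_on (\<lambda>p. \<Prod>i\<in>A. f i p) U"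
  using assms(1) by (induction A rule: infinite_finite_induct)
    (auto intro!: meromorphic_several_on_const meromorphic_several_on_mult assms(2))

text \<open>The instances are translations of one variable by a multiple of a period and
  permutations of the variables. The continuous inverse makes \<open>\<Phi>\<close> an open map, and
  openness is what lets a nowhere identically vanishing denominator remain one after composition
  with \<open>\<Phi>\<close>.\<close>

locale holomorphic_automorphism =
  fixes \<Phi> \<Psi> :: "complex ^ 'n \<Rightarrow> complex ^ 'n" and U :: "(complex ^ 'n) set"
  assumes holo: "\<And>i. holomorphic_several_on (\<lambda>p. \<Phi> p $ i) UNIV"
    and cont: "continuous_on UNIV \<Psi>"
    and inv: "\<And>p. \<Phi> (\<Psi> p) = p" "\<And>p. \<Psi> (\<Phi> p) = p"
    and U: "\<And>p. p \<in> U \<Longrightarrow> \<Phi> p \<in> U"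
begin

lemma cont\<Phi>: "continuous_on UNIV \<Phi>"
proof -
  have "continuous_on UNIV (\<lambda>p. \<chi> i. \<Phi> p $ i)"
    by (intro continuous_on_vec_lambda holomorphic_several_on_imp_continuous_on[OF holo])
  then show ?thesis by simp
qed

lemma open_image: "open W \<Longrightarrow> open (\<Phi> ` W)"
proof -
  assume "open W"
  then have "open (\<Psi> -` W)" using cont by (rule open_vimage)
  moreover have "\<Psi> -` W = \<Phi> ` W"
    by (auto simp: inv image_iff intro!: bexI[of _ "\<Psi> _"])
  ultimately show ?thesis by simp
qed

lemma compose:
  assumes "holomorphic_several_on f V" shows "holomorphic_several_on (\<lambda>p. f (\<Phi> p)) (\<Phi> -` V)"
  by (rule holomorphic_several_on_compose[OF assms]) (auto intro: holomorphic_several_on_subset[OF holo])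

lemma nowhere:
  assumes "nowhere_identically_zero_on h V"
  shows "nowhere_identically_zero_on (\<lambda>p. h (\<Phi> p)) (\<Phi> -` V)"
  unfolding nowhere_identically_zero_on_def
proof (intro allI impI)
  fix W assume W: "open W \<and> W \<subseteq> \<Phi> -` V \<and> W \<noteq> {}"
  have "open (\<Phi> ` W)" "\<Phi> ` W \<subseteq> V" "\<Phi> ` W \<noteq> {}" using W open_image by auto
  then have "\<exists>q\<in>\<Phi> ` W. h q \<noteq> 0" using assms unfolding nowhere_identically_zero_on_def by blast
  then show "\<exists>q\<in>W. h (\<Phi> q) \<noteq> 0" by auto
qed

lemma meromorphic_compose:
  assumes "meromorphic_several_on f U" "open U"
  shows "meromorphic_several_on (\<lambda>p. f (\<Phi> p)) U"
proof (rule meromorphic_several_onI)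
  fix p assume p: "p \<in> U"
  obtain r a b where r: "r > 0" "ball (\<Phi> p) r \<subseteq> U" "holomorphic_several_on a (ball (\<Phi> p) r)"
    "holomorphic_several_on b (ball (\<Phi> p) r)" "nowhere_identically_zero_on b (ball (\<Phi> p) r)" 
    "\<And>q. q \<in> ball (\<Phi> p) r \<Longrightarrow> b q \<noteq> 0 \<Longrightarrow> f q = a q / b q"
    using meromorphic_several_on_locally[OF assms(1) U[OF p]] by metis
  have "open (\<Phi> -` ball (\<Phi> p) r)" by (intro open_vimage cont\<Phi>) auto
  then show "\<exists>V g h. open V \<and> p \<in> V \<and> V \<subseteq> U \<and>
        holomorphic_several_on g V \<and> holomorphic_several_on h V \<and> nowhere_identically_zero_on h V \<and>
        (\<forall>q\<in>V. h q \<noteq> 0 \<longrightarrow> f (\<Phi> q) = g q / h q)"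
    using r compose[OF r(3)] compose[OF r(4)] nowhere[OF r(5)] p assms(2)
    by (intro exI[of _ "\<Phi> -` ball (\<Phi> p) r \<inter> U"] exI[of _ "\<lambda>q. a (\<Phi> q)"] exI[of _ "\<lambda>q. b (\<Phi> q)"])
       (auto elim: holomorphic_several_on_subset nowhere_identically_zero_on_subset)
qed

lemma generically_compose:
  assumes "generically_on P U" "open U"
  shows "generically_on (\<lambda>p. P (\<Phi> p)) U"
  unfolding generically_on_def
proof
  fix p assume p: "p \<in> U"
  obtain r b where r: "r > 0" "ball (\<Phi> p) r \<subseteq> U" 
    "holomorphic_several_on b (ball (\<Phi> p) r)" "nowhere_identically_zero_on b (ball (\<Phi> p) r)" 
    "\<And>q. q \<in> ball (\<Phi> p) r \<Longrightarrow> b q \<noteq> 0 \<Longrightarrow> P q"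
    using generically_on_locally[OF assms(1) U[OF p]] by metis
  have "open (\<Phi> -` ball (\<Phi> p) r)" by (intro open_vimage cont\<Phi>) auto
  then show "\<exists>V h. open V \<and> p \<in> V \<and> V \<subseteq> U \<and>
        holomorphic_several_on h V \<and> nowhere_identically_zero_on h V \<and>
        (\<forall>q\<in>V. h q \<noteq> 0 \<longrightarrow> P (\<Phi> q))"
    using r compose[OF r(3)] nowhere[OF r(4)] p assms(2)
    by (intro exI[of _ "\<Phi> -` ball (\<Phi> p) r \<inter> U"] exI[of _ "\<lambda>q. b (\<Phi> q)"])
       (auto elim: holomorphic_several_on_subset nowhere_identically_zero_on_subset)
qed

end

section \<open>Identity theorems for meromorphic functions\<close>

lemma generically_on_imp_ex:
  assumes "generically_on P U" "open W" "W \<subseteq> U" "W \<noteq> {}"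
  shows "\<exists>q\<in>W. P q"
proof -
  obtain p where p: "p \<in> W" using assms by blast
  obtain r h where r: "r > 0" "ball p r \<subseteq> U" "nowhere_identically_zero_on h (ball p r)" 
    "\<And>q. q \<in> ball p r \<Longrightarrow> h q \<noteq> 0 \<Longrightarrow> P q"
    using generically_on_locally[OF assms(1)] p assms(3) by (metis subsetD)
  have "\<exists>q\<in>ball p r \<inter> W. h q \<noteq> 0"
    using r(1,3) p assms(2) unfolding nowhere_identically_zero_on_def
    by (metis Int_iff Int_lower1 centre_in_ball empty_iff open_Int open_ball)
  then show ?thesis using r(4) by blast
qed

text \<open>The set of points near which a meromorphic function vanishes generically is open and closed.\<close>

lemma meromorphic_several_identity:
  assumes F: "meromorphic_several_on F U" and U: "open U" "connected U"
    and p0: "open V" "p0 \<in> V" "V \<subseteq> U" and F0: "generically_on (\<lambda>p. F p = 0) V"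
  shows "generically_on (\<lambda>p. F p = 0) U"
proof -
  define Z where "Z = {p \<in> U. \<exists>V. open V \<and> p \<in> V \<and> V \<subseteq> U \<and> generically_on (\<lambda>p. F p = 0) V}"
  have "open Z"
  proof (subst open_subopen, safe)
    fix p assume "p \<in> Z"
    then obtain V where "open V" "p \<in> V" "V \<subseteq> U" "generically_on (\<lambda>p. F p = 0) V" by (auto simp: Z_def)
    then show "\<exists>T. open T \<and> p \<in> T \<and> T \<subseteq> Z" by (intro exI[of _ V]) (auto simp: Z_def)
  qed
  moreover have "open (U - Z)"
  proof (subst open_subopen, safe)
    fix p assume p: "p \<in> U" "p \<notin> Z"
    obtain r a b where r: "r > 0" "ball p r \<subseteq> U" "holomorphic_several_on a (ball p r)"
      "holomorphic_several_on b (ball p r)" "nowhere_identically_zero_on b (ball p r)" 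
      "\<And>q. q \<in> ball p r \<Longrightarrow> b q \<noteq> 0 \<Longrightarrow> F q = a q / b q"
      using meromorphic_several_on_locally[OF F p(1)] by metis
    \<comment> \<open>Otherwise the numerator vanishes on the whole ball, \<open>F\<close> is
      generically zero there and \<open>p\<close> belongs to \<open>Z\<close>. So \<open>F\<close>
      is generically nonzero near \<open>p\<close>, which excludes points of \<open>Z\<close> from
      the ball.\<close>
    have an: "nowhere_identically_zero_on a (ball p r)"
    proof (rule holomorphic_several_dichotomy[OF r(3) convex_ball open_ball])
      assume "\<And>q. q \<in> ball p r \<Longrightarrow> a q = 0"
      then have "generically_on (\<lambda>p. F p = 0) (ball p r)"
        unfolding generically_on_def using r by (intro ballI exI[of _ "ball p r"] exI[of _ b]) auto
      with p r have False by (auto simp: Z_def dest!: spec[of _ "ball p r"])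
      then show ?thesis ..
    qed
    have "ball p r \<inter> Z = {}"
    proof safe
      fix q assume q: "q \<in> ball p r" "q \<in> Z"
      then obtain V where V: "open V" "q \<in> V" "V \<subseteq> U" "generically_on (\<lambda>p. F p = 0) V" by (auto simp: Z_def)
      have "nowhere_identically_zero_on (\<lambda>q. a q * b q) (ball p r)"
        by (rule nowhere_identically_zero_on_mult[OF r(3) open_ball an r(5)])
      then obtain q1 where q1: "q1 \<in> ball p r \<inter> V" "a q1 * b q1 \<noteq> 0"
        using V q unfolding nowhere_identically_zero_on_def
        by (metis Int_iff Int_lower1 empty_iff open_Int open_ball)
      have "open ({q \<in> ball p r. a q * b q \<noteq> 0} \<inter> V)"
        using r V by (intro open_Int open_nonzero holomorphic_several_on_mult) auto
      then obtain q2 where "q2 \<in> {q \<in> ball p r. a q * b q \<noteq> 0} \<inter> V" "F q2 = 0"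
        using generically_on_imp_ex[OF V(4), of "{q \<in> ball p r. a q * b q \<noteq> 0} \<inter> V"] q1 by blast
      then show "q \<in> {}" using r(6)[of q2] by auto
    qed
    then show "\<exists>T. open T \<and> p \<in> T \<and> T \<subseteq> U - Z" using r by (intro exI[of _ "ball p r"]) auto
  qed
  moreover have "p0 \<in> Z" using p0 F0 by (auto simp: Z_def)
  ultimately have "U - Z = {}"
  proof -
    assume o: "open Z" "open (U - Z)" "p0 \<in> Z"
    have "Z \<inter> (U - Z) \<inter> U = {}" "U \<subseteq> Z \<union> (U - Z)" by auto
    then have "Z \<inter> U = {} \<or> (U - Z) \<inter> U = {}" by (rule connectedD[OF U(2) o(1,2)])
    moreover have "p0 \<in> U" using p0 by auto
    ultimately show ?thesis using o(3) by auto
  qed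
  moreover have "Z \<subseteq> U" unfolding Z_def by blast
  ultimately have "U = Z" by blast
  show ?thesis
    unfolding generically_on_def
  proof
    fix p assume "p \<in> U"
    then have "p \<in> Z" using \<open>U = Z\<close> by simp
    then obtain V where V: "open V" "p \<in> V" "V \<subseteq> U" "generically_on (\<lambda>p. F p = 0) V" 
      unfolding Z_def by blast
    obtain r h where r: "r > 0" "ball p r \<subseteq> V" "holomorphic_several_on h (ball p r)" 
      "nowhere_identically_zero_on h (ball p r)" "\<And>q. q \<in> ball p r \<Longrightarrow> h q \<noteq> 0 \<Longrightarrow> F q = 0"
      using generically_on_locally[OF V(4,2)] by metis
    show "\<exists>V h. open V \<and> p \<in> V \<and> V \<subseteq> U \<and> holomorphic_several_on h V \<and>
        nowhere_identically_zero_on h V \<and> (\<forall>q\<in>V. h q \<noteq> 0 \<longrightarrow> F q = 0)"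
      by (rule exI[of _ "ball p r"], rule exI[of _ h]) (use r V in auto)
  qed
qed

text \<open>The value of \<open>F\<close> carries no information where the denominator
  \<open>b\<close> vanishes, so its zeros at real points cannot be transferred directly. The product
  of numerator and denominator vanishes at every real point, whichever of the two is responsible,
  hence on a ball; off the zeros of \<open>b\<close> this gives \<open>F\<close> = 0.\<close>

lemma meromorphic_several_identity_real_form:
  fixes F :: "complex ^ 'n \<Rightarrow> complex" and K :: "complex ^ 'n \<Rightarrow> complex ^ 'n"
  assumes F: "meromorphic_several_on F U" and U: "open U" "connected U"
    and K: "\<And>p q. K (p + q) = K p + K q" "\<And>c p. K (c *s p) = cnj c *s K p" "\<And>p. K (K p) = p"
      "\<And>p. norm (K p) = norm p"
    and Kp: "K p = p" "p \<in> U" "r > 0"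
    and z: "\<And>q. dist p q < r \<Longrightarrow> K q = q \<Longrightarrow> F q = 0" 
  shows "generically_on (\<lambda>p. F p = 0) U"
proof -
  obtain s a b where s: "s > 0" "ball p s \<subseteq> U" "holomorphic_several_on a (ball p s)"
      "holomorphic_several_on b (ball p s)" "nowhere_identically_zero_on b (ball p s)" 
      "\<And>q. q \<in> ball p s \<Longrightarrow> b q \<noteq> 0 \<Longrightarrow> F q = a q / b q"
    using meromorphic_several_on_locally[OF F Kp(2)] by metis
  define t where "t = min r s"
  have t: "t > 0" "ball p t \<subseteq> ball p s" "ball p t \<subseteq> ball p r" using s Kp by (auto simp: t_def)
  have ab: "a q * b q = 0" if "q \<in> ball p t" for q
  proof (rule holomorphic_several_identity_real_form[of "\<lambda>q. a q * b q" p t K, OF _ K Kp(1) _ that])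
    show "holomorphic_several_on (\<lambda>q. a q * b q) (ball p t)"
      using s t by (auto elim: holomorphic_several_on_subset)
    fix q assume q: "q \<in> ball p t" "K q = q"
    then have "F q = 0" using z t by (auto simp: subset_iff)
    then show "a q * b q = 0" using s(6)[of q] q t by (cases "b q = 0") auto
  qed
  have "generically_on (\<lambda>p. F p = 0) (ball p t)"
    unfolding generically_on_def
  proof (intro ballI exI conjI impI)
    show "holomorphic_several_on b (ball p t)" "nowhere_identically_zero_on b (ball p t)"
      using s t by (auto elim: holomorphic_several_on_subset nowhere_identically_zero_on_subset)
    fix q assume "q \<in> ball p t" "b q \<noteq> 0"
    then show "F q = 0" using ab[of q] s(6)[of q] t by auto
  qed auto
  then show ?thesis
    using s t by (intro meromorphic_several_identity[OF F U open_ball, of p]) auto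
qed

text \<open>If \<open>F\<close> were generically zero, the function \<open>b\<close> whose zero set
  contains the exceptions would have to vanish at all real points near \<open>p\<close>, hence
  identically.\<close>

lemma not_generically_zero_real_form:
  fixes F :: "complex ^ 'n \<Rightarrow> complex" and K :: "complex ^ 'n \<Rightarrow> complex ^ 'n"
  assumes K: "\<And>p q. K (p + q) = K p + K q" "\<And>c p. K (c *s p) = cnj c *s K p" "\<And>p. K (K p) = p"
      "\<And>p. norm (K p) = norm p"
    and Kp: "K p = p" "p \<in> U" "r > 0"
    and nz: "\<And>q. dist p q < r \<Longrightarrow> K q = q \<Longrightarrow> F q \<noteq> 0" 
  shows "\<not> generically_on (\<lambda>p. F p = 0) U"
proof
  assume gen: "generically_on (\<lambda>p. F p = 0) U"
  obtain s b where s: "s > 0" "ball p s \<subseteq> U" 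
      "holomorphic_several_on b (ball p s)" "nowhere_identically_zero_on b (ball p s)" 
      "\<And>q. q \<in> ball p s \<Longrightarrow> b q \<noteq> 0 \<Longrightarrow> F q = 0"
    using generically_on_locally[OF gen Kp(2)] by metis
  define t where "t = min r s"
  have t: "t > 0" "ball p t \<subseteq> ball p s" "ball p t \<subseteq> ball p r" using s Kp by (auto simp: t_def)
  have "b q = 0" if "q \<in> ball p t" for q
  proof (rule holomorphic_several_identity_real_form[of b p t K, OF _ K Kp(1) _ that])
    show "holomorphic_several_on b (ball p t)"
      using s t by (auto elim: holomorphic_several_on_subset)
    fix q assume q: "q \<in> ball p t" "K q = q"
    then show "b q = 0" using nz[of q] s(5)[of q] by (auto simp: t_def)
  qed
  then show False 
    using s(4)[unfolded nowhere_identically_zero_on_def, rule_format, of "ball p t"] t by auto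
qed

section \<open>Parameter integrals\<close>

text \<open>The remainder is controlled by a bound on the values of \<open>f\<close> alone, with a
  constant independent of \<open>f\<close>. This uniformity is what permits differentiation under
  the integral sign.\<close>

lemma holomorphic_several_taylor1:
  assumes f: "holomorphic_several_on f (ball p r)" 
    and B: "\<And>q. q \<in> ball p r \<Longrightarrow> norm (f q) \<le> B" and D: "(f has_derivative D) (at p)" 
    and Dlin: "\<And>c v. D (c *s v) = c * D v" and v: "norm v < r / 4"
  shows "norm (f (p + v) - f p - D v) \<le> 8 * B / r\<^sup>2 * (norm v)\<^sup>2"
proof (cases "v = 0")
  case True
  have "norm (D (0 *s 0)) = 0" by (subst Dlin) simp
  then have "D 0 = 0" by simp
  then show ?thesis using True by simp
next
  case False
  have r: "r > 0" using v norm_ge_zero[of v] by linarith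
  have B0: "B \<ge> 0" using B[of p] r norm_ge_zero[of "f p"] by (smt (verit) centre_in_ball)
  \<comment> \<open>The radius of the disc of parameters t for which p + t v lies in the ball. As R
    > 4, discs of radius R / 2 about points of modulus below 2 stay inside it, and Cauchy's
    inequality there gives the factor 2 / (1/2)^2 = 8.\<close>
  define R where "R = r / norm v"
  have R: "R > 4" using v False by (simp add: R_def field_simps)
  define \<phi> where "\<phi> = (\<lambda>t. f (p + t *s v))"
  have norm_smult: "norm (t *s v) = norm t * norm v" for t
    by (simp add: norm_vec_def L2_set_def norm_mult power_mult_distrib sum_distrib_left[symmetric] real_sqrt_mult)
  have mem: "p + t *s v \<in> ball p r \<longleftrightarrow> norm t < R" for t
    using False by (simp add: dist_norm norm_smult R_def field_simps)
  have hol: "\<phi> holomorphic_on ball 0 R"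
    using holomorphic_several_on_line[OF f, of p v] unfolding \<phi>_def mem by (simp add: ball_def dist_norm)
  have bd: "norm (\<phi> t) \<le> B" if "norm t < R" for t
    unfolding \<phi>_def by (rule B) (use that mem in blast)
  have d2: "norm ((deriv ^^ Suc 1) \<phi> \<xi>) \<le> fact 2 * B / (R/2)^2" if "\<xi> \<in> ball 0 2" for \<xi>
  proof -
    have sub: "cball \<xi> (R/2) \<subseteq> ball 0 R"
    proof
      fix x assume "x \<in> cball \<xi> (R/2)"
      then have "norm x \<le> norm \<xi> + R/2" using norm_triangle_ineq[of \<xi> "x - \<xi>"] by (simp add: dist_norm norm_minus_commute)
      then show "x \<in> ball 0 R" using that R by simp
    qed
    have "norm ((deriv ^^ 2) \<phi> \<xi>) \<le> fact 2 * B / (R/2)^2"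
    proof (rule Cauchy_inequality)
      show "\<phi> holomorphic_on ball \<xi> (R/2)" using hol sub holomorphic_on_subset ball_subset_cball by (metis subset_trans)
      show "continuous_on (cball \<xi> (R/2)) \<phi>" using hol sub holomorphic_on_imp_continuous_on continuous_on_subset by blast
      show "0 < R / 2" using R by simp
      fix x assume "norm (\<xi> - x) = R / 2"
      then have "x \<in> cball \<xi> (R/2)" by (simp add: dist_norm)
      then have "x \<in> ball 0 R" using sub by blast
      then show "norm (\<phi> x) \<le> B" using bd by simp
    qed
    then show ?thesis by (simp add: numeral_2_eq_2)
  qed
  have "norm ((deriv ^^ 0) \<phi> 1 - (\<Sum>i\<le>1. (deriv ^^ i) \<phi> 0 * (1 - 0) ^ i / fact i)) \<le> (fact 2 * B / (R/2)^2) * norm (1 - 0 :: complex) ^ Suc 1 / fact 1"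
  proof (rule complex_Taylor[where S = "ball 0 2" and f = "\<lambda>i. (deriv ^^ i) \<phi>"])
    show "((deriv ^^ i) \<phi> has_field_derivative (deriv ^^ Suc i) \<phi> x) (at x within ball 0 2)" if "x \<in> ball 0 2" "i \<le> (1::nat)" for i x
    proof -
      have "((deriv ^^ i) \<phi>) holomorphic_on ball 0 R"
        using hol by (intro holomorphic_higher_deriv) auto
      then have "((deriv ^^ i) \<phi> has_field_derivative deriv ((deriv ^^ i) \<phi>) x) (at x)"
        using that R by (intro holomorphic_derivI[of _ "ball 0 R"]) auto
      then show ?thesis by (simp add: has_field_derivative_at_within)
    qed
  qed (use d2 in auto)
  then have "norm (\<phi> 1 - \<phi> 0 - deriv \<phi> 0) \<le> 8 * B / R^2"
    by (simp add: algebra_simps power_divide)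
  moreover have "deriv \<phi> 0 = D v"
  proof (rule DERIV_imp_deriv)
    have "linear (\<lambda>s::complex. s *s v)"
      by (rule linearI) (simp_all add: vec_eq_iff algebra_simps)
    then have "bounded_linear (\<lambda>s::complex. s *s v)" by (simp add: linear_conv_bounded_linear)
    then have *: "((\<lambda>s. p + s *s v) has_derivative (\<lambda>s. s *s v)) (at 0)"
      by (auto intro!: derivative_eq_intros bounded_linear_imp_has_derivative)
    have "(f has_derivative D) (at (p + 0 *s v))" using D by simp
    from has_derivative_compose[OF * this]
    show "(\<phi> has_field_derivative D v) (at 0)"
      using Dlin by (simp add: has_field_derivative_def \<phi>_def mult.commute[of "D v"] mult_commute_abs)
  qed
  ultimately show ?thesis using False by (simp add: \<phi>_def R_def field_simps power_divide)
qed

text \<open>By \<open>holomorphic_several_taylor1\<close> a local majorant \<open>B\<close> for the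
  values of \<open>f\<close> also controls derivative and remainder, so the integral of the
  derivatives approximates the increment of the integral with an error of order |v|^2.\<close>

lemma holomorphic_several_on_integral:
  fixes f :: "complex ^ 'n \<Rightarrow> 'b \<Rightarrow> complex" 
  assumes hol: "\<And>y. y \<in> space M \<Longrightarrow> holomorphic_several_on (\<lambda>p. f p y) U"
    and meas: "\<And>p. p \<in> U \<Longrightarrow> f p \<in> borel_measurable M"
    and dom: "\<And>p. p \<in> U \<Longrightarrow> \<exists>r>0. \<exists>B. ball p r \<subseteq> U \<and> integrable M B \<and> 
      (\<forall>q\<in>ball p r. \<forall>y\<in>space M. norm (f q y) \<le> (B y :: real))"
  shows "holomorphic_several_on (\<lambda>p. \<integral>y. f p y \<partial>M) U"
proof (rule holomorphic_several_onI)
  fix p assume "p \<in> U"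
  with dom obtain r B where r: "r > 0" "ball p r \<subseteq> U" and B: "integrable M B" 
    and fB: "\<And>q y. q \<in> ball p r \<Longrightarrow> y \<in> space M \<Longrightarrow> norm (f q y) \<le> B y" by metis
  have "\<forall>y\<in>space M. \<exists>D. ((\<lambda>p. f p y) has_derivative D) (at p) \<and> (\<forall>c v. D (c *s v) = c * D v)"
    using hol \<open>p \<in> U\<close> unfolding holomorphic_several_on_def by blast
  then obtain D where D: "\<And>y. y \<in> space M \<Longrightarrow> ((\<lambda>p. f p y) has_derivative D y) (at p)"
    and Dlin: "\<And>y c v. y \<in> space M \<Longrightarrow> D y (c *s v) = c * D y v" by metis
  have Dadd: "D y (u + v) = D y u + D y v" if "y \<in> space M" for y u v
    using has_derivative_bounded_linear[OF D[OF that]] by (simp add: bounded_linear.linear linear_add)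
  have int_f: "integrable M (f q)" if "q \<in> ball p r" for q
    by (rule Bochner_Integration.integrable_bound[OF B]) (use that r fB meas in \<open>auto intro!: AE_I2 order_trans[OF fB]\<close>)
  have T: "norm (f (p + v) y - f p y - D y v) \<le> 8 * B y / r\<^sup>2 * (norm v)\<^sup>2" 
    if "y \<in> space M" "norm v < r / 4" for y v
    using holomorphic_several_taylor1[OF holomorphic_several_on_subset[OF hol[OF that(1)] r(2)] _ D[OF that(1)] Dlin[OF that(1)] that(2)]
      fB that by blast
  have measD: "(\<lambda>y. D y v) \<in> borel_measurable M" for v
  proof (cases "v = 0")
    case True
    have "D y v = 0" if "y \<in> space M" for y
      using Dlin[OF that, of 0 v] True by simp
    then show ?thesis by (simp cong: measurable_cong)
  next
    case v: False
    \<comment> \<open>Step sizes tending to 0; the 8 keeps every step within the radius r / 4 of the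
      Taylor estimate. The derivative is measurable as a limit of these difference
      quotients.\<close>
    define s where "s = (\<lambda>n. r / (8 * norm v * real (Suc n)))"
    have s: "s n > 0" "norm (of_real (s n) *s v) < r / 4" for n
    proof -
      show "s n > 0" using v r by (simp add: s_def)
      have "of_real (s n) *s v = s n *\<^sub>R v" by (simp add: vec_eq_iff complex_eq_iff)
      then have "norm (of_real (s n) *s v) = s n * norm v" using \<open>s n > 0\<close> by simp
      also have "\<dots> = r / (8 * real (Suc n))" using v by (simp add: s_def)
      also have "\<dots> \<le> r / (8 * 1)" using r by (intro divide_left_mono mult_left_mono) auto
      finally show "norm (of_real (s n) *s v) < r / 4" using r by simp
    qed
    have nv: "norm (of_real (s n) *s v) = s n * norm v" for n
    proof -
      have "of_real (s n) *s v = s n *\<^sub>R v" by (simp add: vec_eq_iff complex_eq_iff)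
      then show ?thesis using s(1)[of n] by simp
    qed
    show ?thesis
    proof (rule borel_measurable_LIMSEQ_metric)
      show "(\<lambda>y. (f (p + of_real (s n) *s v) y - f p y) / of_real (s n)) \<in> borel_measurable M" for n
        using int_f[of "p + of_real (s n) *s v"] int_f[of p] s(2)[of n] r
        by (intro borel_measurable_divide borel_measurable_diff borel_measurable_integrable borel_measurable_const) 
          (auto simp: dist_norm)
      fix y assume y: "y \<in> space M"
      show "(\<lambda>n. (f (p + of_real (s n) *s v) y - f p y) / of_real (s n)) \<longlonglongrightarrow> D y v"
      proof (rule LIM_zero_cancel, rule Lim_null_comparison[OF always_eventually])
        show "\<forall>n. norm ((f (p + of_real (s n) *s v) y - f p y) / of_real (s n) - D y v)
                \<le> 8 * B y / r\<^sup>2 * (norm v)\<^sup>2 * s n"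
        proof
          fix n
          have "(f (p + of_real (s n) *s v) y - f p y) / of_real (s n) - D y v =
             (f (p + of_real (s n) *s v) y - f p y - D y (of_real (s n) *s v)) / of_real (s n)"
            using s(1)[of n] Dlin[OF y] by (simp add: field_simps)
          also have "norm \<dots> \<le> (8 * B y / r\<^sup>2 * (s n * norm v)\<^sup>2) / s n"
            using divide_right_mono[OF T[OF y s(2)[of n]], of "s n"] s(1)[of n] nv[of n] by (simp add: norm_divide)
          also have "\<dots> = 8 * B y / r\<^sup>2 * (norm v)\<^sup>2 * s n" using s(1)[of n] by (simp add: power2_eq_square)
          finally show "norm ((f (p + of_real (s n) *s v) y - f p y) / of_real (s n) - D y v)
                \<le> 8 * B y / r\<^sup>2 * (norm v)\<^sup>2 * s n" .
        qed
        have "s = (\<lambda>n. r / (8 * norm v) * inverse (real (Suc n)))"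
          using v by (simp add: s_def field_simps)
        then have "s \<longlonglongrightarrow> 0"
          by (simp only:) (rule tendsto_mult_right_zero[OF LIMSEQ_inverse_real_of_nat])
        then show "(\<lambda>n. 8 * B y / r\<^sup>2 * (norm v)\<^sup>2 * s n) \<longlonglongrightarrow> 0"
          by (rule tendsto_mult_right_zero)
      qed
    qed
  qed
  have int_D: "integrable M (\<lambda>y. D y v)" for v
  proof -
    obtain c where c: "c > 0" "norm (of_real c *s v) < r / 4"
    proof -
      \<comment> \<open>By homogeneity only a short multiple of \<open>v\<close> needs a bound; the
        summand 1 keeps the denominator positive for \<open>v\<close> = 0.\<close>
      define c where "c = r / (8 * (norm v + 1))"
      have c0: "c > 0" using r by (simp add: c_def add_nonneg_pos)
      have "of_real c *s v = c *\<^sub>R v" by (simp add: vec_eq_iff complex_eq_iff)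
      then have "norm (of_real c *s v) = c * norm v" using c0 by simp
      also have "\<dots> \<le> c * (norm v + 1)" using c0 by (intro mult_left_mono) auto
      also have "\<dots> = r / 8" 
      proof -
        have "norm v + 1 \<noteq> 0" using norm_ge_zero[of v] by linarith
        then show ?thesis by (simp add: c_def field_simps)
      qed
      finally have "norm (of_real c *s v) < r / 4" using r by simp
      with c0 show ?thesis by (rule that)
    qed
    define u where "u = of_real c *s v"
    have "integrable M (\<lambda>y. D y u)"
    proof (rule Bochner_Integration.integrable_bound)
      show "integrable M (\<lambda>y. 2 * B y + 8 * B y / r\<^sup>2 * (norm u)\<^sup>2)"
        using B by auto
      show "AE y in M. norm (D y u) \<le> norm (2 * B y + 8 * B y / r\<^sup>2 * (norm u)\<^sup>2)"
      proof (rule AE_I2)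
        fix y assume y: "y \<in> space M"
        have "norm (f (p + u) y) \<le> B y" "norm (f p y) \<le> B y"
          using y r c by (auto intro!: fB simp: u_def dist_norm)
        moreover have "norm (D y u) \<le> norm (f (p + u) y) + norm (f p y) + norm (f (p + u) y - f p y - D y u)"
          using norm_triangle_ineq4[of "f (p + u) y - f p y" "f (p + u) y - f p y - D y u"] norm_triangle_ineq4[of "f (p + u) y" "f p y"]
          by simp
        ultimately show "norm (D y u) \<le> norm (2 * B y + 8 * B y / r\<^sup>2 * (norm u)\<^sup>2)"
          using T[OF y, of u] c by (simp add: u_def)
      qed
    qed (rule measD)
    then have "integrable M (\<lambda>y. inverse (of_real c) * D y u)" by simp
    moreover have "inverse (of_real c) * D y u = D y v" if "y \<in> space M" for y
      using Dlin[OF that] c by (simp add: u_def)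
    ultimately show ?thesis by (simp cong: Bochner_Integration.integrable_cong)
  qed
  define E where "E = (\<lambda>v. \<integral>y. D y v \<partial>M)"
  have Esc: "E (c *s v) = c * E v" for c v
  proof -
    have "E (c *s v) = (\<integral>y. c * D y v \<partial>M)" 
      unfolding E_def by (intro Bochner_Integration.integral_cong) (auto simp: Dlin)
    then show ?thesis by (simp add: E_def)
  qed
  have "linear E"
  proof (rule linearI)
    fix u v show "E (u + v) = E u + E v"
    proof -
      have "E (u + v) = (\<integral>y. D y u + D y v \<partial>M)" 
        unfolding E_def by (intro Bochner_Integration.integral_cong) (auto simp: Dadd)
      then show ?thesis by (simp add: E_def int_D)
    qed
  next
    fix c :: real and v :: "complex ^ 'n"
    have "c *\<^sub>R v = of_real c *s v" by (simp add: vec_eq_iff complex_eq_iff)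
    then show "E (c *\<^sub>R v) = c *\<^sub>R E v" by (simp add: Esc scaleR_conv_of_real)
  qed
  then have "bounded_linear E" by (simp add: linear_conv_bounded_linear)
  define C where "C = 8 / r\<^sup>2 * (\<integral>y. B y \<partial>M)"
  have main: "norm ((\<integral>y. f (p + v) y \<partial>M) - (\<integral>y. f p y \<partial>M) - E v) \<le> C * (norm v)\<^sup>2" if v: "norm v < r / 4" for v
  proof -
    have i: "integrable M (f (p + v))" "integrable M (f p)" using v r by (auto intro!: int_f simp: dist_norm)
    then have "(\<integral>y. f (p + v) y \<partial>M) - (\<integral>y. f p y \<partial>M) - E v = (\<integral>y. f (p + v) y - f p y - D y v \<partial>M)"
      by (simp add: E_def int_D)
    also have "norm \<dots> \<le> (\<integral>y. 8 * B y / r\<^sup>2 * (norm v)\<^sup>2 \<partial>M)"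
      by (rule order_trans[OF integral_norm_bound Bochner_Integration.integral_mono]) (use i int_D B T v in auto)
    also have "\<dots> = C * (norm v)\<^sup>2" by (simp add: C_def)
    finally show ?thesis .
  qed
  have "((\<lambda>p. \<integral>y. f p y \<partial>M) has_derivative E) (at p)"
    unfolding has_derivative_at_alt
  proof (intro conjI allI impI)
    show "bounded_linear E" by fact
    fix e :: real assume e: "e > 0"
    have C0: "\<bar>C\<bar> + 1 > 0" by simp
    show "\<exists>d>0. \<forall>y. norm (y - p) < d \<longrightarrow> norm ((\<integral>x. f y x \<partial>M) - (\<integral>y. f p y \<partial>M) - E (y - p)) \<le> e * norm (y - p)"
    proof (intro exI[of _ "min (r / 4) (e / (\<bar>C\<bar> + 1))"] conjI allI impI)
      show "0 < min (r / 4) (e / (\<bar>C\<bar> + 1))" using r e by (simp add: add_nonneg_pos)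
      fix y assume y: "norm (y - p) < min (r / 4) (e / (\<bar>C\<bar> + 1))"
      have "norm ((\<integral>x. f y x \<partial>M) - (\<integral>y. f p y \<partial>M) - E (y - p)) \<le> C * (norm (y - p))\<^sup>2"
        using main[of "y - p"] y by simp
      also have "\<dots> \<le> (\<bar>C\<bar> + 1) * norm (y - p) * norm (y - p)"
        unfolding power2_eq_square mult.assoc by (rule mult_right_mono) auto
      also have "\<dots> \<le> e * norm (y - p)"
        using y C0 by (intro mult_right_mono) (auto simp: field_simps)
      finally show "norm ((\<integral>x. f y x \<partial>M) - (\<integral>y. f p y \<partial>M) - E (y - p)) \<le> e * norm (y - p)" .
    qed
  qed
  then show "\<exists>D. ((\<lambda>p. \<integral>y. f p y \<partial>M) has_derivative D) (at p) \<and> (\<forall>c v. D (c *s v) = c * D v)"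
    using Esc by blast
qed

section \<open>The integral defining the hyperbolic gamma function\<close>

text \<open>The common majorant for the gamma kernel and, later, for decaying exponentials; its
  primitive is arctan.\<close>

lemma integrable_inverse_1_plus_square: 
  "integrable lborel (\<lambda>y::real. indicator {0<..} y *\<^sub>R (1 / (1 + y\<^sup>2)))"
proof -
  have *: "(\<integral>\<^sup>+y. ennreal (1 / (1 + y\<^sup>2)) * indicator {0..} y \<partial>lborel) = ennreal (pi / 2 - arctan 0)"
  proof (rule nn_integral_FTC_atLeast)
    show "(arctan \<longlongrightarrow> pi / 2) at_top" by (rule tendsto_arctan_at_top)
  qed (auto intro!: derivative_eq_intros divide_nonneg_pos add_pos_nonneg simp: inverse_eq_divide)
  have **: "integrable lborel (\<lambda>y::real. 1 / (1 + y\<^sup>2) * indicator {0..} y)"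
  proof (intro integrableI_bounded)
    have "(\<integral>\<^sup>+y. ennreal (norm (1 / (1 + y\<^sup>2) * indicator {0..} y :: real)) \<partial>lborel) =
        (\<integral>\<^sup>+y. ennreal (1 / (1 + y\<^sup>2)) * indicator {0..} y \<partial>lborel)"
      by (intro nn_integral_cong) (auto simp: indicator_def)
    with * show "(\<integral>\<^sup>+y. ennreal (norm (1 / (1 + y\<^sup>2) * indicator {0..} y :: real)) \<partial>lborel) < \<infinity>"
      by simp
  qed auto
  show ?thesis
    by (rule Bochner_Integration.integrable_bound[OF **]) (auto simp: indicator_def)
qed

text \<open>Cubic order matters: after the terms of lowest order cancel, the numerator of
  \<open>gamma_kernel\<close> is of order y^4, which matches its denominator at y = 0.\<close>

lemma norm_sin_minus_self: "norm (sin u - u) \<le> exp (norm u) * norm u ^ 3" for u :: complex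
proof -
  have "(\<Sum>k\<le>2. complex_of_real (sin_coeff k) * u ^ k) = u"
    by (simp add: numeral_2_eq_2 sin_coeff_def)
  then have "norm (sin u - u) \<le> exp \<bar>Im u\<bar> * norm u ^ 3 / fact 2"
    using Taylor_sin[of u 2] by (simp add: numeral_3_eq_3)
  also have "\<dots> \<le> exp (norm u) * norm u ^ 3 / 1"
    by (intro frac_le mult_mono) (auto simp: abs_Im_le_cmod)
  finally show ?thesis by simp
qed

lemma norm_sinh_minus_self: "norm (sinh u - u) \<le> exp (norm u) * norm u ^ 3" for u :: complex
proof -
  have "sinh u - u = - \<i> * (sin (\<i> * u) - \<i> * u)" by (simp add: sinh_conv_sin algebra_simps)
  then show ?thesis using norm_sin_minus_self[of "\<i> * u"] by (simp add: norm_mult)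
qed

lemma norm_sin_le_exp: "norm (sin u) \<le> exp \<bar>Im u\<bar>" for u :: complex
proof -
  have "norm (sin u) = norm (exp (\<i> * u) - exp (- (\<i> * u))) / 2"
    by (simp add: sin_exp_eq norm_divide norm_mult)
  also have "\<dots> \<le> (norm (exp (\<i> * u)) + norm (exp (- (\<i> * u)))) / 2"
    by (intro divide_right_mono norm_triangle_ineq4) auto
  also have "\<dots> \<le> (exp \<bar>Im u\<bar> + exp \<bar>Im u\<bar>) / 2"
    by (intro divide_right_mono add_mono) auto
  finally show ?thesis by simp
qed

lemma sinh_le_norm_sinh: "sinh \<bar>Re u\<bar> \<le> norm (sinh u)" for u :: complex
proof -
  have "norm (exp \<bar>Re u\<bar> - exp (- \<bar>Re u\<bar>)) \<le> norm (exp u - exp (- u))"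
  proof (cases "Re u \<ge> 0")
    case True
    have "norm (exp u) - norm (exp (- u)) \<le> norm (exp u - exp (- u))" by (rule norm_triangle_ineq2)
    then show ?thesis using True by simp
  next
    case False
    have "norm (exp (-u)) - norm (exp u) \<le> norm (exp (-u) - exp u)" by (rule norm_triangle_ineq2)
    then show ?thesis using False by (simp add: norm_minus_commute)
  qed
  then show ?thesis by (simp add: sinh_def norm_divide)
qed

lemma real_le_sinh: "x \<ge> 0 \<Longrightarrow> x \<le> sinh (x::real)"
proof -
  assume x: "x \<ge> 0"
  have "inverse (exp x) \<le> exp x" using x by (simp add: exp_minus[symmetric])
  then show "x \<le> sinh x"
    using real_le_abs_sinh[of x] by (simp add: sinh_def exp_minus abs_if split: if_splits)
qed

lemma sinh_nonzero: "Re u \<noteq> 0 \<Longrightarrow> sinh u \<noteq> 0" for u :: complex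
  using sinh_le_norm_sinh[of u] real_le_sinh[of "\<bar>Re u\<bar>"] by auto

definition gamma_kernel :: "complex \<Rightarrow> complex \<Rightarrow> complex \<Rightarrow> real \<Rightarrow> complex" where
  "gamma_kernel w1 w2 z y = (sin (2 * complex_of_real y * z) /
          (2 * sinh (w1 * complex_of_real y) * sinh (w2 * complex_of_real y))
        - z / (w1 * w2 * complex_of_real y)) / complex_of_real y"

text \<open>Near 0 the two terms of the kernel cancel to leading order, so it stays bounded; for y >
  1 the quotient of sine and hyperbolic sines decays exponentially at rate \<open>\<delta>\<close>
  and the other term is of order 1 / y^2. The constant depends only on \<open>a\<close>,
  \<open>\<delta>\<close> and \<open>R\<close>, which makes the bound locally uniform in the periods
  and in \<open>z\<close>.\<close>

lemma gamma_kernel_bound: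
  fixes a \<delta> R :: real
  assumes a: "a > 0" and \<delta>: "\<delta> > 0" and R: "R \<ge> 0"
  obtains C where "C > 0" "\<And>w1 w2 z y. a \<le> Re w1 \<Longrightarrow> a \<le> Re w2 \<Longrightarrow> norm w1 \<le> R \<Longrightarrow> norm w2 \<le> R \<Longrightarrow> norm z \<le> R \<Longrightarrow>
      2 * \<bar>Im z\<bar> + \<delta> \<le> Re w1 + Re w2 \<Longrightarrow> y > 0 \<Longrightarrow> norm (gamma_kernel w1 w2 z y) \<le> C / (1 + y\<^sup>2)"
proof -
  \<comment> \<open>\<open>Q\<close> bounds the cubic errors, \<open>C1\<close> the kernel for y
    \<le> 1, and \<open>C2\<close> the kernel times y^2 for y > 1. The constant \<open>c\<close> is
    the largest one with c exp s \<le> sinh s for all s \<ge> a.\<close>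
  define Q where "Q = exp (2 * R) * (2 * R) ^ 3"
  define C1 where "C1 = (R * R * Q + 2 * R * (2 * R * Q + Q * Q)) / (2 * a ^ 4)"
  define c where "c = (1 - exp (- 2 * a)) / 2"
  define C2 where "C2 = 1 / (2 * c\<^sup>2 * \<delta>) + R / a\<^sup>2"
  have Q0: "Q \<ge> 0" using R by (simp add: Q_def)
  have c0: "c > 0" using a by (simp add: c_def)
  have C10: "C1 \<ge> 0" using R Q0 a by (simp add: C1_def)
  have C20: "C2 \<ge> 0" using R c0 \<delta> by (simp add: C2_def)
  show ?thesis
  proof (rule that[of "2 * (C1 + C2) + 1"])
    show "2 * (C1 + C2) + 1 > 0" using C10 C20 by simp
    fix w1 w2 z :: complex and y :: real
    assume h: "a \<le> Re w1" "a \<le> Re w2" "norm w1 \<le> R" "norm w2 \<le> R" "norm z \<le> R"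
      "2 * \<bar>Im z\<bar> + \<delta> \<le> Re w1 + Re w2" "y > 0"
    define Y where "Y = complex_of_real y"
    have Y: "norm Y = y" "Y \<noteq> 0" using h by (auto simp: Y_def)
    have w0: "w1 \<noteq> 0" "w2 \<noteq> 0" using h a by auto
    have w: "a \<le> norm w1" "a \<le> norm w2" using h by (auto intro: order_trans[OF _ complex_Re_le_cmod])
    have sR: "Re w1 * y \<le> norm (sinh (w1 * Y))" "Re w2 * y \<le> norm (sinh (w2 * Y))"
      "sinh (Re w1 * y) \<le> norm (sinh (w1 * Y))" "sinh (Re w2 * y) \<le> norm (sinh (w2 * Y))"
      using sinh_le_norm_sinh[of "w1 * Y"] sinh_le_norm_sinh[of "w2 * Y"] 
        real_le_sinh[of "Re w1 * y"] real_le_sinh[of "Re w2 * y"] h a by (auto simp: Y_def abs_mult)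
    have sn: "sinh (w1 * Y) \<noteq> 0" "sinh (w2 * Y) \<noteq> 0"
      using h a by (auto intro!: sinh_nonzero simp: Y_def)
    have K: "gamma_kernel w1 w2 z y = (sin (2 * Y * z) / (2 * sinh (w1 * Y) * sinh (w2 * Y)) - z / (w1 * w2 * Y)) / Y"
      by (simp add: gamma_kernel_def Y_def)
    show "norm (gamma_kernel w1 w2 z y) \<le> (2 * (C1 + C2) + 1) / (1 + y\<^sup>2)"
    proof (cases "y \<le> 1")
      case True
      define S where "S = sin (2 * Y * z) - 2 * Y * z"
      define S1 where "S1 = sinh (w1 * Y) - w1 * Y"
      define S2 where "S2 = sinh (w2 * Y) - w2 * Y"
      have cube: "exp (norm u) * norm u ^ 3 \<le> Q * y ^ 3" if "norm u \<le> 2 * R * y" for u :: complex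
      proof -
        have "norm u \<le> 2 * R" using that R True h by (smt (verit) mult_left_le mult_nonneg_nonneg)
        then have "exp (norm u) * norm u ^ 3 \<le> exp (2 * R) * (2 * R * y) ^ 3"
          using that by (intro mult_mono power_mono) auto
        then show ?thesis by (simp add: Q_def power_mult_distrib)
      qed
      have S: "norm S \<le> Q * y ^ 3" unfolding S_def
        using h Y by (intro order_trans[OF norm_sin_minus_self] cube) (simp add: norm_mult mult.commute)
      have S1: "norm S1 \<le> Q * y ^ 3" unfolding S1_def
        using h R Y by (intro order_trans[OF norm_sinh_minus_self] cube) (auto simp: norm_mult intro!: mult_right_mono)
      have S2: "norm S2 \<le> Q * y ^ 3" unfolding S2_def
        using h R Y by (intro order_trans[OF norm_sinh_minus_self] cube) (auto simp: norm_mult intro!: mult_right_mono)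
      \<comment> \<open>The numerator over the common denominator. The main terms of sin and of the
        product of the two sinh cancel, so each surviving summand contains one of the errors
        \<open>S\<close>, \<open>S1\<close>, \<open>S2\<close>.\<close>
      define E where "E = w1 * w2 * Y * S - 2 * z * (w1 * Y * S2 + w2 * Y * S1 + S1 * S2)"
      have KE: "gamma_kernel w1 w2 z y = E / (2 * w1 * w2 * Y\<^sup>2 * (sinh (w1 * Y) * sinh (w2 * Y)))"
      proof -
        have "E = w1 * w2 * Y * sin (2 * Y * z) - 2 * z * (sinh (w1 * Y) * sinh (w2 * Y))"
          by (simp add: E_def S_def S1_def S2_def algebra_simps)
        then show ?thesis unfolding K using sn Y w0 by (simp add: divide_simps power2_eq_square)
      qed
      have y6: "y ^ 6 \<le> y ^ 4" using True h by (intro power_decreasing) auto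
      have "norm E \<le> norm (w1 * w2 * Y * S) + norm (2 * z * (w1 * Y * S2 + w2 * Y * S1 + S1 * S2))"
        unfolding E_def by (rule norm_triangle_ineq4)
      also have "\<dots> \<le> norm w1 * norm w2 * y * norm S + 2 * norm z * (norm w1 * y * norm S2 + norm w2 * y * norm S1 + norm S1 * norm S2)"
        using norm_triangle_le[OF order_refl, of "w1 * Y * S2 + w2 * Y * S1" "S1 * S2"]
          norm_triangle_ineq[of "w1 * Y * S2" "w2 * Y * S1"] norm_ge_zero[of z]
        by (simp add: norm_mult Y mult_left_mono)
      also have "\<dots> \<le> R * R * y * (Q * y ^ 3) + 2 * R * (R * y * (Q * y ^ 3) + R * y * (Q * y ^ 3) + (Q * y ^ 3) * (Q * y ^ 3))"
        using h S S1 S2 R Q0 by (intro add_mono mult_mono) auto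
      also have "\<dots> = R * R * Q * y ^ 4 + 2 * R * (2 * R * Q * y ^ 4 + Q * Q * y ^ 6)"
        by (simp add: algebra_simps power_numeral_reduce)
      also have "\<dots> \<le> R * R * Q * y ^ 4 + 2 * R * (2 * R * Q * y ^ 4 + Q * Q * y ^ 4)"
        using y6 R Q0 by (intro add_mono mult_left_mono) auto
      also have "\<dots> = C1 * (2 * a * a * y\<^sup>2 * (a * y * (a * y)))"
        using a by (simp add: C1_def field_simps power_numeral_reduce)
      finally have E1: "norm E \<le> C1 * (2 * a * a * y\<^sup>2 * (a * y * (a * y)))" .
      have low: "2 * a * a * y\<^sup>2 * (a * y * (a * y)) \<le> norm (2 * w1 * w2 * Y\<^sup>2 * (sinh (w1 * Y) * sinh (w2 * Y)))"
      proof -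
        have "a * y \<le> norm (sinh (w1 * Y))" "a * y \<le> norm (sinh (w2 * Y))"
          using sR h by (auto intro: order_trans[OF mult_right_mono])
        then show ?thesis 
          unfolding norm_mult norm_power Y(1) using w a h(7) by (intro mult_mono) auto
      qed
      have pos: "0 < 2 * a * a * y\<^sup>2 * (a * y * (a * y))" using a h by simp
      have "norm (gamma_kernel w1 w2 z y) \<le> 
         (C1 * (2 * a * a * y\<^sup>2 * (a * y * (a * y)))) / (2 * a * a * y\<^sup>2 * (a * y * (a * y)))"
        unfolding KE norm_divide by (rule frac_le) (use E1 low pos C10 in auto)
      also have "\<dots> = C1" by (rule nonzero_mult_div_cancel_right) (use pos in linarith)
      also have "C1 * (1 + y\<^sup>2) \<le> C1 * 2"
        using True h C10 by (intro mult_left_mono) (auto simp: power_le_one)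
      then have "C1 \<le> (2 * (C1 + C2) + 1) / (1 + y\<^sup>2)"
        using C20 by (simp add: pos_le_divide_eq add_pos_nonneg)
      finally show ?thesis .
    next
      case False
      have sh: "c * exp (r * y) \<le> sinh (r * y)" if "r \<ge> a" for r
      proof -
        have "exp (- (r * y)) = exp (- 2 * (r * y)) * exp (r * y)" by (simp add: exp_add[symmetric])
        also have "\<dots> \<le> exp (- 2 * a) * exp (r * y)"
        proof -
          have "a * 1 \<le> r * y" using that False a by (intro mult_mono) auto
          then show ?thesis by (intro mult_right_mono) auto
        qed
        finally have "exp (r * y) - exp (- 2 * a) * exp (r * y) \<le> exp (r * y) - exp (- (r * y))" by simp
        moreover have "sinh (r * y) = (exp (r * y) - exp (- (r * y))) / 2" by (simp add: sinh_def)
        moreover have "c * exp (r * y) = (exp (r * y) - exp (- 2 * a) * exp (r * y)) / 2"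
          by (simp add: c_def left_diff_distrib)
        ultimately show ?thesis by (metis divide_right_mono zero_le_numeral)
      qed
      have "norm (sin (2 * Y * z)) \<le> exp (2 * y * \<bar>Im z\<bar>)"
        using norm_sin_le_exp[of "2 * Y * z"] h by (simp add: Y_def abs_mult)
      moreover have "c * exp (Re w1 * y) * (c * exp (Re w2 * y)) \<le> norm (sinh (w1 * Y)) * norm (sinh (w2 * Y))"
        using sh[of "Re w1"] sh[of "Re w2"] h sR c0 by (intro mult_mono) auto
      ultimately have "norm (sin (2 * Y * z)) / (2 * (norm (sinh (w1 * Y)) * norm (sinh (w2 * Y)))) \<le> 
          exp (2 * y * \<bar>Im z\<bar>) / (2 * (c * exp (Re w1 * y) * (c * exp (Re w2 * y))))"
        using c0 by (intro frac_le) auto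
      also have "\<dots> = exp (2 * y * \<bar>Im z\<bar> - Re w1 * y - Re w2 * y) / (2 * c\<^sup>2)"
        by (simp add: exp_diff exp_add power2_eq_square field_simps)
      also have "\<dots> \<le> exp (- (\<delta> * y)) / (2 * c\<^sup>2)"
      proof -
        have "(2 * \<bar>Im z\<bar> + \<delta>) * y \<le> (Re w1 + Re w2) * y" using h by (intro mult_right_mono) auto
        then show ?thesis by (intro divide_right_mono) (auto simp: algebra_simps)
      qed
      \<comment> \<open>The exponential is weakened to 1 / y, the order of the other term, so that
        division by y gives the same majorant for both.\<close>
      also have "\<dots> \<le> (1 / (\<delta> * y)) / (2 * c\<^sup>2)"
      proof (intro divide_right_mono)
        have "\<delta> * y \<le> exp (\<delta> * y)" using exp_ge_add_one_self[of "\<delta> * y"] by linarith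
        then show "exp (- (\<delta> * y)) \<le> 1 / (\<delta> * y)" using \<delta> h by (simp add: exp_minus field_simps)
      qed simp
      finally have b1: "norm (sin (2 * Y * z) / (2 * sinh (w1 * Y) * sinh (w2 * Y))) \<le> (1 / (\<delta> * y)) / (2 * c\<^sup>2)"
        by (simp add: norm_divide norm_mult mult.assoc)
      have b2: "norm (z / (w1 * w2 * Y)) \<le> R / (a * a * y)"
        unfolding norm_divide norm_mult Y(1) using w h a R by (intro frac_le mult_mono) auto
      have "norm (gamma_kernel w1 w2 z y) \<le> ((1 / (\<delta> * y)) / (2 * c\<^sup>2) + R / (a * a * y)) / y"
        unfolding K norm_divide[of _ Y] Y(1) using h b1 b2
        by (intro divide_right_mono order_trans[OF norm_triangle_ineq4] add_mono) auto
      also have "\<dots> = C2 / y\<^sup>2" using h \<delta> a c0 by (simp add: C2_def field_simps power2_eq_square)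
      also have "\<dots> \<le> (2 * (C1 + C2) + 1) / (1 + y\<^sup>2)"
      proof (rule frac_le_eq[THEN iffD2])
        show "y\<^sup>2 \<noteq> 0" "1 + y\<^sup>2 \<noteq> 0" using h by (auto simp: add_nonneg_eq_0_iff)
        have "1 \<le> y\<^sup>2" using False by (simp add: one_le_power)
        then have "C2 * (1 + y\<^sup>2) \<le> C2 * (2 * y\<^sup>2)" using C20 by (intro mult_left_mono) auto
        also have "\<dots> \<le> (2 * (C1 + C2) + 1) * y\<^sup>2" using C10 C20 by (simp add: algebra_simps)
        finally have "C2 * (1 + y\<^sup>2) - (2 * (C1 + C2) + 1) * y\<^sup>2 \<le> 0" by simp
        then show "(C2 * (1 + y\<^sup>2) - (2 * (C1 + C2) + 1) * y\<^sup>2) / (y\<^sup>2 * (1 + y\<^sup>2)) \<le> 0"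
          by (intro divide_nonpos_nonneg) auto
      qed
      finally show ?thesis .
    qed
  qed
qed

definition gamma_log :: "complex \<Rightarrow> complex \<Rightarrow> complex \<Rightarrow> complex" where
  "gamma_log w1 w2 z = (LINT y:{0<..}|lborel. gamma_kernel w1 w2 z y)"

lemma hyp_gamma_strip_eq: "hyp_gamma_strip w1 w2 z = exp (\<i> * gamma_log w1 w2 z)"
  by (simp add: hyp_gamma_strip_def gamma_log_def gamma_kernel_def)

lemma gamma_kernel_measurable [measurable]: "gamma_kernel w1 w2 z \<in> borel_measurable borel"
proof -
  have [measurable]: "(\<lambda>y. sin (2 * complex_of_real y * z)) \<in> borel_measurable borel"
    "(\<lambda>y. sinh (w * complex_of_real y)) \<in> borel_measurable borel" for w
    by (intro borel_measurable_continuous_onI continuous_intros; simp)+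
  show ?thesis unfolding gamma_kernel_def by measurable
qed

definition gamma_domain :: "(complex ^ 3) set" where
  "gamma_domain = {p. 0 < Re (p $ 1) \<and> 0 < Re (p $ 2) \<and> 2 * \<bar>Im (p $ 3)\<bar> < Re (p $ 1) + Re (p $ 2)}"

lemma gamma_kernel_locally_dominated:
  assumes "p \<in> gamma_domain"
  obtains r C where "r > 0" "ball p r \<subseteq> gamma_domain" 
    "\<And>q y. q \<in> ball p r \<Longrightarrow> y > 0 \<Longrightarrow> norm (gamma_kernel (q $ 1) (q $ 2) (q $ 3) y) \<le> C / (1 + y\<^sup>2)"
proof -
  \<comment> \<open>Half of every inequality defining \<open>gamma_domain\<close> is kept as a
    margin on the ball. The radius is at most \<open>\<delta>\<close> / 4 because a displacement of
    r in each coordinate changes 2 |Im z| - Re w1 - Re w2 by at most 4 r.\<close>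
  define a where "a = min (Re (p $ 1)) (Re (p $ 2)) / 2"
  define \<delta> where "\<delta> = (Re (p $ 1) + Re (p $ 2) - 2 * \<bar>Im (p $ 3)\<bar>) / 2"
  define R where "R = norm p + 1"
  define r where "r = min 1 (min a (\<delta> / 4))"
  have pos: "a > 0" "\<delta> > 0" "R \<ge> 0" "r > 0" using assms by (auto simp: gamma_domain_def a_def \<delta>_def R_def r_def)
  obtain C where C: "\<And>w1 w2 z y. a \<le> Re w1 \<Longrightarrow> a \<le> Re w2 \<Longrightarrow> norm w1 \<le> R \<Longrightarrow> norm w2 \<le> R \<Longrightarrow> norm z \<le> R \<Longrightarrow>
      2 * \<bar>Im z\<bar> + \<delta> \<le> Re w1 + Re w2 \<Longrightarrow> y > 0 \<Longrightarrow> norm (gamma_kernel w1 w2 z y) \<le> C / (1 + y\<^sup>2)"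
    using gamma_kernel_bound[OF pos(1-3)] by metis
  have q: "a \<le> Re (q $ 1) \<and> a \<le> Re (q $ 2) \<and> norm (q $ i) \<le> R \<and> 2 * \<bar>Im (q $ 3)\<bar> + \<delta> \<le> Re (q $ 1) + Re (q $ 2)"
    if "q \<in> ball p r" for q i
  proof -
    have n: "norm ((q - p) $ j) < r" for j
      using that Finite_Cartesian_Product.norm_nth_le[of "q - p" j] by (simp add: dist_norm norm_minus_commute)
    have R1: "\<bar>Re (q $ j) - Re (p $ j)\<bar> < r" "\<bar>Im (q $ j) - Im (p $ j)\<bar> < r" for j
      using n[of j] abs_Re_le_cmod[of "(q - p) $ j"] abs_Im_le_cmod[of "(q - p) $ j"] by auto
    have "norm (q $ i) \<le> norm (p $ i) + norm ((q - p) $ i)" 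
      using norm_triangle_ineq[of "p $ i" "(q - p) $ i"] by simp
    then have "norm (q $ i) \<le> R"
      using n[of i] Finite_Cartesian_Product.norm_nth_le[of p i] by (simp add: R_def r_def)
    moreover have "r \<le> a" "4 * r \<le> \<delta>" by (auto simp: r_def)
    moreover have "2 * a \<le> Re (p $ 1)" "2 * a \<le> Re (p $ 2)" "2 * \<delta> = Re (p $ 1) + Re (p $ 2) - 2 * \<bar>Im (p $ 3)\<bar>"
      by (auto simp: a_def \<delta>_def)
    ultimately show ?thesis using R1[of 1] R1[of 2] R1[of 3] by linarith
  qed
  show ?thesis
  proof (rule that[OF pos(4)])
    show "ball p r \<subseteq> gamma_domain"
    proof
      fix x assume "x \<in> ball p r"
      from q[OF this, of 1] pos show "x \<in> gamma_domain" by (auto simp: gamma_domain_def)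
    qed
  qed (use C q in blast)
qed

lemma set_integrable_gamma_kernel:
  assumes "Re w1 > 0" "Re w2 > 0" "2 * \<bar>Im z\<bar> < Re w1 + Re w2"
  shows "set_integrable lborel {0<..} (gamma_kernel w1 w2 z)"
proof -
  define p :: "complex ^ 3" where "p = (\<chi> i. if i = 1 then w1 else if i = 2 then w2 else z)"
  have p: "p $ 1 = w1" "p $ 2 = w2" "p $ 3 = z" by (simp_all add: p_def)
  have "p \<in> gamma_domain" using assms by (simp add: gamma_domain_def p)
  then obtain r C where "r > 0" "\<And>q y. q \<in> ball p r \<Longrightarrow> y > 0 \<Longrightarrow> norm (gamma_kernel (q $ 1) (q $ 2) (q $ 3) y) \<le> C / (1 + y\<^sup>2)"
    using gamma_kernel_locally_dominated by metis
  then have C: "y > 0 \<Longrightarrow> norm (gamma_kernel w1 w2 z y) \<le> C / (1 + y\<^sup>2)" for y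
    using p by (metis centre_in_ball)
  have "integrable lborel (\<lambda>y. C * (indicator {0<..} y *\<^sub>R (1 / (1 + y\<^sup>2))))"
    by (intro Bochner_Integration.integrable_mult_right integrable_inverse_1_plus_square)
  then show ?thesis unfolding set_integrable_def
  proof (rule Bochner_Integration.integrable_bound)
    show "AE y in lborel. norm (indicator {0<..} y *\<^sub>R gamma_kernel w1 w2 z y)
       \<le> norm (C * (indicator {0<..} y *\<^sub>R (1 / (1 + y\<^sup>2))))"
      by (intro AE_I2) (auto simp: indicator_def intro!: order_trans[OF C] divide_right_mono)
  qed measurable
qed

text \<open>Holomorphy is joint in both periods and the argument; the meromorphy of \<open>S\<close>
  in all eight variables rests on it.\<close>

lemma holomorphic_gamma_log:
  "holomorphic_several_on (\<lambda>p. gamma_log (p $ 1) (p $ 2) (p $ 3)) gamma_domain"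
  unfolding gamma_log_def set_lebesgue_integral_def
proof (rule holomorphic_several_on_integral)
  fix y :: real
  show "holomorphic_several_on (\<lambda>p. indicator {0<..} y *\<^sub>R gamma_kernel (p $ 1) (p $ 2) (p $ 3) y) gamma_domain"
  proof (cases "y > 0")
    case True
    have sinh_h: "holomorphic_several_on (\<lambda>p. sinh (p $ i * complex_of_real y)) gamma_domain" for i
      unfolding sinh_conv_sin
      by (intro holomorphic_several_on_mult holomorphic_several_on_const 
          holomorphic_several_on_compose1[where g = sin and T = UNIV]) (auto intro: holomorphic_on_sin)
    have nz: "sinh (p $ 1 * complex_of_real y) \<noteq> 0" "sinh (p $ 2 * complex_of_real y) \<noteq> 0" 
      "p $ 1 \<noteq> 0" "p $ 2 \<noteq> 0" if "p \<in> gamma_domain" for p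
      using that True by (auto simp: gamma_domain_def intro!: sinh_nonzero)
    have "holomorphic_several_on (\<lambda>p. gamma_kernel (p $ 1) (p $ 2) (p $ 3) y) gamma_domain"
      unfolding gamma_kernel_def
      by (intro holomorphic_several_on_divide holomorphic_several_on_diff holomorphic_several_on_mult 
          holomorphic_several_on_const holomorphic_several_on_nth sinh_h
          holomorphic_several_on_compose1[where g = sin and T = UNIV]) 
        (use True nz in \<open>auto intro: holomorphic_on_sin\<close>)
    with True show ?thesis by simp
  qed auto
next
  fix p :: "complex ^ 3"
  show "(\<lambda>y. indicator {0<..} y *\<^sub>R gamma_kernel (p $ 1) (p $ 2) (p $ 3) y) \<in> borel_measurable lborel"
    by measurable
next
  fix p assume "p \<in> gamma_domain"
  then obtain r C where r: "r > 0" "ball p r \<subseteq> gamma_domain"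
     and C: "\<And>q y. q \<in> ball p r \<Longrightarrow> y > 0 \<Longrightarrow> norm (gamma_kernel (q $ 1) (q $ 2) (q $ 3) y) \<le> C / (1 + y\<^sup>2)"
    using gamma_kernel_locally_dominated by metis
  have "integrable lborel (\<lambda>y. C * (indicator {0<..} y *\<^sub>R (1 / (1 + y\<^sup>2))))"
    by (intro Bochner_Integration.integrable_mult_right integrable_inverse_1_plus_square)
  then show "\<exists>r>0. \<exists>B. ball p r \<subseteq> gamma_domain \<and> integrable lborel B \<and>
             (\<forall>q\<in>ball p r. \<forall>y\<in>space lborel.
                 norm (indicator {0<..} y *\<^sub>R gamma_kernel (q $ 1) (q $ 2) (q $ 3) y) \<le> (B y :: real))"
    using r C by (intro exI[of _ r] exI[of _ "\<lambda>y. C * (indicator {0<..} y *\<^sub>R (1 / (1 + y\<^sup>2)))"] conjI ballI)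
      (auto simp: indicator_def)
qed

section \<open>The difference equation inside the strip\<close>

text \<open>Up to the factor - \<i> this is the difference of \<open>gamma_kernel\<close> across a
  step \<i> w1 of the argument. Its integral is a logarithm of 2 cosh (pi z / w), as
  \<open>exp_log_cosh\<close> shows.\<close>

definition cosh_kernel :: "complex \<Rightarrow> complex \<Rightarrow> real \<Rightarrow> complex" where
  "cosh_kernel w z y = (1 / (w * complex_of_real y) - cos (2 * complex_of_real y * z) / sinh (w * complex_of_real y)) / complex_of_real y"

definition log_cosh :: "complex \<Rightarrow> complex \<Rightarrow> complex" where
  "log_cosh w z = (LINT y:{0<..}|lborel. cosh_kernel w z y)"

text \<open>The addition theorem of sine produces a factor sinh (w1 y), which cancels against the
  denominator and removes \<open>w1\<close> from the result.\<close>

lemma gamma_kernel_diff: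
  assumes "Re w1 > 0" "Re w2 > 0" "y > 0"
  shows "gamma_kernel w1 w2 (z + \<i> * w1 / 2) y - gamma_kernel w1 w2 (z - \<i> * w1 / 2) y = - \<i> * cosh_kernel w2 z y"
proof -
  define Y where "Y = complex_of_real y"
  have nz: "Y \<noteq> 0" "sinh (w1 * Y) \<noteq> 0" "sinh (w2 * Y) \<noteq> 0" "w1 \<noteq> 0" "w2 \<noteq> 0"
    using assms by (auto simp: Y_def intro!: sinh_nonzero)
  have "sin (2 * Y * (z + \<i> * w1 / 2)) - sin (2 * Y * (z - \<i> * w1 / 2)) 
      = sin (2 * Y * z + \<i> * (w1 * Y)) - sin (2 * Y * z - \<i> * (w1 * Y))"
    by (simp add: algebra_simps)
  also have "\<dots> = 2 * cos (2 * Y * z) * sin (\<i> * (w1 * Y))"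
    by (simp add: sin_add sin_diff)
  also have "\<dots> = 2 * \<i> * cos (2 * Y * z) * sinh (w1 * Y)"
    by (simp add: sinh_conv_sin)
  finally have s: "sin (2 * Y * (z + \<i> * w1 / 2)) = sin (2 * Y * (z - \<i> * w1 / 2)) + 2 * \<i> * cos (2 * Y * z) * sinh (w1 * Y)"
    by (simp add: algebra_simps)
  show ?thesis
    unfolding gamma_kernel_def cosh_kernel_def Y_def[symmetric] s
    using nz by (simp add: field_simps)
qed

text \<open>Both statements come from writing the kernel as a difference of two gamma kernels with
  an auxiliary first period. Integrability is shown with that period equal to 1, since
  \<open>cosh_kernel\<close> does not depend on it.\<close>

lemma
  assumes "Re w > 0" "2 * \<bar>Im z\<bar> < Re w"
  shows set_integrable_cosh_kernel: "set_integrable lborel {0<..} (cosh_kernel w z)"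
    and log_cosh_eq: "Re w1 > 0 \<Longrightarrow> log_cosh w z = \<i> * (gamma_log w1 w (z + \<i> * w1 / 2) - gamma_log w1 w (z - \<i> * w1 / 2))"
proof -
  have *: "set_integrable lborel {0<..} (gamma_kernel w1 w (z + \<i> * w1 / 2))"
    "set_integrable lborel {0<..} (gamma_kernel w1 w (z - \<i> * w1 / 2))" if "Re w1 > 0" for w1
  proof -
    have "Im (z + \<i> * w1 / 2) = Im z + Re w1 / 2" "Im (z - \<i> * w1 / 2) = Im z - Re w1 / 2" by simp_all
    then have "2 * \<bar>Im (z + \<i> * w1 / 2)\<bar> < Re w1 + Re w" "2 * \<bar>Im (z - \<i> * w1 / 2)\<bar> < Re w1 + Re w"
      using assms that by linarith+
    then show "set_integrable lborel {0<..} (gamma_kernel w1 w (z + \<i> * w1 / 2))"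
      "set_integrable lborel {0<..} (gamma_kernel w1 w (z - \<i> * w1 / 2))"
      using assms that by (auto intro!: set_integrable_gamma_kernel)
  qed
  have eq: "cosh_kernel w z y = \<i> * (gamma_kernel w1 w (z + \<i> * w1 / 2) y - gamma_kernel w1 w (z - \<i> * w1 / 2) y)"
    if "Re w1 > 0" "y > 0" for w1 y
    by (simp only: gamma_kernel_diff[OF that(1) assms(1) that(2), of z]) simp
  have "set_integrable lborel {0<..} (\<lambda>y. \<i> * (gamma_kernel 1 w (z + \<i> * 1 / 2) y - gamma_kernel 1 w (z - \<i> * 1 / 2) y))"
    by (intro set_integrable_mult_right set_integral_diff * zero_less_one) simp_all
  then show "set_integrable lborel {0<..} (cosh_kernel w z)"
    by (subst set_integrable_cong[OF refl refl eq[of 1]]) auto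
  assume w1: "Re w1 > 0"
  have "log_cosh w z = (LINT y:{0<..}|lborel. \<i> * (gamma_kernel w1 w (z + \<i> * w1 / 2) y - gamma_kernel w1 w (z - \<i> * w1 / 2) y))"
    unfolding log_cosh_def by (intro set_lebesgue_integral_cong) (auto simp: eq[OF w1])
  also have "\<dots> = \<i> * (gamma_log w1 w (z + \<i> * w1 / 2) - gamma_log w1 w (z - \<i> * w1 / 2))"
    unfolding gamma_log_def by (subst set_integral_diff(2)[OF *[OF w1], symmetric]) simp
  finally show "log_cosh w z = \<i> * (gamma_log w1 w (z + \<i> * w1 / 2) - gamma_log w1 w (z - \<i> * w1 / 2))" .
qed

lemma holomorphic_gamma_log_line:
  "(\<lambda>t. gamma_log (a1 + t * b1) (a2 + t * b2) (a3 + t * b3)) holomorphic_on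
     {t. 0 < Re (a1 + t * b1) \<and> 0 < Re (a2 + t * b2) \<and> 2 * \<bar>Im (a3 + t * b3)\<bar> < Re (a1 + t * b1) + Re (a2 + t * b2)}"
proof -
  define p v :: "complex ^ 3" where "p = (\<chi> i. if i = 1 then a1 else if i = 2 then a2 else a3)" 
    and "v = (\<chi> i. if i = 1 then b1 else if i = 2 then b2 else b3)"
  have *: "p $ 1 = a1" "p $ 2 = a2" "p $ 3 = a3" "v $ 1 = b1" "v $ 2 = b2" "v $ 3 = b3" by (simp_all add: p_def v_def)
  show ?thesis
    using holomorphic_several_on_line[OF holomorphic_gamma_log, of p v] by (simp add: gamma_domain_def *)
qed

subsection \<open>Real parameters\<close>

lemma has_bochner_integral_FTC_atLeast_0:
  fixes f F :: "real \<Rightarrow> real"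
  assumes "f \<in> borel_measurable borel" "\<And>x. x \<ge> a \<Longrightarrow> (F has_real_derivative f x) (at x)" "\<And>x. x \<ge> a \<Longrightarrow> f x \<ge> 0"
    "(F \<longlongrightarrow> T) at_top"
  shows "(\<integral>\<^sup>+y. ennreal (f y) * indicator {a<..} y \<partial>lborel) = ennreal (T - F a)"
proof -
  have "(\<integral>\<^sup>+y. ennreal (f y) * indicator {a<..} y \<partial>lborel) = (\<integral>\<^sup>+y. ennreal (f y) * indicator {a..} y \<partial>lborel)"
    by (rule nn_integral_cong_AE, rule AE_mp[OF AE_lborel_singleton[of a]], rule AE_I2) (auto simp: indicator_def)
  also have "\<dots> = ennreal (T - F a)" by (rule nn_integral_FTC_atLeast[OF assms])
  finally show ?thesis .
qed

lemma tendsto_exp_times_bounded: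
  fixes g :: "real \<Rightarrow> real"
  assumes s: "s > 0" and "\<And>y. \<bar>g y\<bar> \<le> B"
  shows "((\<lambda>y. exp (- (s * y)) * g y) \<longlongrightarrow> 0) at_top"
proof (rule Lim_null_comparison[of _ "\<lambda>y. exp (- (s * y)) * B"])
  show "\<forall>\<^sub>F y in at_top. norm (exp (- (s * y)) * g y) \<le> exp (- (s * y)) * B"
    using assms by (intro always_eventually) (auto simp: abs_mult)
  have "((\<lambda>y. exp (- (s * y))) \<longlongrightarrow> 0) at_top"
    using s by (intro filterlim_compose[OF exp_at_bot]) 
      (auto simp: filterlim_uminus_at_bot intro!: filterlim_tendsto_pos_mult_at_top[OF tendsto_const _ filterlim_ident])
  from tendsto_mult_left_zero[OF this] show "((\<lambda>y. exp (- (s * y)) * B) \<longlongrightarrow> 0) at_top" .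
qed

text \<open>Write \<open>exp (- a y) / y\<close> as the integral of \<open>exp (- s y)\<close> over \<open>s > a\<close> and interchange.\<close>

lemma nn_integral_one_minus_cos:
  fixes a b :: real
  assumes a: "a > 0"
  shows "(\<integral>\<^sup>+y. ennreal ((1 - cos (b * y)) * exp (- (a * y)) / y) * indicator {0<..} y \<partial>lborel) 
    = ennreal (ln (1 + b\<^sup>2 / a\<^sup>2) / 2)"
proof -
  have s_int: "(\<integral>\<^sup>+s. ennreal (exp (- (y * s))) * indicator {a<..} s \<partial>lborel) = ennreal (exp (- (a * y)) / y)" if y: "y > 0" for y
  proof (subst has_bochner_integral_FTC_atLeast_0[where F = "\<lambda>s. - exp (- (y * s)) / y" and T = 0])
    show "((\<lambda>s. - exp (- (y * s)) / y) \<longlongrightarrow> 0) at_top"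
      using tendsto_exp_times_bounded[OF y, of "\<lambda>_. - 1 / y" "1 / y"] y by simp
  qed (use y in \<open>auto intro!: derivative_eq_intros simp: mult.commute\<close>)
  have y_int: "(\<integral>\<^sup>+y. ennreal ((1 - cos (b * y)) * exp (- (s * y))) * indicator {0<..} y \<partial>lborel) = ennreal (b\<^sup>2 / (s * (s\<^sup>2 + b\<^sup>2)))" if s: "s > 0" for s
  proof -
    have sb: "s\<^sup>2 + b\<^sup>2 > 0" using s by (simp add: add_pos_nonneg)
    \<comment> \<open>Chosen so that exp (- s y) g y is a primitive of the integrand that tends to 0
      at infinity.\<close>
    define g where "g = (\<lambda>y. - 1 / s - (b * sin (b * y) - s * cos (b * y)) / (s\<^sup>2 + b\<^sup>2))"
    have g: "\<bar>g y\<bar> \<le> 1 / s + (\<bar>b\<bar> + s) / (s\<^sup>2 + b\<^sup>2)" for y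
    proof -
      have "\<bar>b * sin (b * y) - s * cos (b * y)\<bar> \<le> \<bar>b * sin (b * y)\<bar> + \<bar>s * cos (b * y)\<bar>" by linarith
      also have "\<dots> \<le> \<bar>b\<bar> * 1 + s * 1" unfolding abs_mult using s by (intro add_mono mult_mono) auto
      finally have "\<bar>b * sin (b * y) - s * cos (b * y)\<bar> / (s\<^sup>2 + b\<^sup>2) \<le> (\<bar>b\<bar> + s) / (s\<^sup>2 + b\<^sup>2)"
        using sb by (intro divide_right_mono) auto
      moreover have "\<bar>g y\<bar> \<le> \<bar>1 / s\<bar> + \<bar>(b * sin (b * y) - s * cos (b * y)) / (s\<^sup>2 + b\<^sup>2)\<bar>"
        unfolding g_def by (rule order_trans[OF abs_triangle_ineq4]) simp
      ultimately show ?thesis using s sb by (simp add: abs_divide)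
    qed
    have "(\<integral>\<^sup>+y. ennreal ((1 - cos (b * y)) * exp (- (s * y))) * indicator {0<..} y \<partial>lborel) = ennreal (0 - exp (- (s * 0)) * g 0)"
    proof (rule has_bochner_integral_FTC_atLeast_0)
      show "((\<lambda>y. exp (- (s * y)) * g y) \<longlongrightarrow> 0) at_top" by (rule tendsto_exp_times_bounded[OF s g])
      fix y :: real
      define D where "D = s\<^sup>2 + b\<^sup>2"
      have D: "D \<noteq> 0" using sb unfolding D_def by linarith
      define g' where "g' = - (b * (cos (b * y) * b) + s * (sin (b * y) * b)) / D"
      have "(g has_real_derivative g') (at y)"
        unfolding g_def D_def[symmetric] g'_def using D by (auto intro!: derivative_eq_intros simp: field_simps)
      then have "((\<lambda>y. exp (- (s * y)) * g y) has_real_derivative exp (- (s * y)) * (g' - s * g y)) (at y)"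
        by (auto intro!: derivative_eq_intros simp: algebra_simps)
      moreover have "g' - s * g y = 1 - cos (b * y)"
      proof -
        have "D * (g' - s * g y) = D * (1 - cos (b * y))"
          unfolding g'_def g_def D_def[symmetric] using D s by (simp add: field_simps) (simp add: D_def algebra_simps power2_eq_square)
        then show ?thesis using D by simp
      qed
      ultimately show "((\<lambda>y. exp (- (s * y)) * g y) has_real_derivative (1 - cos (b * y)) * exp (- (s * y))) (at y)"
        by (simp add: mult.commute)
    qed auto
    also have "0 - exp (- (s * 0)) * g 0 = b\<^sup>2 / (s * (s\<^sup>2 + b\<^sup>2))"
      using s sb by (simp add: g_def field_simps power2_eq_square)
    finally show ?thesis .
  qed
  have out: "(\<integral>\<^sup>+s. ennreal (b\<^sup>2 / (s * (s\<^sup>2 + b\<^sup>2))) * indicator {a<..} s \<partial>lborel) = ennreal (0 - - ln (1 + b\<^sup>2 / a\<^sup>2) / 2)"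
  proof (rule has_bochner_integral_FTC_atLeast_0)
    have "((\<lambda>s. - ln (1 + b\<^sup>2 * (inverse s)\<^sup>2) / 2) \<longlongrightarrow> - ln (1 + b\<^sup>2 * 0\<^sup>2) / 2) at_top"
      by (intro tendsto_intros tendsto_inverse_0_at_top filterlim_ident) auto
    then show "((\<lambda>s. - ln (1 + b\<^sup>2 / s\<^sup>2) / 2) \<longlongrightarrow> 0) at_top"
      by (simp add: field_simps)
    fix s assume "a \<le> s"
    then have s: "s > 0" using a by simp
    have sb: "s\<^sup>2 + b\<^sup>2 > 0" using s by (simp add: add_pos_nonneg)
    have p: "1 + b\<^sup>2 / s\<^sup>2 > 0" using s by (simp add: add_pos_nonneg)
    have "((\<lambda>s. 1 + b\<^sup>2 / s\<^sup>2) has_real_derivative - (b\<^sup>2 * (2 * s)) / (s\<^sup>2 * s\<^sup>2)) (at s)"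
      using s by (auto intro!: derivative_eq_intros simp: power2_eq_square)
    from DERIV_cmult[OF DERIV_chain2[OF DERIV_ln_divide[OF p] this], of "- 1 / 2"]
    have "((\<lambda>s. - ln (1 + b\<^sup>2 / s\<^sup>2) / 2) has_real_derivative
        - 1 / 2 * (1 / (1 + b\<^sup>2 / s\<^sup>2) * (- (b\<^sup>2 * (2 * s)) / (s\<^sup>2 * s\<^sup>2)))) (at s)"
      by simp
    moreover have "- 1 / 2 * (1 / (1 + b\<^sup>2 / s\<^sup>2) * (- (b\<^sup>2 * (2 * s)) / (s\<^sup>2 * s\<^sup>2))) = b\<^sup>2 / (s * (s\<^sup>2 + b\<^sup>2))"
      using s sb p by (simp add: divide_simps) (simp add: algebra_simps power2_eq_square power4_eq_xxxx)
    ultimately show "((\<lambda>s. - ln (1 + b\<^sup>2 / s\<^sup>2) / 2) has_real_derivative b\<^sup>2 / (s * (s\<^sup>2 + b\<^sup>2))) (at s)"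
      by simp
    show "0 \<le> b\<^sup>2 / (s * (s\<^sup>2 + b\<^sup>2))" using s sb by auto
  qed auto
  have "(\<integral>\<^sup>+y. ennreal ((1 - cos (b * y)) * exp (- (a * y)) / y) * indicator {0<..} y \<partial>lborel) =
     (\<integral>\<^sup>+y. \<integral>\<^sup>+s. ennreal ((1 - cos (b * y)) * exp (- (s * y))) * indicator {a<..} s * indicator {0<..} y \<partial>lborel \<partial>lborel)"
  proof (intro nn_integral_cong)
    fix y :: real
    show "ennreal ((1 - cos (b * y)) * exp (- (a * y)) / y) * indicator {0<..} y = 
       (\<integral>\<^sup>+s. ennreal ((1 - cos (b * y)) * exp (- (s * y))) * indicator {a<..} s * indicator {0<..} y \<partial>lborel)"
    proof (cases "y > 0")
      case True
      have "(\<integral>\<^sup>+s. ennreal ((1 - cos (b * y)) * exp (- (s * y))) * indicator {a<..} s \<partial>lborel) =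
        (\<integral>\<^sup>+s. ennreal (1 - cos (b * y)) * (ennreal (exp (- (y * s))) * indicator {a<..} s) \<partial>lborel)"
        by (simp add: ennreal_mult' mult.assoc mult.commute[of _ y])
      also have "\<dots> = ennreal (1 - cos (b * y)) * ennreal (exp (- (a * y)) / y)"
        by (subst nn_integral_cmult) (auto simp: s_int[OF True])
      finally show ?thesis using True by (simp add: ennreal_mult'[symmetric])
    qed auto
  qed
  also have "\<dots> = (\<integral>\<^sup>+s. \<integral>\<^sup>+y. ennreal ((1 - cos (b * y)) * exp (- (s * y))) * indicator {a<..} s * indicator {0<..} y \<partial>lborel \<partial>lborel)"
    by (rule lborel_pair.Fubini') measurable
  also have "\<dots> = (\<integral>\<^sup>+s. ennreal (b\<^sup>2 / (s * (s\<^sup>2 + b\<^sup>2))) * indicator {a<..} s \<partial>lborel)"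
  proof (intro nn_integral_cong)
    fix s :: real
    show "(\<integral>\<^sup>+y. ennreal ((1 - cos (b * y)) * exp (- (s * y))) * indicator {a<..} s * indicator {0<..} y \<partial>lborel) = ennreal (b\<^sup>2 / (s * (s\<^sup>2 + b\<^sup>2))) * indicator {a<..} s"
      using y_int[of s] a by (cases "a < s") auto
  qed
  also have "\<dots> = ennreal (ln (1 + b\<^sup>2 / a\<^sup>2) / 2)" unfolding out by simp
  finally show ?thesis .
qed

lemma integral_one_minus_cos:
  fixes a b :: real
  assumes a: "a > 0"
  shows "has_bochner_integral lborel (\<lambda>y. indicator {0<..} y * ((1 - cos (b * y)) * exp (- (a * y)) / y)) (ln (1 + b\<^sup>2 / a\<^sup>2) / 2)"
proof (rule has_bochner_integral_nn_integral)
  show "(\<integral>\<^sup>+ x. ennreal (indicator {0<..} x * ((1 - cos (b * x)) * exp (- (a * x)) / x)) \<partial>lborel) = ennreal (ln (1 + b\<^sup>2 / a\<^sup>2) / 2)"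
    by (subst nn_integral_one_minus_cos[OF a, symmetric]) (intro nn_integral_cong, auto simp: indicator_def)
qed (auto simp: indicator_def)

lemma sinh_of_real: "sinh (complex_of_real x) = of_real (sinh x)"
  by (simp add: sinh_def exp_of_real[symmetric] scaleR_conv_of_real)

lemma cosh_of_real: "cosh (complex_of_real x) = of_real (cosh x)"
  by (simp add: cosh_def exp_of_real[symmetric] scaleR_conv_of_real)

text \<open>cosh (pi u) is the quotient sin (2 pi \<i> u) / (2 sin (pi \<i> u)). In the sine
  products the factors of even index in the numerator cancel against the denominator and those of
  odd index remain; for this the numerator is truncated at 2 n and the denominator at n.\<close>

lemma cosh_product_formula:
  fixes u :: real
  shows "(\<lambda>n. \<Prod>k<n. 1 + (2 * u)\<^sup>2 / (2 * real k + 1)\<^sup>2) \<longlonglongrightarrow> cosh (pi * u)"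
proof (cases "u = 0")
  case False
  define c where "c = complex_of_real u"
  define P where "P = (\<lambda>z n. of_real pi * z * (\<Prod>k=1..n. 1 - z\<^sup>2 / (of_nat k)\<^sup>2) :: complex)"
  have lim: "P z \<longlonglongrightarrow> sin (of_real pi * z)" for z
    unfolding P_def by (rule sin_product_formula_complex)
  have s: "sin (of_real pi * (\<i> * c)) = \<i> * of_real (sinh (pi * u))"
    by (simp add: c_def sinh_of_real[symmetric] sinh_conv_sin mult.left_commute)
  have nz: "sin (of_real pi * (\<i> * c)) \<noteq> 0" using False by (simp add: s)
  have "(\<lambda>n. P (2 * \<i> * c) (2 * n)) \<longlonglongrightarrow> sin (of_real pi * (2 * \<i> * c))"
    by (rule LIMSEQ_subseq_LIMSEQ[OF lim, unfolded o_def]) (auto simp: strict_mono_def)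
  from tendsto_divide[OF this lim nz]
  have "(\<lambda>n. P (2 * \<i> * c) (2 * n) / P (\<i> * c) n) \<longlonglongrightarrow> sin (of_real pi * (2 * \<i> * c)) / sin (of_real pi * (\<i> * c))" .
  moreover have "sin (of_real pi * (2 * \<i> * c)) / sin (of_real pi * (\<i> * c)) = of_real (2 * cosh (pi * u))"
  proof -
    have "sin (of_real pi * (2 * \<i> * c)) = 2 * sin (of_real pi * (\<i> * c)) * cos (of_real pi * (\<i> * c))"
      using sin_double[of "of_real pi * (\<i> * c)"] by (simp add: mult_ac)
    also have "cos (of_real pi * (\<i> * c)) = of_real (cosh (pi * u))"
      by (simp add: c_def cosh_of_real[symmetric] cosh_conv_cos mult.left_commute)
    finally show ?thesis using nz by simp
  qed
  moreover have "P (2 * \<i> * c) (2 * n) / P (\<i> * c) n = of_real (2 * (\<Prod>k<n. 1 + (2 * u)\<^sup>2 / (2 * real k + 1)\<^sup>2))" for n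
  proof -
    have Q: "(\<Prod>k=1..n. 1 - (\<i> * c)\<^sup>2 / (of_nat k)\<^sup>2) \<noteq> 0"
    proof (subst prod_zero_iff, simp, safe)
      fix k assume k: "k \<in> {1..n}" "1 - (\<i> * c)\<^sup>2 / (of_nat k)\<^sup>2 = 0"
      then have "complex_of_real (1 + u\<^sup>2 / (real k)\<^sup>2) = 0" by (simp add: c_def power_mult_distrib)
      then have "1 + u\<^sup>2 / (real k)\<^sup>2 = 0" by (simp only: of_real_eq_0_iff)
      moreover have "u\<^sup>2 / (real k)\<^sup>2 \<ge> 0" by simp
      ultimately show False by linarith
    qed
    have "(\<Prod>k=1..2*n. 1 - (2 * \<i> * c)\<^sup>2 / (of_nat k)\<^sup>2) = 
       (\<Prod>k=1..n. 1 - (\<i> * c)\<^sup>2 / (of_nat k)\<^sup>2) * of_real (\<Prod>k<n. 1 + (2 * u)\<^sup>2 / (2 * real k + 1)\<^sup>2)"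
    proof (induction n)
      case (Suc n)
      have "1 - (2 * \<i> * c)\<^sup>2 / (of_nat (Suc (Suc (2 * n))))\<^sup>2 = 1 - (\<i> * c)\<^sup>2 / (of_nat (Suc n))\<^sup>2"
      proof -
        have "of_nat (Suc (Suc (2 * n))) = 2 * (of_nat (Suc n) :: complex)" by simp
        then show ?thesis by (simp only: power_mult_distrib mult.assoc) (simp del: of_nat_Suc)
      qed
      moreover have "1 - (2 * \<i> * c)\<^sup>2 / (of_nat (Suc (2 * n)))\<^sup>2 = complex_of_real (1 + (2 * u)\<^sup>2 / (2 * real n + 1)\<^sup>2)"
        by (simp add: c_def power_mult_distrib add.commute)
      ultimately show ?case using Suc.IH by (simp del: of_nat_Suc add: mult_ac)
    qed simp
    then show ?thesis using Q False unfolding P_def by (simp add: c_def)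
  qed
  ultimately have "(\<lambda>n. complex_of_real (2 * (\<Prod>k<n. 1 + (2 * u)\<^sup>2 / (2 * real k + 1)\<^sup>2))) \<longlonglongrightarrow> of_real (2 * cosh (pi * u))"
    by simp
  then have "(\<lambda>n. 2 * (\<Prod>k<n. 1 + (2 * u)\<^sup>2 / (2 * real k + 1)\<^sup>2)) \<longlonglongrightarrow> 2 * cosh (pi * u)"
    by (simp only: tendsto_of_real_iff)
  then show ?thesis by (simp add: tendsto_mult_left_iff)
qed simp

text \<open>A geometric series; it breaks the integral of (1 - cos) / (y sinh) into terms of the
  form in \<open>integral_one_minus_cos\<close>.\<close>

lemma inverse_sinh_sums:
  assumes "s > (0 :: real)"
  shows "(\<lambda>k. 2 * exp (- ((2 * real k + 1) * s))) sums (1 / sinh s)"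
proof -
  have "exp (- (2 * s)) < 1" using assms by simp
  then have "(\<lambda>k. 2 * exp (- s) * exp (- (2 * s)) ^ k) sums (2 * exp (- s) * (1 / (1 - exp (- (2 * s)))))"
    by (intro sums_mult geometric_sums) auto
  moreover have "2 * exp (- s) * exp (- (2 * s)) ^ k = 2 * exp (- ((2 * real k + 1) * s))" for k
    by (simp add: exp_of_nat_mult[symmetric] exp_add[symmetric] algebra_simps)
  moreover have "2 * exp (- s) * (1 / (1 - exp (- (2 * s)))) = 1 / sinh s"
  proof -
    have "exp (- (2 * s)) = exp (- s) * exp (- s)" by (simp add: exp_add[symmetric])
    then have "sinh s * (2 * exp (- s)) = 1 - exp (- (2 * s))"
      by (simp add: sinh_def algebra_simps exp_minus)
    moreover have "sinh s \<noteq> 0" using assms by simp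
    ultimately show ?thesis using \<open>exp (- (2 * s)) < 1\<close> by (simp add: field_simps)
  qed
  ultimately show ?thesis by simp
qed

text \<open>Subtracting the kernel at argument 0 removes the term 1 / (w y) and leaves (1 - cos) /
  (y sinh). Expanding 1 / sinh and integrating termwise gives the logarithms of the factors in
  \<open>cosh_product_formula\<close>.\<close>

lemma exp_log_cosh_real:
  fixes w x :: real
  assumes w: "w > 0"
  shows "exp (log_cosh (of_real w) (of_real x)) = exp (log_cosh (of_real w) 0) * cosh (of_real (pi * x / w))"
proof -
  define f where "f = (\<lambda>k y. 2 * (indicator {0<..} y * ((1 - cos (2 * x * y)) * exp (- (((2 * real k + 1) * w) * y)) / y)))"
  define t where "t = (\<lambda>k. (2 * (x / w))\<^sup>2 / (2 * real k + 1)\<^sup>2)"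
  have t0: "t k \<ge> 0" for k by (simp add: t_def)
  have f0: "f k y \<ge> 0" for k y by (simp add: f_def indicator_def)
  have hf: "has_bochner_integral lborel (f k) (ln (1 + t k))" for k
  proof -
    have "has_bochner_integral lborel (f k) (2 * (ln (1 + (2 * x)\<^sup>2 / ((2 * real k + 1) * w)\<^sup>2) / 2))"
      unfolding f_def by (intro has_bochner_integral_mult_right integral_one_minus_cos) (use w in simp)
    then show ?thesis by (simp add: t_def power_mult_distrib power_divide mult.commute)
  qed
  have "summable t"
  proof -
    have "summable (\<lambda>k. (2 * (x / w))\<^sup>2 * (1 / (real (Suc k))\<^sup>2))"
    proof (intro summable_mult)
      have "summable (\<lambda>n. 1 / (real n)\<^sup>2)"
        using inverse_power_summable[of 2, where 'a = real] by (simp add: inverse_eq_divide power_divide)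
      then show "summable (\<lambda>k. 1 / (real (Suc k))\<^sup>2)" by (subst summable_Suc_iff)
    qed
    then show ?thesis
    proof (rule summable_comparison_test[rotated], intro exI[of _ 0] allI impI)
      fix k
      have "(real (Suc k))\<^sup>2 \<le> (2 * real k + 1)\<^sup>2" by (intro power_mono) auto
      then show "norm (t k) \<le> (2 * (x / w))\<^sup>2 * (1 / (real (Suc k))\<^sup>2)"
        using t0[of k] by (simp add: t_def divide_left_mono)
    qed
  qed
  \<comment> \<open>The functions \<open>f k\<close> are nonnegative, so this is also summability of
    the integrals of their norms, as needed to exchange sum and integral.\<close>
  then have sl: "summable (\<lambda>k. ln (1 + t k))"
    by (rule summable_comparison_test[rotated]) (use t0 in \<open>auto intro!: exI[of _ 0] ln_add_one_self_le_self\<close>)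
  have fs: "(\<lambda>k. f k y) sums (indicator {0<..} y * ((1 - cos (2 * x * y)) / (y * sinh (w * y))))" for y
  proof (cases "y > 0")
    case True
    have "(\<lambda>k. (1 - cos (2 * x * y)) / y * (2 * exp (- ((2 * real k + 1) * (w * y))))) sums ((1 - cos (2 * x * y)) / y * (1 / sinh (w * y)))"
      using True w by (intro sums_mult inverse_sinh_sums) simp
    then show ?thesis using True by (simp add: f_def mult_ac)
  qed (simp add: f_def)
  have int: "integrable lborel (f k)" "integral\<^sup>L lborel (f k) = ln (1 + t k)" for k
    using hf[of k] by (auto simp: has_bochner_integral_iff)
  have S: "(\<lambda>k. ln (1 + t k)) sums (\<integral>y. (\<Sum>k. f k y) \<partial>lborel)"
    unfolding int(2)[symmetric]
  proof (rule sums_integral)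
    show "AE y in lborel. summable (\<lambda>k. norm (f k y))"
      using fs f0 by (intro AE_I2) (auto simp: sums_iff)
    show "summable (\<lambda>k. \<integral>y. norm (f k y) \<partial>lborel)"
      using sl f0 by (simp add: int)
  qed (rule int)
  define I where "I = (\<integral>y. indicator {0<..} y * ((1 - cos (2 * x * y)) / (y * sinh (w * y))) \<partial>lborel)"
  have "(\<lambda>k. ln (1 + t k)) sums I"
    using S fs by (simp add: I_def sums_iff)
  then have "(\<lambda>n. exp (\<Sum>k<n. ln (1 + t k))) \<longlonglongrightarrow> exp I"
    unfolding sums_def by (rule tendsto_exp)
  moreover have "exp (\<Sum>k<n. ln (1 + t k)) = (\<Prod>k<n. 1 + t k)" for n
    using t0 by (subst exp_sum) (auto intro!: prod.cong simp: add_pos_nonneg)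
  ultimately have "(\<lambda>n. \<Prod>k<n. 1 + t k) \<longlonglongrightarrow> exp I" by simp
  moreover have "(\<lambda>n. \<Prod>k<n. 1 + t k) \<longlonglongrightarrow> cosh (pi * (x / w))"
    unfolding t_def by (rule cosh_product_formula)
  ultimately have expI: "exp I = cosh (pi * (x / w))" by (rule LIMSEQ_unique)
  have i: "set_integrable lborel {0<..} (cosh_kernel (of_real w) (of_real x))" 
     "set_integrable lborel {0<..} (cosh_kernel (of_real w) 0)"
    using w by (intro set_integrable_cosh_kernel; simp)+
  have "log_cosh (of_real w) (of_real x) - log_cosh (of_real w) 0 = 
     (LINT y:{0<..}|lborel. cosh_kernel (of_real w) (of_real x) y - cosh_kernel (of_real w) 0 y)"
    unfolding log_cosh_def by (rule set_integral_diff(2)[OF i, symmetric])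
  also have "\<dots> = (\<integral>y. complex_of_real (indicator {0<..} y * ((1 - cos (2 * x * y)) / (y * sinh (w * y)))) \<partial>lborel)"
    unfolding set_lebesgue_integral_def
  proof (intro Bochner_Integration.integral_cong refl)
    fix y :: real
    show "indicator {0<..} y *\<^sub>R (cosh_kernel (of_real w) (of_real x) y - cosh_kernel (of_real w) 0 y) =
      complex_of_real (indicator {0<..} y * ((1 - cos (2 * x * y)) / (y * sinh (w * y))))"
    proof (cases "y > 0")
      case True
      have "sinh (complex_of_real w * complex_of_real y) = complex_of_real (sinh (w * y))"
        by (simp add: sinh_of_real[symmetric])
      moreover have "cos (2 * complex_of_real y * complex_of_real x) = complex_of_real (cos (2 * x * y))"
        by (simp add: cos_of_real[symmetric] mult_ac)
      moreover have "sinh (w * y) \<noteq> 0" using True w by simp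
      ultimately show ?thesis using True by (simp add: cosh_kernel_def field_simps)
    qed simp
  qed
  also have "\<dots> = of_real I" unfolding I_def by (rule integral_complex_of_real)
  finally have "log_cosh (of_real w) (of_real x) = log_cosh (of_real w) 0 + of_real I" by (simp add: algebra_simps)
  then show ?thesis by (simp only: exp_add cosh_of_real exp_of_real expI) simp
qed

text \<open>Invariance of dy / y under scaling: at argument 0 the period occurs only in the product
  w y.\<close>

lemma log_cosh_0_real:
  fixes w :: real
  assumes w: "w > 0"
  shows "log_cosh (of_real w) 0 = log_cosh 1 0"
proof -
  have "log_cosh 1 0 = (\<integral>y. indicator {0<..} y *\<^sub>R cosh_kernel 1 0 y \<partial>lborel)"
    by (simp add: log_cosh_def set_lebesgue_integral_def)
  also have "\<dots> = \<bar>w\<bar> *\<^sub>R (\<integral>y. indicator {0<..} (0 + w * y) *\<^sub>R cosh_kernel 1 0 (0 + w * y) \<partial>lborel)"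
    using w by (intro lborel_integral_real_affine) simp
  also have "\<dots> = (\<integral>y. w *\<^sub>R (indicator {0<..} (0 + w * y) *\<^sub>R cosh_kernel 1 0 (0 + w * y)) \<partial>lborel)"
    using w by (simp del: scaleR_scaleR)
  also have "\<dots> = (\<integral>y. indicator {0<..} y *\<^sub>R cosh_kernel (of_real w) 0 y \<partial>lborel)"
    using w by (intro Bochner_Integration.integral_cong refl)
      (auto simp: cosh_kernel_def indicator_def zero_less_mult_iff scaleR_conv_of_real)
  also have "\<dots> = log_cosh (of_real w) 0"
    by (simp add: log_cosh_def set_lebesgue_integral_def)
  finally show ?thesis ..
qed

lemma strip_shift_bound:
  fixes t r :: real
  assumes "2 * \<bar>t\<bar> < r"
  shows "2 * \<bar>t + 1 / 2\<bar> < 1 + r" "2 * \<bar>t - 1 / 2\<bar> < 1 + r" "0 < r"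
  using assms abs_triangle_ineq[of t "1 / 2"] abs_triangle_ineq4[of t "1 / 2"] by simp_all

text \<open>Written as a difference of \<open>gamma_log\<close> with auxiliary period 1, the
  function inherits holomorphy from there.\<close>

lemma holomorphic_log_cosh_fixed_period:
  assumes "Re w > 0"
  shows "log_cosh w holomorphic_on {z. 2 * \<bar>Im z\<bar> < Re w}"
proof -
  have "(\<lambda>z. \<i> * (gamma_log 1 w (z + \<i> / 2) - gamma_log 1 w (z - \<i> / 2))) holomorphic_on {z. 2 * \<bar>Im z\<bar> < Re w}"
  proof (intro holomorphic_intros)
    show "(\<lambda>z. gamma_log 1 w (z + \<i> / 2)) holomorphic_on {z. 2 * \<bar>Im z\<bar> < Re w}"
      using holomorphic_gamma_log_line[of 1 0 w 0 "\<i> / 2" 1] assms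
      by (rule_tac holomorphic_on_subset[of "\<lambda>z. gamma_log 1 w (z + \<i> / 2)"]) (auto simp: add.commute intro: strip_shift_bound)
    show "(\<lambda>z. gamma_log 1 w (z - \<i> / 2)) holomorphic_on {z. 2 * \<bar>Im z\<bar> < Re w}"
      using holomorphic_gamma_log_line[of 1 0 w 0 "- \<i> / 2" 1] assms
      by (rule_tac holomorphic_on_subset[of "\<lambda>z. gamma_log 1 w (z - \<i> / 2)"]) (auto simp: add.commute intro: strip_shift_bound)
  qed
  then show ?thesis
    by (rule holomorphic_transform) (use assms log_cosh_eq[of w _ 1] in auto)
qed

lemma holomorphic_log_cosh_fixed_argument:
  "(\<lambda>w. log_cosh w z) holomorphic_on {w. 2 * \<bar>Im z\<bar> < Re w}"
proof -
  have "(\<lambda>w. \<i> * (gamma_log 1 w (z + \<i> / 2) - gamma_log 1 w (z - \<i> / 2))) holomorphic_on {w. 2 * \<bar>Im z\<bar> < Re w}"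
  proof (intro holomorphic_intros)
    show "(\<lambda>w. gamma_log 1 w (z + \<i> / 2)) holomorphic_on {w. 2 * \<bar>Im z\<bar> < Re w}"
      using holomorphic_gamma_log_line[of 1 0 0 1 "z + \<i> / 2" 0] 
      by (rule_tac holomorphic_on_subset[of "\<lambda>w. gamma_log 1 w (z + \<i> / 2)"]) (auto intro: strip_shift_bound)
    show "(\<lambda>w. gamma_log 1 w (z - \<i> / 2)) holomorphic_on {w. 2 * \<bar>Im z\<bar> < Re w}"
      using holomorphic_gamma_log_line[of 1 0 0 1 "z - \<i> / 2" 0] 
      by (rule_tac holomorphic_on_subset[of "\<lambda>w. gamma_log 1 w (z - \<i> / 2)"]) (auto intro: strip_shift_bound)
  qed
  then show ?thesis
    by (rule holomorphic_transform) (use log_cosh_eq[of _ z 1] in auto)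
qed

text \<open>The constant is found from the duplication \<open>cosh (w y / 2) / sinh (w y) = 1 / (2 sinh (w y / 2))\<close>.\<close>

lemma exp_log_cosh:
  assumes "2 * \<bar>Im z\<bar> < Re w"
  shows "exp (log_cosh w z) = 2 * cosh (of_real pi * z / w)"
proof -
  define c where "c = exp (log_cosh 1 0)"
  \<comment> \<open>The formula is continued twice: here in \<open>z\<close> from the real axis for
    a real period, at the end in \<open>w\<close> from a real half-line for fixed
    \<open>z\<close>.\<close>
  have real_w: "exp (log_cosh (of_real w) z) = c * cosh (of_real pi * z / of_real w)" 
    if w: "w > 0" and z: "2 * \<bar>Im z\<bar> < w" for w :: real and z
  proof -
    define S where "S = {z. 2 * \<bar>Im z\<bar> < w}"
    have conv: "convex S" "open S"
    proof -
      have S: "S = {z. Im z < w / 2} \<inter> {z. Im z > - w / 2}" by (auto simp: S_def)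
      show "convex S" "open S" unfolding S
        by (simp_all only: convex_Int convex_halfspace_Im_lt convex_halfspace_Im_gt open_Int open_halfspace_Im_lt open_halfspace_Im_gt)
    qed
    have "exp (log_cosh (of_real w) z) - c * cosh (of_real pi * z / of_real w) = 0"
    proof (rule analytic_continuation[where S = S and U = "range of_real" and \<xi> = 0 and 
          f = "\<lambda>z. exp (log_cosh (of_real w) z) - c * cosh (of_real pi * z / of_real w)"])
      show "(\<lambda>z. exp (log_cosh (of_real w) z) - c * cosh (of_real pi * z / of_real w)) holomorphic_on S"
        unfolding cosh_conv_cos using holomorphic_log_cosh_fixed_period[of "of_real w"] w
        by (intro holomorphic_intros) (auto simp: S_def)
      show "(0::complex) islimpt range complex_of_real"
      proof (subst islimpt_approachable, intro allI impI)
        fix d :: real assume d: "d > 0"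
        show "\<exists>x'\<in>range complex_of_real. x' \<noteq> 0 \<and> dist x' 0 < d"
          by (rule bexI[OF _ rangeI[of _ "d / 2"]]) (use d in auto)
      qed
      fix u :: complex assume "u \<in> range of_real"
      then obtain x where "u = of_real x" by auto
      then show "exp (log_cosh (of_real w) u) - c * cosh (of_real pi * u / of_real w) = 0"
        using exp_log_cosh_real[OF w, of x] log_cosh_0_real[OF w] by (simp add: c_def)
    qed (use conv z w in \<open>auto simp: S_def convex_connected\<close>)
    then show ?thesis by simp
  qed
  have "log_cosh 1 (\<i> / 4) = (LINT y:{0<..}|lborel. (1 / 2) * cosh_kernel (1 / 2) 0 y)"
    unfolding log_cosh_def
  proof (rule set_lebesgue_integral_cong)
    show "\<forall>y. y \<in> {0<..} \<longrightarrow> cosh_kernel 1 (\<i> / 4) y = (1 / 2) * cosh_kernel (1 / 2) 0 y"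
    proof (intro allI impI)
      fix y :: real assume y: "y \<in> {0<..}"
      define Y where "Y = complex_of_real y / 2"
      have Y: "complex_of_real y = 2 * Y" "Y \<noteq> 0" "sinh Y \<noteq> 0" "cosh Y \<noteq> 0" 
      proof -
        show "cosh Y \<noteq> 0" using cosh_of_real[of "y / 2"] cosh_real_pos[of "y / 2"] 
          by (metis Y_def less_irrefl of_real_0 of_real_divide of_real_eq_iff of_real_numeral)
      qed (use y in \<open>auto simp: Y_def intro!: sinh_nonzero\<close>)
      have "cos (2 * (2 * Y) * (\<i> / 4)) = cosh Y" by (simp add: cosh_conv_cos mult_ac)
      moreover have "sinh (2 * Y) = 2 * sinh Y * cosh Y" by (rule sinh_double)
      ultimately show "cosh_kernel 1 (\<i> / 4) y = (1 / 2) * cosh_kernel (1 / 2) 0 y"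
        unfolding cosh_kernel_def Y(1) using Y(2-) by (simp add: field_simps)
    qed
  qed auto
  also have "\<dots> = log_cosh 1 0 / 2"
    using log_cosh_0_real[of "1 / 2"] by (simp add: log_cosh_def)
  finally have "2 * log_cosh 1 (\<i> / 4) = log_cosh 1 0" by (simp only:) simp
  \<comment> \<open>Together with \<open>e2\<close> and \<open>e3\<close> this reads c = c^2 / 2, so
    c = 2.\<close>
  then have e1: "exp (log_cosh 1 (\<i> / 4)) ^ 2 = c" by (simp only: c_def exp_double[symmetric])
  have e2: "exp (log_cosh 1 (\<i> / 4)) = c * cosh (of_real pi * (\<i> / 4))"
    using real_w[of 1 "\<i> / 4"] by simp
  have e3: "cosh (of_real pi * (\<i> / 4)) = of_real (sqrt 2 / 2)"
  proof -
    have "cosh (of_real pi * (\<i> / 4)) = cos (complex_of_real (pi / 4))" by (simp add: cosh_conv_cos mult_ac)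
    then show ?thesis by (simp only: cos_of_real cos_45)
  qed
  have e4: "complex_of_real (sqrt 2 / 2) ^ 2 = 1 / 2"
    by (simp only: of_real_power[symmetric]) (simp add: power_divide)
  have "c = c\<^sup>2 * (1 / 2)" using e1 unfolding e2 e3 power_mult_distrib e4 by simp
  moreover have "c \<noteq> 0" by (simp add: c_def)
  ultimately have c2: "c = 2" by (simp add: power2_eq_square)
  define T where "T = {w. 2 * \<bar>Im z\<bar> < Re w}"
  have T: "convex T" "open T" unfolding T_def by (simp_all add: convex_halfspace_Re_gt open_halfspace_Re_gt)
  define w0 where "w0 = complex_of_real (2 * \<bar>Im z\<bar> + 1)"
  have "exp (log_cosh w z) - 2 * cosh (of_real pi * z / w) = 0"
  proof (rule analytic_continuation[where S = T and U = "of_real ` {2 * \<bar>Im z\<bar><..}" and \<xi> = w0 and 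
        f = "\<lambda>w. exp (log_cosh w z) - 2 * cosh (of_real pi * z / w)"])
    show "(\<lambda>w. exp (log_cosh w z) - 2 * cosh (of_real pi * z / w)) holomorphic_on T"
      unfolding cosh_conv_cos using holomorphic_log_cosh_fixed_argument[of z]
      by (intro holomorphic_intros) (auto simp: T_def)
    show "w0 islimpt complex_of_real ` {2 * \<bar>Im z\<bar><..}"
    proof (subst islimpt_approachable, intro allI impI)
      fix d :: real assume d: "d > 0"
      show "\<exists>x'\<in>complex_of_real ` {2 * \<bar>Im z\<bar><..}. x' \<noteq> w0 \<and> dist x' w0 < d"
        by (rule bexI[of _ "of_real (2 * \<bar>Im z\<bar> + 1 + d / 2)"]) 
          (use d in \<open>auto simp: w0_def dist_of_real dist_real_def simp del: of_real_add of_real_mult\<close>)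
    qed
    fix u :: complex assume "u \<in> of_real ` {2 * \<bar>Im z\<bar><..}"
    then obtain x where x: "u = of_real x" "x > 2 * \<bar>Im z\<bar>" by auto
    then have "x > 0" using abs_ge_zero[of "Im z"] by linarith
    with x show "exp (log_cosh u z) - 2 * cosh (of_real pi * z / u) = 0"
      using real_w[of x z] c2 by simp
  qed (use T assms in \<open>auto simp: T_def w0_def convex_connected\<close>)
  then show ?thesis by simp
qed

text \<open>The exponential of \<open>log_cosh_eq\<close>. The bound on Im z says exactly that both
  shifted arguments lie in the strip where the integral converges.\<close>

theorem hyp_gamma_strip_shift:
  assumes "Re w1 > 0" "2 * \<bar>Im z\<bar> < Re w2"
  shows "hyp_gamma_strip w1 w2 (z + \<i> * w1 / 2) = 2 * cosh (of_real pi * z / w2) * hyp_gamma_strip w1 w2 (z - \<i> * w1 / 2)"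
proof -
  have "Re w2 > 0" using assms(2) abs_ge_zero[of "Im z"] by linarith
  then have "exp (\<i> * (gamma_log w1 w2 (z + \<i> * w1 / 2) - gamma_log w1 w2 (z - \<i> * w1 / 2))) = 2 * cosh (of_real pi * z / w2)"
    using exp_log_cosh[OF assms(2)] log_cosh_eq[of w2 z w1] assms by simp
  then show ?thesis unfolding hyp_gamma_strip_eq by (simp add: right_diff_distrib exp_diff field_simps)
qed

section \<open>The hyperbolic gamma function as a meromorphic function\<close>

text \<open>The difference vanishes identically once its singularities are removed, so near any
  point the functions agree except possibly at the point itself; the convention of value 0 at poles
  and the limit elsewhere then fixes that value. This makes the definite description in
  \<open>hyp_gamma\<close> meaningful.\<close>

lemma nicely_meromorphic_on_UNIV_unique:
  assumes f: "f nicely_meromorphic_on UNIV" and g: "g nicely_meromorphic_on UNIV"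
    and W: "open W" "w \<in> W" "\<And>z. z \<in> W \<Longrightarrow> f z = g z"
  shows "f = g"
proof
  fix z
  define h where "h = (\<lambda>z. f z - g z)"
  have h: "h meromorphic_on UNIV" 
    using f g by (auto simp: h_def nicely_meromorphic_on_def intro!: meromorphic_intros)
  have iso: "isolated_singularity_at h u" for u
    using h by (metis meromorphic_onE UNIV_I)
  have ev: "\<forall>\<^sub>F u in at v. remove_sings h u = h u" for v
    using iso by (rule eventually_remove_sings_eq_at)
  have "\<forall>\<^sub>F u in at w. u \<in> W" using W by (intro eventually_at_in_open') auto
  with ev[of w] have "\<forall>\<^sub>F u in at w. remove_sings h u = 0"
    by eventually_elim (use W in \<open>auto simp: h_def\<close>)
  then have "\<exists>\<^sub>F u in at w. remove_sings h u = 0"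
    by (rule eventually_frequently[rotated]) simp
  from frequently_eq_meromorphic_imp_constant[OF this remove_sings_nicely_meromorphic[OF h]]
  have "remove_sings h u = 0" for u by auto
  with ev[of z] have eq: "\<forall>\<^sub>F u in at z. f u = g u" by (simp add: h_def)
  have "(is_pole f z \<and> f z = 0) \<or> f \<midarrow>z\<rightarrow> f z" "(is_pole g z \<and> g z = 0) \<or> g \<midarrow>z\<rightarrow> g z"
    using f g by (auto simp: nicely_meromorphic_on_def)
  moreover have "is_pole f z \<longleftrightarrow> is_pole g z" by (rule is_pole_cong[OF eq refl])
  moreover have "f \<midarrow>z\<rightarrow> f z \<longleftrightarrow> g \<midarrow>z\<rightarrow> f z" by (rule filterlim_cong[OF refl refl eq])
  moreover have "\<not> (is_pole f z \<and> f \<midarrow>z\<rightarrow> f z)" "\<not> (is_pole g z \<and> g \<midarrow>z\<rightarrow> g z)"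
    by (auto simp: is_pole_def dest: not_tendsto_and_filterlim_at_infinity[rotated -1])
  ultimately show "f z = g z" by (auto dest: LIM_unique)
qed

lemma cosh_nonzero: "Re u \<noteq> 0 \<Longrightarrow> cosh u \<noteq> 0" for u :: complex
proof
  assume "Re u \<noteq> 0" "cosh u = 0"
  then have "exp u = - exp (- u)" by (simp add: cosh_def add_eq_0_iff2)
  then have "norm (exp u) = norm (exp (- u))" by simp
  with \<open>Re u \<noteq> 0\<close> show False by simp
qed

definition gamma_factor :: "complex \<Rightarrow> complex \<Rightarrow> complex \<Rightarrow> complex" where
  "gamma_factor w1 w2 z = 2 * cosh (of_real pi * z / w2)"

text \<open>At most one of the products is nonempty, since \<open>nat\<close> maps negative integers
  to 0: positive m multiplies by the factors met on the way up from the strip, negative m divides by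
  those met on the way down.\<close>

definition gamma_prod :: "complex \<Rightarrow> complex \<Rightarrow> int \<Rightarrow> complex \<Rightarrow> complex" where
  "gamma_prod w1 w2 m z = 
    (\<Prod>k<nat m. gamma_factor w1 w2 (z - \<i> * (of_nat k + 1/2) * w1)) /
    (\<Prod>k<nat (- m). gamma_factor w1 w2 (z + \<i> * (of_nat k + 1/2) * w1))"

text \<open>The continuation after \<open>m\<close> steps of the difference equation. At a pole a factor of the
  denominator vanishes and \<open>x / 0 = 0\<close> gives the value prescribed by \<open>nicely_meromorphic_on\<close>.\<close>

definition gamma_ext :: "complex \<Rightarrow> complex \<Rightarrow> int \<Rightarrow> complex \<Rightarrow> complex" where
  "gamma_ext w1 w2 m z = hyp_gamma_strip w1 w2 (z - \<i> * of_int m * w1) * gamma_prod w1 w2 m z"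

text \<open>Subtracting the nearest multiple of \<i> w1 brings the imaginary part to at most Re w1 /
  2 in modulus, strictly inside the strip.\<close>

definition gamma_level :: "complex \<Rightarrow> complex \<Rightarrow> int" where
  "gamma_level w1 z = round (Im z / Re w1)"

lemma hyp_gamma_strip_nonzero [simp]: "hyp_gamma_strip w1 w2 z \<noteq> 0"
  by (simp add: hyp_gamma_strip_eq)

lemma holomorphic_hyp_gamma_strip:
  assumes "Re w1 > 0" "Re w2 > 0"
  shows "hyp_gamma_strip w1 w2 holomorphic_on {z. 2 * \<bar>Im z\<bar> < Re w1 + Re w2}"
  unfolding hyp_gamma_strip_eq
  using holomorphic_gamma_log_line[of w1 0 w2 0 0 1] assms by (intro holomorphic_intros) simp

text \<open>For negative m the step deletes a factor from the denominator, which is legitimate only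
  if this factor is nonzero.\<close>

lemma gamma_prod_Suc:
  assumes "gamma_factor w1 w2 (z - \<i> * (of_int m + 1/2) * w1) \<noteq> 0"
  shows "gamma_prod w1 w2 (m + 1) z = gamma_prod w1 w2 m z * gamma_factor w1 w2 (z - \<i> * (of_int m + 1/2) * w1)"
proof (cases "m \<ge> 0")
  case True
  then obtain n where m: "m = int n" by (metis nonneg_eq_int)
  have "nat (m + 1) = Suc n" "nat (- m) = 0" "nat (- (m + 1)) = 0" "nat m = n" by (auto simp: m)
  then show ?thesis by (simp add: gamma_prod_def m)
next
  case False
  define n where "n = nat (- m - 1)"
  have m: "m = - int n - 1" using False by (simp add: n_def)
  have "nat (m + 1) = 0" "nat (- m) = Suc n" "nat (- (m + 1)) = n" "nat m = 0" by (auto simp: m)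
  moreover have "z + \<i> * (of_nat n + 1/2) * w1 = z - \<i> * (of_int m + 1/2) * w1" by (simp add: m algebra_simps)
  ultimately show ?thesis using assms by (simp add: gamma_prod_def)
qed

lemma abs_diff_between:
  fixes t :: real
  assumes "a \<le> b" "b \<le> c" "2 * \<bar>t - a\<bar> < r" "2 * \<bar>t - c\<bar> < r"
  shows "2 * \<bar>t - b\<bar> < r"
  using assms by (auto simp: abs_if split: if_splits)

context
  fixes w1 w2 :: complex
  assumes w: "Re w1 > 0" "Re w2 > 0"
begin

text \<open>On the overlap of two neighbouring strips the difference equation applies at the
  midpoint \<open>u\<close> of the two shifted arguments. The factor there is nonzero because the
  strip function has no zeros.\<close>

lemma gamma_ext_Suc:
  assumes "2 * \<bar>Im z - of_int m * Re w1\<bar> < Re w1 + Re w2" "2 * \<bar>Im z - of_int (m + 1) * Re w1\<bar> < Re w1 + Re w2"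
  shows "gamma_ext w1 w2 m z = gamma_ext w1 w2 (m + 1) z"
proof -
  define u where "u = z - \<i> * (of_int m + 1/2) * w1"
  have "Im u = Im z - of_int m * Re w1 - Re w1 / 2" by (simp add: u_def algebra_simps)
  then have "2 * \<bar>Im u\<bar> < Re w2" using assms w by (auto simp: abs_if algebra_simps split: if_splits)
  from hyp_gamma_strip_shift[OF w(1) this] 
  have s: "hyp_gamma_strip w1 w2 (u + \<i> * w1 / 2) = gamma_factor w1 w2 u * hyp_gamma_strip w1 w2 (u - \<i> * w1 / 2)"
    by (simp add: gamma_factor_def)
  then have "gamma_factor w1 w2 u \<noteq> 0" by (metis hyp_gamma_strip_nonzero mult_zero_left)
  then have "gamma_prod w1 w2 (m + 1) z = gamma_prod w1 w2 m z * gamma_factor w1 w2 u"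
    unfolding u_def by (rule gamma_prod_Suc)
  moreover have "z - \<i> * of_int m * w1 = u + \<i> * w1 / 2" "z - \<i> * of_int (m + 1) * w1 = u - \<i> * w1 / 2"
    by (simp_all add: u_def algebra_simps)
  ultimately show ?thesis unfolding gamma_ext_def by (simp only: s mult_ac)
qed

text \<open>If Re w2 is large, strips of distant levels overlap as well. All levels in between are
  then admissible by \<open>abs_diff_between\<close>, and the one-step case applies along
  them.\<close>

lemma gamma_ext_eq:
  assumes "2 * \<bar>Im z - of_int m * Re w1\<bar> < Re w1 + Re w2" "2 * \<bar>Im z - of_int n * Re w1\<bar> < Re w1 + Re w2"
  shows "gamma_ext w1 w2 m z = gamma_ext w1 w2 n z"
proof -
  have le: "gamma_ext w1 w2 m z = gamma_ext w1 w2 n z"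
    if "m \<le> n" "2 * \<bar>Im z - of_int m * Re w1\<bar> < Re w1 + Re w2" "2 * \<bar>Im z - of_int n * Re w1\<bar> < Re w1 + Re w2" for m n
    using that
  proof (induction n rule: int_ge_induct)
    case (step j)
    have "of_int m * Re w1 \<le> of_int j * Re w1" "of_int j * Re w1 \<le> of_int (j + 1) * Re w1"
      using step.hyps w by (intro mult_right_mono; simp)+
    then have j: "2 * \<bar>Im z - of_int j * Re w1\<bar> < Re w1 + Re w2" 
      using step.prems by (rule abs_diff_between)
    then show ?case using step.IH step.prems gamma_ext_Suc by metis
  qed simp
  show ?thesis
  proof (cases "m \<le> n")
    case True
    then show ?thesis by (rule le[OF _ assms])
  next
    case False
    then show ?thesis by (intro le[OF _ assms(2,1), symmetric]) simp
  qed
qed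

lemma gamma_level_strip: "2 * \<bar>Im z - of_int (gamma_level w1 z) * Re w1\<bar> < Re w1 + Re w2"
proof -
  have "\<bar>of_int (gamma_level w1 z) - Im z / Re w1\<bar> \<le> 1 / 2"
    unfolding gamma_level_def by (rule of_int_round_abs_le)
  then have "\<bar>of_int (gamma_level w1 z) - Im z / Re w1\<bar> * Re w1 \<le> 1 / 2 * Re w1"
    using w by (intro mult_right_mono) auto
  also have "\<bar>of_int (gamma_level w1 z) - Im z / Re w1\<bar> * Re w1 = \<bar>(of_int (gamma_level w1 z) - Im z / Re w1) * Re w1\<bar>"
    using w by (simp add: abs_mult)
  also have "(of_int (gamma_level w1 z) - Im z / Re w1) * Re w1 = - (Im z - of_int (gamma_level w1 z) * Re w1)"
    using w by (simp add: field_simps)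
  finally show ?thesis using w by (simp only: abs_minus_cancel) simp
qed

lemma gamma_ext_level: 
  assumes "2 * \<bar>Im z - of_int m * Re w1\<bar> < Re w1 + Re w2" 
  shows "gamma_ext w1 w2 (gamma_level w1 z) z = gamma_ext w1 w2 m z"
  using gamma_ext_eq[OF gamma_level_strip assms] .

lemma gamma_prod_num_analytic: 
  fixes n :: nat
  shows "(\<lambda>z. \<Prod>k<n. gamma_factor w1 w2 (z + c k)) holomorphic_on UNIV"
  unfolding gamma_factor_def cosh_conv_cos using w by (intro holomorphic_intros) auto

lemma gamma_prod_den_nonzero: 
  fixes n :: nat
  shows "\<forall>\<^sub>F z in at z0. (\<Prod>k<n. gamma_factor w1 w2 (z + c k)) \<noteq> 0"
proof -
  have "\<forall>\<^sub>F z in at z0. gamma_factor w1 w2 (z + c k) \<noteq> 0" for k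
  proof -
    have "gamma_factor w1 w2 ((w2 - c k) + c k) \<noteq> 0" 
      using w unfolding gamma_factor_def by (auto intro!: cosh_nonzero)
    moreover have "(\<lambda>z. gamma_factor w1 w2 (z + c k)) holomorphic_on UNIV"
      unfolding gamma_factor_def cosh_conv_cos using w by (intro holomorphic_intros) auto
    ultimately have "\<forall>\<^sub>F z in at z0. gamma_factor w1 w2 (z + c k) \<noteq> 0 \<and> z \<in> UNIV"
      by (intro non_zero_neighbour_alt[where \<beta> = "w2 - c k"]) auto
    then show ?thesis by simp
  qed
  then have "\<forall>\<^sub>F z in at z0. \<forall>k\<in>{..<n}. gamma_factor w1 w2 (z + c k) \<noteq> 0"
    by (intro eventually_ball_finite) auto
  then show ?thesis by eventually_elim auto
qed

lemma gamma_ext_nicely_meromorphic: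
  assumes z0: "2 * \<bar>Im z0 - of_int m * Re w1\<bar> < Re w1 + Re w2"
  shows "gamma_ext w1 w2 m nicely_meromorphic_on {z0}"
proof -
  define S where "S = {z. 2 * \<bar>Im z - of_int m * Re w1\<bar> < Re w1 + Re w2}"
  have "continuous_on UNIV (\<lambda>z. 2 * \<bar>Im z - of_int m * Re w1\<bar>)" by (intro continuous_intros)
  then have S: "open S" "z0 \<in> S" using z0 by (auto simp: S_def intro!: open_Collect_less)
  define N where "N = (\<lambda>z. hyp_gamma_strip w1 w2 (z - \<i> * of_int m * w1) * (\<Prod>k<nat m. gamma_factor w1 w2 (z + (- \<i> * (of_nat k + 1/2) * w1))))"
  define D where "D = (\<lambda>z. \<Prod>k<nat (- m). gamma_factor w1 w2 (z + \<i> * (of_nat k + 1/2) * w1))"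
  have eq: "gamma_ext w1 w2 m = (\<lambda>z. N z / D z)"
    by (simp add: gamma_ext_def gamma_prod_def N_def D_def fun_eq_iff)
  have "(\<lambda>z. hyp_gamma_strip w1 w2 (z - \<i> * of_int m * w1)) holomorphic_on S"
    by (rule holomorphic_on_compose_gen[of "\<lambda>z. z - \<i> * of_int m * w1" S, OF _ holomorphic_hyp_gamma_strip[OF w], unfolded o_def])
       (auto simp: S_def intro!: holomorphic_intros)
  then have "N holomorphic_on S" unfolding N_def
    by (intro holomorphic_on_mult holomorphic_on_subset[OF gamma_prod_num_analytic] subset_UNIV)
  then have N: "N analytic_on {z0}" using S by (auto simp: analytic_at)
  have "D holomorphic_on UNIV" unfolding D_def by (rule gamma_prod_num_analytic)
  then have D: "D analytic_on {z0}" by (auto simp: analytic_at)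
  show ?thesis
  proof (cases "D z0 = 0")
    case False
    then have "(\<lambda>z. N z / D z) analytic_on {z0}" using N D by (intro analytic_intros) auto
    then show ?thesis unfolding eq by (rule analytic_on_imp_nicely_meromorphic_on)
  next
    case True
    \<comment> \<open>A zero of \<open>D\<close> needs a nonempty product, hence m < 0; then
      \<open>N\<close> consists of the zero-free strip function alone and cannot cancel the
      pole.\<close>
    then have "m < 0" by (rule_tac ccontr) (simp add: D_def)
    then have "N z0 \<noteq> 0" by (simp add: N_def)
    have "\<forall>\<^sub>F z in at z0. D z \<noteq> 0" unfolding D_def by (rule gamma_prod_den_nonzero)
    moreover have "D \<midarrow>z0\<rightarrow> 0" using analytic_at_imp_isCont[OF D] True by (simp add: isCont_def)
    ultimately have "filterlim D (at 0) (at z0)" by (simp add: filterlim_at)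
    then have "is_pole (\<lambda>z. N z / D z) z0"
      using \<open>N z0 \<noteq> 0\<close> analytic_at_imp_isCont[OF N] by (intro is_pole_divide)
    moreover have "(\<lambda>z. N z / D z) meromorphic_on {z0}"
      using N D by (intro meromorphic_intros analytic_on_imp_meromorphic_on)
    ultimately show ?thesis using True unfolding eq nicely_meromorphic_on_def by simp
  qed
qed

lemma gamma_ext_level_nicely_meromorphic: "(\<lambda>z. gamma_ext w1 w2 (gamma_level w1 z) z) nicely_meromorphic_on UNIV"
proof -
  define G where "G = (\<lambda>z. gamma_ext w1 w2 (gamma_level w1 z) z)"
  have loc: "G meromorphic_on {z0} \<and> ((is_pole G z0 \<and> G z0 = 0) \<or> G \<midarrow>z0\<rightarrow> G z0)" for z0
  proof -
    define m where "m = gamma_level w1 z0"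
    define S where "S = {z. 2 * \<bar>Im z - of_int m * Re w1\<bar> < Re w1 + Re w2}"
    have "continuous_on UNIV (\<lambda>z. 2 * \<bar>Im z - of_int m * Re w1\<bar>)" by (intro continuous_intros)
    then have S: "open S" "z0 \<in> S" using gamma_level_strip[of z0] by (auto simp: S_def m_def intro!: open_Collect_less)
    have eqS: "G z = gamma_ext w1 w2 m z" if "z \<in> S" for z
      using gamma_ext_level that by (simp add: G_def S_def)
    have "\<forall>\<^sub>F z in at z0. z \<in> S" using S by (intro eventually_at_in_open') auto
    then have eq: "\<forall>\<^sub>F z in at z0. G z = gamma_ext w1 w2 m z" by eventually_elim (rule eqS)
    have n: "gamma_ext w1 w2 m nicely_meromorphic_on {z0}"
      by (rule gamma_ext_nicely_meromorphic) (use S in \<open>simp add: S_def\<close>)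
    have "G meromorphic_on {z0} \<longleftrightarrow> gamma_ext w1 w2 m meromorphic_on {z0}"
      by (rule meromorphic_on_cong) (use eq in auto)
    moreover have "is_pole G z0 \<longleftrightarrow> is_pole (gamma_ext w1 w2 m) z0" by (rule is_pole_cong[OF eq refl])
    moreover have "G \<midarrow>z0\<rightarrow> G z0 \<longleftrightarrow> gamma_ext w1 w2 m \<midarrow>z0\<rightarrow> G z0" by (rule filterlim_cong[OF refl refl eq])
    ultimately show ?thesis using n eqS[OF S(2)] by (simp add: nicely_meromorphic_on_def)
  qed
  show ?thesis unfolding nicely_meromorphic_on_def G_def[symmetric]
    using loc meromorphic_on_meromorphic_at[of G UNIV] by auto
qed

text \<open>The glued function shows existence of the continuation, and agreement on the strip gives
  uniqueness.\<close>

theorem hyp_gamma_eq_level: "hyp_gamma w1 w2 z = gamma_ext w1 w2 (gamma_level w1 z) z"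
proof -
  define P where "P = (\<lambda>f. f nicely_meromorphic_on UNIV \<and>
        (\<forall>z. \<bar>Im z\<bar> < Re (wmean w1 w2) \<longrightarrow> f z = hyp_gamma_strip w1 w2 z))"
  have "P (\<lambda>z. gamma_ext w1 w2 (gamma_level w1 z) z)"
    unfolding P_def
  proof (intro conjI allI impI)
    fix z assume "\<bar>Im z\<bar> < Re (wmean w1 w2)"
    then have "gamma_ext w1 w2 (gamma_level w1 z) z = gamma_ext w1 w2 0 z"
      by (intro gamma_ext_level) (simp add: wmean_def)
    then show "gamma_ext w1 w2 (gamma_level w1 z) z = hyp_gamma_strip w1 w2 z"
      by (simp add: gamma_ext_def gamma_prod_def)
  qed (rule gamma_ext_level_nicely_meromorphic)
  moreover have "f = g" if "P f" "P g" for f g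
  proof (rule nicely_meromorphic_on_UNIV_unique[where W = "{z. \<bar>Im z\<bar> < Re (wmean w1 w2)}" and w = 0])
    have "continuous_on UNIV (\<lambda>z. \<bar>Im z\<bar>)" by (intro continuous_intros)
    then show "open {z. \<bar>Im z\<bar> < Re (wmean w1 w2)}" by (auto intro!: open_Collect_less)
  qed (use that w in \<open>auto simp: P_def wmean_def\<close>)
  ultimately have "(THE f. P f) = (\<lambda>z. gamma_ext w1 w2 (gamma_level w1 z) z)"
    by (intro the_equality) blast+
  then show ?thesis unfolding hyp_gamma_def P_def by simp
qed

text \<open>Every admissible level gives the same value, so on an open set where one level stays
  admissible \<open>hyp_gamma\<close> is a single explicit formula.\<close>

lemma hyp_gamma_eq_ext:
  assumes "2 * \<bar>Im z - of_int m * Re w1\<bar> < Re w1 + Re w2" 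
  shows "hyp_gamma w1 w2 z = gamma_ext w1 w2 m z"
  using gamma_ext_level[OF assms] hyp_gamma_eq_level by simp

lemma hyp_gamma_eq_strip:
  assumes "2 * \<bar>Im z\<bar> < Re w1 + Re w2"
  shows "hyp_gamma w1 w2 z = hyp_gamma_strip w1 w2 z"
  using hyp_gamma_eq_ext[of z 0] assms by (simp add: gamma_ext_def gamma_prod_def)

end

section \<open>Real periods\<close>

lemma gamma_kernel_uminus: "gamma_kernel w1 w2 (- z) y = - gamma_kernel w1 w2 z y"
  unfolding gamma_kernel_def by (simp add: diff_divide_distrib)

lemma gamma_log_uminus: "gamma_log w1 w2 (- z) = - gamma_log w1 w2 z"
  by (simp add: gamma_log_def gamma_kernel_uminus set_lebesgue_integral_def)

lemma hyp_gamma_strip_uminus: "hyp_gamma_strip w1 w2 (- z) = inverse (hyp_gamma_strip w1 w2 z)"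
  by (simp add: hyp_gamma_strip_eq gamma_log_uminus exp_minus)

lemma gamma_kernel_cnj:
  "gamma_kernel (of_real w1) (of_real w2) (cnj z) y = cnj (gamma_kernel (of_real w1) (of_real w2) z y)"
proof -
  have "sin (2 * complex_of_real y * cnj z) = cnj (sin (2 * complex_of_real y * z))"
    by (simp add: cnj_sin)
  moreover have "sinh (complex_of_real w * complex_of_real y) = cnj (sinh (complex_of_real w * complex_of_real y))" for w
    by (simp flip: of_real_mult add: sinh_of_real)
  ultimately show ?thesis by (simp add: gamma_kernel_def)
qed

text \<open>For real periods the kernel commutes with conjugation while the factor \<i> in the
  exponent changes sign. This is what makes the integrand of \<open>\<psi>\<close> a squared
  absolute value in the nonvanishing argument.\<close>

lemma hyp_gamma_strip_cnj:
  "cnj (hyp_gamma_strip (of_real w1) (of_real w2) z) = inverse (hyp_gamma_strip (of_real w1) (of_real w2) (cnj z))"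
proof -
  have "gamma_log (of_real w1) (of_real w2) (cnj z) = cnj (gamma_log (of_real w1) (of_real w2) z)"
    unfolding gamma_log_def set_lebesgue_integral_def
    by (subst Bochner_Integration.integral_cnj[symmetric]) (simp add: gamma_kernel_cnj)
  then show ?thesis by (simp add: hyp_gamma_strip_eq exp_cnj exp_minus[symmetric])
qed

text \<open>The integrand of \<open>ln \<bar>G (t - \<i> b)\<bar>\<close> depends on \<open>t\<close> only through \<open>cos (2 y t)\<close>, with a
  non-negative weight.\<close>

lemma norm_hyp_gamma_strip_le:
  fixes w1 w2 b t :: real
  assumes w: "w1 > 0" "w2 > 0" and b: "0 \<le> b" "2 * b < w1 + w2"
  shows "norm (hyp_gamma_strip (of_real w1) (of_real w2) (of_real t - \<i> * of_real b)) \<le> norm (hyp_gamma_strip (of_real w1) (of_real w2) (- \<i> * of_real b))"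
proof -
  let ?K = "\<lambda>z y. gamma_kernel (of_real w1) (of_real w2) z y"
  have im: "Im (?K z y) = (Im (sin (2 * of_real y * z)) / (2 * sinh (w1 * y) * sinh (w2 * y)) - Im z / (w1 * w2 * y)) / y" for z and y :: real
  proof -
    have "?K z y = (sin (2 * of_real y * z) / of_real (2 * sinh (w1 * y) * sinh (w2 * y)) - z / of_real (w1 * w2 * y)) / of_real y"
    proof -
      have "sinh (complex_of_real w * complex_of_real y) = complex_of_real (sinh (w * y))" for w
        by (simp flip: of_real_mult add: sinh_of_real)
      then show ?thesis by (simp add: gamma_kernel_def)
    qed
    then show ?thesis by (simp only: Im_divide_of_real minus_complex.sel)
  qed
  have int: "set_integrable lborel {0<..} (?K z)" if "2 * \<bar>Im z\<bar> < w1 + w2" for z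
    using w that by (intro set_integrable_gamma_kernel) auto
  have Im_log: "Im (gamma_log (of_real w1) (of_real w2) z) = (\<integral>y. Im (indicator {0<..} y *\<^sub>R ?K z y) \<partial>lborel)" 
    if "2 * \<bar>Im z\<bar> < w1 + w2" for z
    using int[OF that] unfolding gamma_log_def set_lebesgue_integral_def set_integrable_def by (rule integral_Im[symmetric])
  have int': "integrable lborel (\<lambda>y. Im (indicator {0<..} y *\<^sub>R ?K z y))" if "2 * \<bar>Im z\<bar> < w1 + w2" for z
    using int[OF that] unfolding set_integrable_def by (rule integrable_Im)
  have z: "2 * \<bar>Im (of_real t - \<i> * of_real b)\<bar> < w1 + w2" "2 * \<bar>Im (- \<i> * of_real b)\<bar> < w1 + w2"
    using b by simp_all
  have "Im (gamma_log (of_real w1) (of_real w2) (- \<i> * of_real b)) \<le> Im (gamma_log (of_real w1) (of_real w2) (of_real t - \<i> * of_real b))"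
    unfolding Im_log[OF z(1)] Im_log[OF z(2)]
  proof (rule Bochner_Integration.integral_mono[OF int'[OF z(2)] int'[OF z(1)]])
    fix y :: real
    show "Im (indicator {0<..} y *\<^sub>R ?K (- \<i> * of_real b) y) \<le> Im (indicator {0<..} y *\<^sub>R ?K (of_real t - \<i> * of_real b) y)"
    proof (cases "y > 0")
      case True
      have s: "Im (sin (2 * of_real y * (of_real t - \<i> * of_real b))) = - cos (2 * y * t) * sinh (2 * y * b)" for t
        by (simp add: Im_sin sinh_def exp_minus field_simps)
      have "cos (2 * y * t) * sinh (2 * y * b) \<le> 1 * sinh (2 * y * b)"
        using True b by (intro mult_right_mono) auto
      then have "Im (sin (2 * of_real y * (- \<i> * of_real b))) \<le> Im (sin (2 * of_real y * (of_real t - \<i> * of_real b)))"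
        using s[of t] s[of 0] by simp
      then have "Im (?K (- \<i> * of_real b) y) \<le> Im (?K (of_real t - \<i> * of_real b) y)"
        unfolding im using True w by (intro divide_right_mono diff_mono) auto
      then show ?thesis using True by simp
    qed simp
  qed
  then show ?thesis by (simp add: hyp_gamma_strip_eq)
qed

section \<open>Exponential bounds on a horizontal strip and shifting the contour\<close>

definition exp_bounded :: "real \<Rightarrow> real \<Rightarrow> (complex \<Rightarrow> complex) \<Rightarrow> bool" where
  "exp_bounded h k f \<longleftrightarrow> (\<exists>C\<ge>0. \<forall>z. 0 \<le> Im z \<and> Im z \<le> h \<longrightarrow> norm (f z) \<le> C * exp (k * \<bar>Re z\<bar>))"

lemma exp_bounded_mult:
  assumes "exp_bounded h k f" "exp_bounded h l g"
  shows "exp_bounded h (k + l) (\<lambda>z. f z * g z)"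
proof -
  obtain C where C: "C \<ge> 0" "\<And>z. 0 \<le> Im z \<Longrightarrow> Im z \<le> h \<Longrightarrow> norm (f z) \<le> C * exp (k * \<bar>Re z\<bar>)"
    using assms(1) by (auto simp: exp_bounded_def)
  obtain D where D: "D \<ge> 0" "\<And>z. 0 \<le> Im z \<Longrightarrow> Im z \<le> h \<Longrightarrow> norm (g z) \<le> D * exp (l * \<bar>Re z\<bar>)"
    using assms(2) by (auto simp: exp_bounded_def)
  have "norm (f z * g z) \<le> (C * D) * exp ((k + l) * \<bar>Re z\<bar>)" if "0 \<le> Im z" "Im z \<le> h" for z
  proof -
    have "norm (f z * g z) \<le> (C * exp (k * \<bar>Re z\<bar>)) * (D * exp (l * \<bar>Re z\<bar>))"
      unfolding norm_mult using C D that by (intro mult_mono) auto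
    then show ?thesis by (simp add: exp_add algebra_simps)
  qed
  then show ?thesis unfolding exp_bounded_def using C D by (intro exI[of _ "C * D"]) auto
qed

lemma exp_bounded_add:
  assumes "exp_bounded h k f" "exp_bounded h k g"
  shows "exp_bounded h k (\<lambda>z. f z + g z)"
proof -
  obtain C where C: "C \<ge> 0" "\<And>z. 0 \<le> Im z \<Longrightarrow> Im z \<le> h \<Longrightarrow> norm (f z) \<le> C * exp (k * \<bar>Re z\<bar>)"
    using assms(1) by (auto simp: exp_bounded_def)
  obtain D where D: "D \<ge> 0" "\<And>z. 0 \<le> Im z \<Longrightarrow> Im z \<le> h \<Longrightarrow> norm (g z) \<le> D * exp (k * \<bar>Re z\<bar>)"
    using assms(2) by (auto simp: exp_bounded_def)
  have "norm (f z + g z) \<le> (C + D) * exp (k * \<bar>Re z\<bar>)" if "0 \<le> Im z" "Im z \<le> h" for z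
    unfolding distrib_right by (rule order_trans[OF norm_triangle_ineq add_mono[OF C(2)[OF that] D(2)[OF that]]])
  then show ?thesis unfolding exp_bounded_def using C D by (intro exI[of _ "C + D"]) auto
qed

lemma exp_bounded_const: "0 \<le> k \<Longrightarrow> exp_bounded h k (\<lambda>_. c)"
  unfolding exp_bounded_def by (intro exI[of _ "norm c"]) (auto simp: mult_le_cancel_left1)

lemma exp_bounded_exp:
  assumes "\<bar>a\<bar> \<le> k"
  shows "exp_bounded h k (\<lambda>z. exp (of_real a * z))"
  unfolding exp_bounded_def
proof (intro exI[of _ 1] conjI allI impI)
  fix z :: complex
  have "a * Re z \<le> \<bar>a\<bar> * \<bar>Re z\<bar>" by (metis abs_ge_self abs_mult)
  also have "\<dots> \<le> k * \<bar>Re z\<bar>" using assms by (intro mult_right_mono) auto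
  finally show "norm (exp (of_real a * z)) \<le> 1 * exp (k * \<bar>Re z\<bar>)" by simp
qed simp

lemma integrable_exp_neg_abs:
  assumes k: "k < 0"
  shows "integrable lborel (\<lambda>t::real. exp (k * \<bar>t\<bar>))"
proof -
  define f where "f = (\<lambda>y::real. indicator {0<..} y *\<^sub>R (1 / (1 + y\<^sup>2)))"
  have f: "integrable lborel f" unfolding f_def by (rule integrable_inverse_1_plus_square)
  \<comment> \<open>From exp s \<ge> 1 + s + s^2 / 2 with s = - k |t|: this constant makes C exp s
    dominate 1 + t^2.\<close>
  define C where "C = 1 + 2 / k\<^sup>2"
  have "integrable lborel (\<lambda>t. C * (f t + f (0 + - 1 * t)))"
    using f lborel_integrable_real_affine[OF f, of "-1" 0] by (intro Bochner_Integration.integrable_mult_right Bochner_Integration.integrable_add) auto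
  then show ?thesis
  proof (rule Bochner_Integration.integrable_bound)
    show "AE t in lborel. norm (exp (k * \<bar>t\<bar>)) \<le> norm (C * (f t + f (0 + - 1 * t)))"
    proof (rule AE_mp[OF AE_lborel_singleton[of 0]], rule AE_I2, rule impI)
      fix t :: real assume "t \<noteq> 0"
      then have ft: "f t + f (0 + - 1 * t) = 1 / (1 + t\<^sup>2)" by (auto simp: f_def indicator_def)
      have C0: "C \<ge> 0" by (simp add: C_def)
      have "1 + t\<^sup>2 \<le> C * (1 + (- k * \<bar>t\<bar>) + (- k * \<bar>t\<bar>)\<^sup>2 / 2)"
      proof -
        have "C * (1 + 0 + (- k * \<bar>t\<bar>)\<^sup>2 / 2) \<le> C * (1 + (- k * \<bar>t\<bar>) + (- k * \<bar>t\<bar>)\<^sup>2 / 2)"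
          using k C0 by (intro mult_left_mono add_mono) (auto intro: mult_nonpos_nonneg)
        moreover have "C * (1 + 0 + (- k * \<bar>t\<bar>)\<^sup>2 / 2) = 1 + t\<^sup>2 + 2 / k\<^sup>2 + k\<^sup>2 * t\<^sup>2 / 2"
          using k by (simp add: C_def field_simps)
        moreover have "0 \<le> 2 / k\<^sup>2" "0 \<le> k\<^sup>2 * t\<^sup>2 / 2" by simp_all
        ultimately show ?thesis by linarith
      qed
      also have "\<dots> \<le> C * exp (- k * \<bar>t\<bar>)"
        using C0 k by (intro mult_left_mono exp_lower_Taylor_quadratic) (auto intro: mult_nonpos_nonneg)
      finally have "exp (k * \<bar>t\<bar>) \<le> C * (1 / (1 + t\<^sup>2))"
        by (simp add: exp_minus pos_le_divide_eq add_pos_nonneg field_simps)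
      then show "norm (exp (k * \<bar>t\<bar>)) \<le> norm (C * (f t + f (0 + - 1 * t)))"
        unfolding ft using C0 by (simp add: add_nonneg_nonneg)
    qed
  qed simp
qed

lemma exp_bounded_integrable:
  assumes f: "exp_bounded h k f" "k < 0" "0 \<le> s" "s \<le> h" and c: "continuous_on {z. 0 \<le> Im z \<and> Im z \<le> h} f"
  shows "integrable lborel (\<lambda>t::real. f (of_real t + \<i> * of_real s))"
proof -
  obtain C where C: "C \<ge> 0" "\<And>z. 0 \<le> Im z \<Longrightarrow> Im z \<le> h \<Longrightarrow> norm (f z) \<le> C * exp (k * \<bar>Re z\<bar>)"
    using f(1) by (auto simp: exp_bounded_def)
  have "integrable lborel (\<lambda>t. C * exp (k * \<bar>t\<bar>))"
    using integrable_exp_neg_abs[OF f(2)] by (rule Bochner_Integration.integrable_mult_right)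
  then show ?thesis
  proof (rule Bochner_Integration.integrable_bound)
    have "continuous_on UNIV (\<lambda>t::real. f (of_real t + \<i> * of_real s))"
      by (rule continuous_on_compose2[OF c]) (use f in \<open>auto intro!: continuous_intros\<close>)
    then show "(\<lambda>t::real. f (of_real t + \<i> * of_real s)) \<in> borel_measurable lborel"
      by (simp add: borel_measurable_continuous_onI)
    show "AE t in lborel. norm (f (of_real t + \<i> * of_real s)) \<le> norm (C * exp (k * \<bar>t\<bar>))"
      using C(1) f by (intro AE_I2) (auto intro!: order_trans[OF C(2)])
  qed
qed

text \<open>With a primitive \<open>F\<close> on the convex set \<open>S\<close> the integrals over
  two horizontal segments differ by the increments of \<open>F\<close> along the vertical sides,
  which tend to 0 like exp (k n).\<close>

lemma contour_shift:
  assumes f: "exp_bounded h k f" "k < 0" "0 \<le> h" and hol: "f holomorphic_on S" 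
    and S: "convex S" "open S" "{z. 0 \<le> Im z \<and> Im z \<le> h} \<subseteq> S"
  shows "(\<integral>t. f (of_real t + \<i> * of_real h) \<partial>lborel) = (\<integral>t. f (of_real t) \<partial>lborel)"
proof -
  obtain C where C: "C \<ge> 0" "\<And>z. 0 \<le> Im z \<Longrightarrow> Im z \<le> h \<Longrightarrow> norm (f z) \<le> C * exp (k * \<bar>Re z\<bar>)"
    using f(1) by (auto simp: exp_bounded_def)
  have "\<exists>F. \<forall>z\<in>S. (F has_field_derivative f z) (at z within S)"
  proof (rule holomorphic_convex_primitive'[OF S(1,2) hol])
    fix g assume "\<And>x. x \<in> S \<Longrightarrow> (g has_field_derivative f x) (at x within S)"
    then show "\<exists>F. \<forall>z\<in>S. (F has_field_derivative f z) (at z within S)" by (intro exI[of _ g] ballI)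
  qed
  then obtain F where F: "\<forall>z\<in>S. (F has_field_derivative f z) (at z within S)" ..
  have F': "(F has_field_derivative f z) (at z)" if "z \<in> S" for z
    using bspec[OF F that] by (simp only: at_within_open[OF that S(2)])
  have cS: "continuous_on {z. 0 \<le> Im z \<and> Im z \<le> h} f"
    by (rule continuous_on_subset[OF holomorphic_on_imp_continuous_on[OF hol] S(3)])
  define J where "J = (\<lambda>s n. \<integral>t. indicator {- real n..real n} t *\<^sub>R f (of_real t + \<i> * of_real s) \<partial>lborel)"
  have lim: "J s \<longlonglongrightarrow> (\<integral>t. f (of_real t + \<i> * of_real s) \<partial>lborel)" if s: "0 \<le> s" "s \<le> h" for s
    unfolding J_def
  proof (rule integral_dominated_convergence)
    have i: "integrable lborel (\<lambda>t::real. f (of_real t + \<i> * of_real s))"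
      by (rule exp_bounded_integrable[OF f(1,2) s cS])
    then show "integrable lborel (\<lambda>t. norm (f (of_real t + \<i> * of_real s)))" by (rule integrable_norm)
    show "(\<lambda>t. f (of_real t + \<i> * of_real s)) \<in> borel_measurable lborel" using i by simp
    then show "(\<lambda>t. indicator {- real n..real n} t *\<^sub>R f (of_real t + \<i> * of_real s)) \<in> borel_measurable lborel" for n
      by measurable
    show "AE t in lborel. (\<lambda>n. indicator {- real n..real n} t *\<^sub>R f (of_real t + \<i> * of_real s)) \<longlonglongrightarrow> f (of_real t + \<i> * of_real s)"
    proof (rule AE_I2)
      fix t :: real
      obtain N where N: "\<bar>t\<bar> \<le> real N" using real_arch_simple by blast
      have "\<forall>\<^sub>F n in sequentially. indicator {- real n..real n} t *\<^sub>R f (of_real t + \<i> * of_real s) = f (of_real t + \<i> * of_real s)"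
        using eventually_ge_at_top[of N]
      proof eventually_elim
        case (elim n)
        then have "real N \<le> real n" by simp
        then have "t \<in> {- real n..real n}" using N by (auto simp: abs_le_iff)
        then show ?case by simp
      qed
      then show "(\<lambda>n. indicator {- real n..real n} t *\<^sub>R f (of_real t + \<i> * of_real s)) \<longlonglongrightarrow> f (of_real t + \<i> * of_real s)"
        by (rule tendsto_eventually)
    qed
    show "AE t in lborel. norm (indicator {- real n..real n} t *\<^sub>R f (of_real t + \<i> * of_real s)) \<le> norm (f (of_real t + \<i> * of_real s))" for n
      by (intro AE_I2) (auto simp: indicator_def)
  qed
  have J: "J s n = F (of_real (real n) + \<i> * of_real s) - F (- of_real (real n) + \<i> * of_real s)" if s: "0 \<le> s" "s \<le> h" for s n
  proof -
    have "J s n = F (of_real (real n) + \<i> * of_real s) - F (of_real (- real n) + \<i> * of_real s)"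
      unfolding J_def
    proof (rule integral_FTC_atLeastAtMost)
      fix t :: real
      have t: "of_real t + \<i> * of_real s \<in> S" using S(3) s by (auto simp: subset_iff)
      have "((\<lambda>t. complex_of_real t + \<i> * of_real s) has_vector_derivative 1) (at t within {- real n..real n})"
        by (auto intro!: derivative_eq_intros)
      from field_vector_diff_chain_within[OF this has_field_derivative_at_within[OF F'[OF t]]]
      show "((\<lambda>t. F (of_real t + \<i> * of_real s)) has_vector_derivative f (of_real t + \<i> * of_real s)) (at t within {- real n..real n})"
        by (simp add: o_def)
    next
      show "continuous_on {- real n..real n} (\<lambda>t. f (of_real t + \<i> * of_real s))"
        by (rule continuous_on_compose2[OF cS]) (use s in \<open>auto intro!: continuous_intros\<close>)
    qed simp
    then show ?thesis by simp
  qed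
  have side: "norm (F (of_real a + \<i> * of_real h) - F (of_real a)) \<le> C * exp (k * \<bar>a\<bar>) * h" for a :: real
  proof -
    define T where "T = {z. Re z = a \<and> 0 \<le> Im z \<and> Im z \<le> h}"
    have "convex T"
    proof -
      have T: "T = ({z. Re z \<le> a} \<inter> {z. Re z \<ge> a}) \<inter> ({z. Im z \<ge> 0} \<inter> {z. Im z \<le> h})" by (auto simp: T_def)
      show ?thesis unfolding T
        by (intro convex_Int convex_halfspace_Im_ge convex_halfspace_Im_le convex_halfspace_Re_ge convex_halfspace_Re_le)
    qed
    then have "norm (F (of_real a + \<i> * of_real h) - F (of_real a)) \<le> C * exp (k * \<bar>a\<bar>) * norm (of_real a + \<i> * of_real h - complex_of_real a)"
    proof (rule field_differentiable_bound)
      fix z assume z: "z \<in> T"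
      then have "z \<in> S" using S(3) by (auto simp: T_def)
      then show "(F has_field_derivative f z) (at z within T)" by (rule has_field_derivative_at_within[OF F'])
      show "norm (f z) \<le> C * exp (k * \<bar>a\<bar>)" using C(2)[of z] z by (simp add: T_def)
    qed (use f in \<open>auto simp: T_def\<close>)
    then show ?thesis using f(3) by (simp add: norm_mult)
  qed
  have "(\<lambda>n. J h n - J 0 n) \<longlonglongrightarrow> 0"
  proof (rule Lim_null_comparison[OF always_eventually], rule allI)
    fix n
    have "J h n - J 0 n = (F (of_real (real n) + \<i> * of_real h) - F (of_real (real n))) - (F (of_real (- real n) + \<i> * of_real h) - F (of_real (- real n)))"
      using J[of h n] J[of 0 n] f(3) by simp
    also have "norm \<dots> \<le> C * exp (k * \<bar>real n\<bar>) * h + C * exp (k * \<bar>- real n\<bar>) * h"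
      by (intro order_trans[OF norm_triangle_ineq4] add_mono side)
    also have "\<dots> = 2 * C * h * exp k ^ n" by (simp add: exp_of_nat_mult[symmetric] mult.commute)
    finally show "norm (J h n - J 0 n) \<le> 2 * C * h * exp k ^ n" .
    have "(\<lambda>n. exp k ^ n) \<longlonglongrightarrow> 0" using f(2) by (intro LIMSEQ_realpow_zero) auto
    then show "(\<lambda>n. 2 * C * h * exp k ^ n) \<longlonglongrightarrow> 0" by (rule tendsto_mult_right_zero)
  qed
  moreover have "(\<lambda>n. J h n - J 0 n) \<longlonglongrightarrow> (\<integral>t. f (of_real t + \<i> * of_real h) \<partial>lborel) - (\<integral>t. f (of_real t + \<i> * of_real 0) \<partial>lborel)"
    using f(3) by (intro tendsto_diff lim) auto
  ultimately show ?thesis using LIMSEQ_unique by fastforce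
qed

section \<open>Boundedness and decay of \<open>hyp_gamma\<close> for real periods\<close>

lemma norm_cosh_ge: "cosh (Re u) * cos (Im u) \<le> norm (cosh u)" for u :: complex
proof -
  have "Re (cosh u) = cosh (Re u) * cos (Im u)"
    by (simp add: cosh_def Re_exp scaleR_conv_of_real field_simps)
  then show ?thesis using complex_Re_le_cmod[of "cosh u"] by simp
qed

context
  fixes w1 w2 :: real
  assumes w: "0 < w1" "0 < w2"
begin

abbreviation (input) "G \<equiv> hyp_gamma (of_real w1) (of_real w2)"
abbreviation (input) "Gpm \<equiv> hyp_gamma_pm (of_real w1) (of_real w2)"

lemma hyp_gamma_real_strip: "2 * \<bar>Im z\<bar> < w1 + w2 \<Longrightarrow> G z = hyp_gamma_strip (of_real w1) (of_real w2) z"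
  using w by (intro hyp_gamma_eq_strip) auto

lemma hyp_gamma_nonzero: "2 * \<bar>Im z\<bar> < w1 + w2 \<Longrightarrow> G z \<noteq> 0"
  by (simp add: hyp_gamma_real_strip)

lemma hyp_gamma_uminus: "2 * \<bar>Im z\<bar> < w1 + w2 \<Longrightarrow> G (- z) = inverse (G z)"
  by (simp add: hyp_gamma_real_strip hyp_gamma_strip_uminus)

text \<open>The hypothesis says that the midpoint of \<open>u\<close> and u + \<i> w1 has imaginary
  part of modulus less than w2 / 2.\<close>

lemma hyp_gamma_step:
  assumes "\<bar>2 * Im u + w1\<bar> < w2"
  shows "G (u + \<i> * of_real w1) = gamma_factor (of_real w1) (of_real w2) (u + \<i> * of_real w1 / 2) * G u"
proof -
  define z where "z = u + \<i> * of_real w1 / 2"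
  have z: "2 * \<bar>Im z\<bar> < w2" using assms by (simp add: z_def abs_if split: if_splits)
  have e: "u + \<i> * of_real w1 = z + \<i> * of_real w1 / 2" "u = z - \<i> * of_real w1 / 2" by (simp_all add: z_def)
  have "2 * \<bar>Im (u + \<i> * of_real w1)\<bar> < w1 + w2" "2 * \<bar>Im u\<bar> < w1 + w2"
    using assms w by (auto simp: abs_if split: if_splits)
  then show ?thesis
    using hyp_gamma_strip_shift[of "of_real w1" z "of_real w2"] z w
    unfolding z_def[symmetric] e(1) by (simp add: hyp_gamma_real_strip e(2) gamma_factor_def)
qed

lemma hyp_gamma_holomorphic: "G holomorphic_on {z. 2 * \<bar>Im z\<bar> < w1 + w2}"
  by (rule holomorphic_transform[OF holomorphic_hyp_gamma_strip[of "of_real w1" "of_real w2", simplified, OF w]])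
     (simp add: hyp_gamma_real_strip)

text \<open>By \<open>norm_hyp_gamma_strip_le\<close> the maximum on each horizontal line is
  attained on the imaginary axis, where only a compact segment matters.\<close>

lemma hyp_gamma_bounded:
  assumes "2 * \<beta> < w1 + w2"
  obtains C where "C \<ge> 0" "\<And>z. 0 \<le> - Im z \<Longrightarrow> - Im z \<le> \<beta> \<Longrightarrow> norm (G z) \<le> C"
proof -
  have "continuous_on {0..\<beta>} (\<lambda>b. norm (G (- \<i> * of_real b)))"
    by (intro continuous_on_norm continuous_on_compose2[OF holomorphic_on_imp_continuous_on[OF hyp_gamma_holomorphic]])
       (use assms w in \<open>auto intro!: continuous_intros\<close>)
  then have "bounded ((\<lambda>b. norm (G (- \<i> * of_real b))) ` {0..\<beta>})"
    by (intro compact_imp_bounded compact_continuous_image) auto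
  then have "\<exists>C. \<forall>b\<in>{0..\<beta>}. norm (G (- \<i> * of_real b)) \<le> C"
    unfolding bounded_iff by auto
  then obtain C where C: "\<forall>b\<in>{0..\<beta>}. norm (G (- \<i> * of_real b)) \<le> C" ..
  show ?thesis
  proof (rule that[of "max C 0"])
    fix z assume z: "0 \<le> - Im z" "- Im z \<le> \<beta>"
    define b where "b = - Im z"
    have zb: "z = of_real (Re z) - \<i> * of_real b" by (simp add: b_def complex_eq_iff)
    have "norm (G z) \<le> norm (G (- \<i> * of_real b))"
      using norm_hyp_gamma_strip_le[OF w, of b "Re z"] z assms zb
      by (simp add: hyp_gamma_real_strip b_def)
    also have "\<dots> \<le> max C 0" using bspec[OF C, of b] z by (intro max.coboundedI1) (simp add: b_def)
    finally show "norm (G z) \<le> max C 0" .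
  qed simp
qed

text \<open>One application of the difference equation to the bounded function gains a factor
  \<open>1 / cosh\<close>; this crude decay suffices throughout.\<close>

lemma hyp_gamma_decay:
  assumes "2 * \<beta> < w1 + w2"
  obtains C where "C \<ge> 0" "\<And>z. w1 \<le> - Im z \<Longrightarrow> - Im z \<le> \<beta> \<Longrightarrow> norm (G z) \<le> C * exp (- (pi / w2) * \<bar>Re z\<bar>)"
proof -
  obtain C where C: "C \<ge> 0" "\<And>z. 0 \<le> - Im z \<Longrightarrow> - Im z \<le> \<beta> - w1 \<Longrightarrow> norm (G z) \<le> C"
    using hyp_gamma_bounded[of "\<beta> - w1"] assms w by auto
  \<comment> \<open>The smallest value of cos (Im U) over the admissible z; it is positive because
    \<open>\<beta>\<close> - w1 / 2 < w2 / 2.\<close>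
  define c where "c = cos (pi * (\<beta> - w1 / 2) / w2)"
  show ?thesis
  proof (cases "w1 \<le> \<beta>")
    case False
    show ?thesis by (rule that[of 0]) (use False in auto)
  next
    case True
    have c: "c > 0" unfolding c_def
    proof (rule cos_gt_zero_pi)
      have "(\<beta> - w1 / 2) / w2 < 1 / 2" using assms w by (simp add: field_simps)
      then have "pi * ((\<beta> - w1 / 2) / w2) < pi * (1 / 2)" by (intro mult_strict_left_mono) auto
      then show "pi * (\<beta> - w1 / 2) / w2 < pi / 2" by simp
      have "0 \<le> pi * (\<beta> - w1 / 2) / w2" using True w by (intro divide_nonneg_pos mult_nonneg_nonneg) auto
      then show "- (pi / 2) < pi * (\<beta> - w1 / 2) / w2" using pi_gt_zero by linarith
    qed
    show ?thesis
    proof (rule that[of "C / c"])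
      show "C / c \<ge> 0" using C c by simp
      fix z assume z: "w1 \<le> - Im z" "- Im z \<le> \<beta>"
      define u where "u = z + \<i> * of_real w1 / 2"
      define U where "U = of_real pi * u / of_real w2"
      have U: "Re U = pi / w2 * Re z" "Im U = pi * (Im z + w1 / 2) / w2"
        by (simp_all add: U_def u_def Re_divide_of_real Im_divide_of_real)
      have step: "G (z + \<i> * of_real w1) = 2 * cosh U * G z"
        using hyp_gamma_step[of z] z assms w by (simp add: gamma_factor_def U_def u_def abs_if)
      have "c \<le> cos (Im U)"
      proof -
        have "\<bar>Im U\<bar> = pi * \<bar>Im z + w1 / 2\<bar> / w2" using w by (simp add: U abs_mult)
        also have "\<dots> \<le> pi * (\<beta> - w1 / 2) / w2" using z w by (intro divide_right_mono mult_left_mono) auto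
        finally have "\<bar>Im U\<bar> \<le> pi * (\<beta> - w1 / 2) / w2" .
        moreover have "pi * (\<beta> - w1 / 2) / w2 \<le> pi"
        proof -
          have "(\<beta> - w1 / 2) / w2 \<le> 1" using assms w by (simp add: field_simps)
          then have "pi * ((\<beta> - w1 / 2) / w2) \<le> pi * 1" by (intro mult_left_mono) auto
          then show ?thesis by simp
        qed
        ultimately have "cos (pi * (\<beta> - w1 / 2) / w2) \<le> cos \<bar>Im U\<bar>" by (intro cos_monotone_0_pi_le) auto
        then show ?thesis by (simp add: c_def)
      qed
      then have "cosh (Re U) * c \<le> cosh (Re U) * cos (Im U)" by (intro mult_left_mono) auto
      then have lo: "cosh (Re U) * c \<le> norm (cosh U)" using norm_cosh_ge[of U] by linarith
      have "exp \<bar>Re U\<bar> \<le> 2 * cosh (Re U)" by (simp add: cosh_def abs_if)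
      then have "exp \<bar>Re U\<bar> * c \<le> 2 * cosh (Re U) * c" using c by (intro mult_right_mono) auto
      with lo have "exp \<bar>Re U\<bar> * c \<le> norm (2 * cosh U)" by (simp add: norm_mult)
      then have "exp \<bar>Re U\<bar> * c * norm (G z) \<le> norm (2 * cosh U) * norm (G z)" by (intro mult_right_mono) auto
      also have "\<dots> = norm (G (z + \<i> * of_real w1))" by (simp add: step norm_mult)
      also have "\<dots> \<le> C" using z by (intro C) auto
      finally have "norm (G z) \<le> C / c * exp (- \<bar>Re U\<bar>)" using c by (simp add: exp_minus field_simps)
      also have "\<bar>Re U\<bar> = (pi / w2) * \<bar>Re z\<bar>" using w by (simp add: U abs_mult)
      finally show "norm (G z) \<le> C / c * exp (- (pi / w2) * \<bar>Re z\<bar>)" by simp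
    qed
  qed
qed

text \<open>The conditions on Im a keep the whole strip inside the region of
  \<open>hyp_gamma_decay\<close>; Re a only changes the constant.\<close>

lemma exp_bounded_hyp_gamma:
  assumes "2 * \<beta> < w1 + w2" "w1 \<le> - Im a - h" "- Im a \<le> \<beta>"
  shows "exp_bounded h (- (pi / w2)) (\<lambda>z. G (z + a))"
proof -
  obtain C where C: "C \<ge> 0" "\<And>z. w1 \<le> - Im z \<Longrightarrow> - Im z \<le> \<beta> \<Longrightarrow> norm (G z) \<le> C * exp (- (pi / w2) * \<bar>Re z\<bar>)"
    using hyp_gamma_decay[OF assms(1)] by metis
  show ?thesis unfolding exp_bounded_def
  proof (intro exI[of _ "C * exp (pi / w2 * \<bar>Re a\<bar>)"] conjI allI impI)
    fix z assume z: "0 \<le> Im z \<and> Im z \<le> h"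
    have "norm (G (z + a)) \<le> C * exp (- (pi / w2) * \<bar>Re (z + a)\<bar>)" using z assms by (intro C) auto
    also have "\<dots> \<le> C * exp (pi / w2 * \<bar>Re a\<bar> + - (pi / w2) * \<bar>Re z\<bar>)"
    proof -
      have "pi / w2 * \<bar>Re z\<bar> \<le> pi / w2 * (\<bar>Re a\<bar> + \<bar>Re (z + a)\<bar>)" using w by (intro mult_left_mono) auto
      then show ?thesis using C(1) by (intro mult_left_mono) (auto simp: algebra_simps)
    qed
    finally show "norm (G (z + a)) \<le> C * exp (pi / w2 * \<bar>Re a\<bar>) * exp (- (pi / w2) * \<bar>Re z\<bar>)"
      by (simp only: exp_add mult.assoc)
  qed (use C in simp)
qed

text \<open>By reflection the reciprocal is the value at the opposite argument, to which the decay
  estimate applies.\<close>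

lemma exp_bounded_inverse_hyp_gamma:
  assumes "2 * \<beta> < w1 + w2" "w1 \<le> Im a" "Im a + h \<le> \<beta>"
  shows "exp_bounded h (- (pi / w2)) (\<lambda>z. inverse (G (z + a)))"
proof -
  obtain C where C: "C \<ge> 0" "\<And>z. w1 \<le> - Im z \<Longrightarrow> - Im z \<le> \<beta> \<Longrightarrow> norm (G z) \<le> C * exp (- (pi / w2) * \<bar>Re z\<bar>)"
    using hyp_gamma_decay[OF assms(1)] by metis
  show ?thesis unfolding exp_bounded_def
  proof (intro exI[of _ "C * exp (pi / w2 * \<bar>Re a\<bar>)"] conjI allI impI)
    fix z assume z: "0 \<le> Im z \<and> Im z \<le> h"
    have "inverse (G (z + a)) = G (- (z + a))" using z assms w by (intro hyp_gamma_uminus[symmetric]) auto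
    also have "norm \<dots> \<le> C * exp (- (pi / w2) * \<bar>Re (- (z + a))\<bar>)" using z assms by (intro C) auto
    also have "\<dots> \<le> C * exp (pi / w2 * \<bar>Re a\<bar> + - (pi / w2) * \<bar>Re z\<bar>)"
    proof -
      have "pi / w2 * \<bar>Re z\<bar> \<le> pi / w2 * (\<bar>Re a\<bar> + \<bar>Re (- (z + a))\<bar>)" using w by (intro mult_left_mono) auto
      then show ?thesis using C(1) by (intro mult_left_mono) (auto simp: algebra_simps)
    qed
    finally show "norm (inverse (G (z + a))) \<le> C * exp (pi / w2 * \<bar>Re a\<bar>) * exp (- (pi / w2) * \<bar>Re z\<bar>)"
      by (simp only: exp_add mult.assoc)
  qed (use C in simp)
qed

text \<open>The integrand of \<open>psi_integral\<close> with its four offsets left free, so that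
  the shifts in x and the antidifference are covered by one set of estimates.\<close>

definition gamma_quad :: "complex \<Rightarrow> complex \<Rightarrow> complex \<Rightarrow> complex \<Rightarrow> complex \<Rightarrow> complex \<Rightarrow> complex \<Rightarrow> complex \<Rightarrow> complex \<Rightarrow> complex" where
  "gamma_quad A \<tau> B \<sigma> C \<rho> D \<upsilon> z = Gpm (z + A) (\<i> * \<tau>) * Gpm (z + B) (\<i> * \<sigma>) / (Gpm (z + C) (\<i> * \<rho>) * Gpm (z + D) (\<i> * \<upsilon>))"

lemma gamma_quad_alt: "gamma_quad A \<tau> B \<sigma> C \<rho> D \<upsilon> = (\<lambda>z. 
    ((G (z + (A + \<i> * \<tau>)) * G (z + (A - \<i> * \<tau>))) * (G (z + (B + \<i> * \<sigma>)) * G (z + (B - \<i> * \<sigma>)))) *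
    ((inverse (G (z + (C + \<i> * \<rho>))) * inverse (G (z + (C - \<i> * \<rho>)))) * (inverse (G (z + (D + \<i> * \<upsilon>))) * inverse (G (z + (D - \<i> * \<upsilon>))))))"
  by (simp add: fun_eq_iff gamma_quad_def hyp_gamma_pm_def field_simps add.assoc add_diff_eq)

text \<open>For 0 \<le> Im z \<le> w1 the offsets, parameters and the variable move the imaginary
  parts of the arguments by at most 6 w1 from - W in the numerator and from W in the denominator,
  where W = (w1 + w2) / 4. As 40 w1 \<le> w2 gives W > 10 w1, all eight gamma factors are in their
  region of decay.\<close>

lemma gamma_quad_bounded:
  assumes w2: "40 * w1 \<le> w2" 
    and A: "norm (A + \<i> * of_real ((w1 + w2) / 4)) \<le> 4 * w1" "norm (B + \<i> * of_real ((w1 + w2) / 4)) \<le> 4 * w1"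
      "norm (C - \<i> * of_real ((w1 + w2) / 4)) \<le> 4 * w1" "norm (D - \<i> * of_real ((w1 + w2) / 4)) \<le> 4 * w1"
    and p: "norm \<rho> \<le> w1" "norm \<sigma> \<le> w1" "norm \<tau> \<le> w1" "norm \<upsilon> \<le> w1"
  shows "exp_bounded w1 (- (8 * pi / w2)) (gamma_quad A \<tau> B \<sigma> C \<rho> D \<upsilon>)" 
    and "gamma_quad A \<tau> B \<sigma> C \<rho> D \<upsilon> holomorphic_on {z. - w1 < Im z \<and> Im z < 2 * w1}"
proof -
  define W where "W = (w1 + w2) / 4"
  have W4: "4 * W = w1 + w2" by (simp add: W_def)
  have R: "\<bar>Re \<rho>\<bar> \<le> w1" "\<bar>Re \<sigma>\<bar> \<le> w1" "\<bar>Re \<tau>\<bar> \<le> w1" "\<bar>Re \<upsilon>\<bar> \<le> w1" 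
    using p abs_Re_le_cmod order_trans by blast+
  have "\<bar>Im (A + \<i> * of_real W)\<bar> \<le> 4 * w1" "\<bar>Im (B + \<i> * of_real W)\<bar> \<le> 4 * w1" 
     "\<bar>Im (C - \<i> * of_real W)\<bar> \<le> 4 * w1" "\<bar>Im (D - \<i> * of_real W)\<bar> \<le> 4 * w1"
    using A abs_Im_le_cmod order_trans unfolding W_def by blast+
  then have I: "\<bar>Im A + W\<bar> \<le> 4 * w1" "\<bar>Im B + W\<bar> \<le> 4 * w1" "\<bar>Im C - W\<bar> \<le> 4 * w1" "\<bar>Im D - W\<bar> \<le> 4 * w1" by simp_all
  define \<beta> where "\<beta> = W + 6 * w1"
  have "2 * W + 12 * w1 < w1 + w2" using w w2 W4 by linarith
  then have \<beta>: "2 * \<beta> < w1 + w2" by (simp add: \<beta>_def)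
  have W: "7 * w1 \<le> W" "2 * W + 14 * w1 < w1 + w2" using w w2 W4 by linarith+
  have num: "w1 \<le> - Im (a + \<i> * \<alpha>) - w1 \<and> - Im (a + \<i> * \<alpha>) \<le> \<beta> \<and> w1 \<le> - Im (a - \<i> * \<alpha>) - w1 \<and> - Im (a - \<i> * \<alpha>) \<le> \<beta>" 
    if "\<bar>Im a + W\<bar> \<le> 4 * w1" "\<bar>Re \<alpha>\<bar> \<le> w1" for a \<alpha>
    using that W unfolding \<beta>_def by (simp add: abs_le_iff)
  have den: "w1 \<le> Im (a + \<i> * \<alpha>) \<and> Im (a + \<i> * \<alpha>) + w1 \<le> \<beta> \<and> w1 \<le> Im (a - \<i> * \<alpha>) \<and> Im (a - \<i> * \<alpha>) + w1 \<le> \<beta>" 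
    if "\<bar>Im a - W\<bar> \<le> 4 * w1" "\<bar>Re \<alpha>\<bar> \<le> w1" for a \<alpha>
    using that W w unfolding \<beta>_def by (simp add: abs_le_iff)
  have "exp_bounded w1 (((- (pi / w2) + - (pi / w2)) + (- (pi / w2) + - (pi / w2))) + ((- (pi / w2) + - (pi / w2)) + (- (pi / w2) + - (pi / w2)))) (gamma_quad A \<tau> B \<sigma> C \<rho> D \<upsilon>)"
    unfolding gamma_quad_alt
    by (intro exp_bounded_mult exp_bounded_hyp_gamma[OF \<beta>] exp_bounded_inverse_hyp_gamma[OF \<beta>])
       (use num[OF I(1) R(3)] num[OF I(2) R(2)] den[OF I(3) R(1)] den[OF I(4) R(4)] in auto)
  then show "exp_bounded w1 (- (8 * pi / w2)) (gamma_quad A \<tau> B \<sigma> C \<rho> D \<upsilon>)" by simp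
  have hol: "(\<lambda>z. G (z + a)) holomorphic_on {z. - w1 < Im z \<and> Im z < 2 * w1}" 
    if "\<bar>Im a + W\<bar> \<le> 5 * w1 \<or> \<bar>Im a - W\<bar> \<le> 5 * w1" for a
    by (rule holomorphic_on_compose_gen[of "\<lambda>z. z + a", OF _ hyp_gamma_holomorphic, unfolded o_def])
       (use that W w in \<open>auto intro!: holomorphic_intros simp: abs_if split: if_splits\<close>)
  have nz: "G (z + a) \<noteq> 0" if "\<bar>Im a - W\<bar> \<le> 5 * w1" "- w1 < Im z" "Im z < 2 * w1" for a z
    by (rule hyp_gamma_nonzero) (use that W w in \<open>auto simp: abs_if split: if_splits\<close>)
  have b: "\<bar>Im (a + \<i> * \<alpha>) + W\<bar> \<le> 5 * w1 \<and> \<bar>Im (a - \<i> * \<alpha>) + W\<bar> \<le> 5 * w1" if "\<bar>Im a + W\<bar> \<le> 4 * w1" "\<bar>Re \<alpha>\<bar> \<le> w1" for a \<alpha>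
    using that by (auto simp: abs_if split: if_splits)
  have b': "\<bar>Im (a + \<i> * \<alpha>) - W\<bar> \<le> 5 * w1 \<and> \<bar>Im (a - \<i> * \<alpha>) - W\<bar> \<le> 5 * w1" if "\<bar>Im a - W\<bar> \<le> 4 * w1" "\<bar>Re \<alpha>\<bar> \<le> w1" for a \<alpha>
    using that by (auto simp: abs_if split: if_splits)
  show "gamma_quad A \<tau> B \<sigma> C \<rho> D \<upsilon> holomorphic_on {z. - w1 < Im z \<and> Im z < 2 * w1}"
    unfolding gamma_quad_alt
    by (intro holomorphic_on_mult holomorphic_on_inverse hol nz)
       (use b[OF I(1) R(3)] b[OF I(2) R(2)] b'[OF I(3) R(1)] b'[OF I(4) R(4)] in auto)
qed

lemma gamma_quad_integrable:
  assumes "40 * w1 \<le> w2" 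
    "norm (A + \<i> * of_real ((w1 + w2) / 4)) \<le> 4 * w1" "norm (B + \<i> * of_real ((w1 + w2) / 4)) \<le> 4 * w1"
    "norm (C - \<i> * of_real ((w1 + w2) / 4)) \<le> 4 * w1" "norm (D - \<i> * of_real ((w1 + w2) / 4)) \<le> 4 * w1"
    "norm \<rho> \<le> w1" "norm \<sigma> \<le> w1" "norm \<tau> \<le> w1" "norm \<upsilon> \<le> w1"
  shows "integrable lborel (\<lambda>t::real. gamma_quad A \<tau> B \<sigma> C \<rho> D \<upsilon> (of_real t))"
proof -
  note b = gamma_quad_bounded[OF assms]
  have "{z. 0 \<le> Im z \<and> Im z \<le> w1} \<subseteq> {z. - w1 < Im z \<and> Im z < 2 * w1}" using w by auto
  then have "continuous_on {z. 0 \<le> Im z \<and> Im z \<le> w1} (gamma_quad A \<tau> B \<sigma> C \<rho> D \<upsilon>)"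
    by (rule continuous_on_subset[OF holomorphic_on_imp_continuous_on[OF b(2)]])
  from exp_bounded_integrable[OF b(1) _ _ _ this, of 0] show ?thesis using w by simp
qed

end

section \<open>The difference equation for \<open>\<psi>\<close>\<close>

text \<open>A shift of the argument by \<i> w1 multiplies this exponential by a constant, called q^2
  below, and \<i> w2 is a period; in these terms the difference equations become identities of
  rational functions.\<close>

definition e2 :: "real \<Rightarrow> complex \<Rightarrow> complex" where
  "e2 w2 u = exp (2 * of_real pi * u / of_real w2)"

lemma e2_add: "e2 w2 (u + v) = e2 w2 u * e2 w2 v"
  by (simp add: e2_def exp_add[symmetric] add_divide_distrib distrib_left)

lemma e2_diff: "e2 w2 (u - v) = e2 w2 u / e2 w2 v"
  by (simp add: e2_def exp_diff[symmetric] diff_divide_distrib right_diff_distrib)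

lemma e2_uminus: "e2 w2 (- u) = 1 / e2 w2 u"
  using e2_diff[of w2 0 u] by (simp add: e2_def)

lemma e2_nonzero [simp]: "e2 w2 u \<noteq> 0"
  by (simp add: e2_def)

lemma e2_double: "e2 w2 (2 * u) = (e2 w2 u)\<^sup>2"
  using e2_add[of w2 u u] by (simp add: power2_eq_square)

text \<open>The origin of all sign changes below: \<i> w equals \<i> w1 / 2 plus this half
  period.\<close>

lemma e2_half_period: "w2 \<noteq> 0 \<Longrightarrow> e2 w2 (\<i> * of_real w2 / 2) = - 1"
  by (simp add: e2_def exp_pi_i' mult.commute)

text \<open>The product-to-sum formula for cosh. A pair of gamma factors with opposite parameters
  thus depends on the parameter only through r + 1 / r, which explains the variables
  \<open>R\<close>, \<open>S\<close>, \<open>T\<close>, \<open>U\<close>.\<close>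

lemma gamma_factor_pm:
  "gamma_factor w1 (of_real w2) (p + q) * gamma_factor w1 (of_real w2) (p - q) = e2 w2 p + 1 / e2 w2 p + (e2 w2 q + 1 / e2 w2 q)"
proof -
  define P where "P = exp (of_real pi * p / of_real w2)"
  define Q where "Q = exp (of_real pi * q / of_real w2)"
  have nz: "P \<noteq> 0" "Q \<noteq> 0" by (simp_all add: P_def Q_def)
  have "e2 w2 p = P\<^sup>2" "e2 w2 q = Q\<^sup>2" 
    by (simp_all add: e2_def P_def Q_def exp_double[symmetric] mult.assoc)
  moreover have "gamma_factor w1 (of_real w2) (p + q) = P * Q + 1 / (P * Q)"
  proof -
    have "P * Q = exp (of_real pi * (p + q) / of_real w2)"
      by (simp add: P_def Q_def exp_add[symmetric] distrib_left add_divide_distrib)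
    then show ?thesis by (simp add: gamma_factor_def cosh_def scaleR_conv_of_real exp_minus inverse_eq_divide)
  qed
  moreover have "gamma_factor w1 (of_real w2) (p - q) = P / Q + Q / P"
  proof -
    have "P / Q = exp (of_real pi * (p - q) / of_real w2)" "Q / P = exp (- (of_real pi * (p - q) / of_real w2))"
      by (simp_all add: P_def Q_def exp_diff[symmetric] right_diff_distrib diff_divide_distrib)
    then show ?thesis by (simp add: gamma_factor_def cosh_def scaleR_conv_of_real)
  qed
  moreover have "(P * Q + 1 / (P * Q)) * (P / Q + Q / P) = P\<^sup>2 + 1 / P\<^sup>2 + (Q\<^sup>2 + 1 / Q\<^sup>2)"
    using nz by (simp add: field_simps power2_eq_square)
  ultimately show ?thesis by (simp only:)
qed

text \<open>In \<open>telescoping_identity\<close> the integrand of the difference equation and the difference of its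
  antidifference appear divided by their common gamma factors. There \<open>V\<close> carries the integration
  variable, \<open>x\<close> and \<open>L\<close> are the exponentials of the two variables, \<open>q\<^sup>2\<close> is the multiplier of the
  shift and \<open>R\<close>, \<open>S\<close>, \<open>T\<close>, \<open>U\<close> are the parameters. The factor \<open>antidiff_factor\<close> is the Laurent
  polynomial in \<open>V\<close> found by comparing both sides at the zeros of the last two factors.\<close>

definition antidiff_factor :: "complex \<Rightarrow> complex \<Rightarrow> complex \<Rightarrow> complex \<Rightarrow> complex \<Rightarrow> complex \<Rightarrow> complex \<Rightarrow> complex \<Rightarrow> complex" where
  "antidiff_factor x L q R S T U V = (q\<^sup>2 - x\<^sup>2) * (x\<^sup>2 * S * V + q * x^3 * R * V + q^4 * x\<^sup>2 * S / V + q^3 * x * R / V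
      + q\<^sup>2 * x\<^sup>2 * S * T + x * L + q^4 * x^3 / L - q\<^sup>2 * x^3 * L - q\<^sup>2 * x / L)
    + (1 - q\<^sup>2 * x\<^sup>2) * (q * x\<^sup>2 * U * V / L + x^3 * T * V / L + q^3 * x\<^sup>2 * U * L / V + q^4 * x * T * L / V - R * U * q\<^sup>2 * x\<^sup>2)
    + R * T * q * x^3 * (q^4 - 1)"

text \<open>The product in \<open>coeff_plus_factor\<close>, expanded in R = r + 1 / r and S = s + 1
  / s; \<open>coeff_minus\<close> is its analogue for \<open>T\<close> and \<open>U\<close> with the
  powers of x cleared.\<close>

definition coeff_plus :: "complex \<Rightarrow> complex \<Rightarrow> complex \<Rightarrow> complex \<Rightarrow> complex" where
  "coeff_plus x q R S = (1 + (q*x)\<^sup>2)\<^sup>2 + q * x * (1 + (q*x)\<^sup>2) * R * S + (q*x)\<^sup>2 * (R\<^sup>2 + S\<^sup>2 - 4)"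

definition coeff_minus :: "complex \<Rightarrow> complex \<Rightarrow> complex \<Rightarrow> complex \<Rightarrow> complex" where
  "coeff_minus x q T U = (x\<^sup>2 + q\<^sup>2)\<^sup>2 + q * x * (x\<^sup>2 + q\<^sup>2) * T * U + (q*x)\<^sup>2 * (T\<^sup>2 + U\<^sup>2 - 4)"

text \<open>Up to a factor, the sum of both Askey-Wilson coefficients and the eigenvalue after
  clearing denominators, see \<open>coeff_zero_eq\<close>.\<close>

definition coeff_zero :: "complex \<Rightarrow> complex \<Rightarrow> complex \<Rightarrow> complex \<Rightarrow> complex \<Rightarrow> complex \<Rightarrow> complex \<Rightarrow> complex" where
  "coeff_zero x L q R S T U = (1 - x\<^sup>2) * (q^3 * x * (1 + x\<^sup>2) * (U * R + S * T) + q\<^sup>2 * (1 + q\<^sup>2) * x\<^sup>2 * (S * U + R * T)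
     - q * (L + 1 / L) * (1 - q\<^sup>2 * x\<^sup>2) * (q\<^sup>2 - x\<^sup>2))"

lemma telescoping_identity:
  fixes V x L q R S T U :: complex
  assumes "V \<noteq> 0" "x \<noteq> 0" "L \<noteq> 0" "q \<noteq> 0"
  shows "coeff_plus x q R S * (q\<^sup>2 - x\<^sup>2) * ((V + 1 / V + T) * (V / q\<^sup>2 + q\<^sup>2 / V + T))
    + coeff_minus x q T U * (1 - q\<^sup>2 * x\<^sup>2) * ((R - V * q / L - L / (V * q)) * (R - V / (q * L) - q * L / V))
    - coeff_zero x L q R S T U * ((R - V * q / L - L / (V * q)) * (V / q\<^sup>2 + q\<^sup>2 / V + T))
    = antidiff_factor x L q R S T U (q\<^sup>2 * V) * ((V / (x * L) + x * L / V + S) * (V / q\<^sup>2 + q\<^sup>2 / V + T)) 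
      - antidiff_factor x L q R S T U V * ((U - V / (q * x) - q * x / V) * (R - V * q / L - L / (V * q)))"
proof -
  \<comment> \<open>Reciprocals become independent variables subject to V v = 1 and the like, which
    turns the claim into a polynomial ideal membership for \<open>algebra\<close>.\<close>
  define v where "v = 1 / V"
  define m where "m = 1 / L"
  define p where "p = 1 / q"
  define y where "y = 1 / x"
  have e: "V * v = 1" "L * m = 1" "q * p = 1" "x * y = 1" using assms by (auto simp: v_def m_def p_def y_def)
  have r: "A / V = A * v" "A / L = A * m" "A / q = A * p" "A / x = A * y" "A / (V * q) = A * (v * p)" "A / (q * L) = A * (p * m)" "A / (x * L) = A * (y * m)"
    "A / (q * x) = A * (p * y)" "A / q\<^sup>2 = A * p\<^sup>2" "A / (q\<^sup>2 * V) = A * (p\<^sup>2 * v)" for A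
    by (auto simp: v_def m_def p_def y_def power2_eq_square)
  show ?thesis unfolding antidiff_factor_def coeff_plus_def coeff_minus_def coeff_zero_def r using e by algebra
qed

text \<open>In exponentials the left-hand side is A(x) + A(- x) + v, the coefficient of the
  unshifted value when the eigenvalue equation is solved for the shifted ones.\<close>

lemma coeff_zero_eq:
  fixes x L q r s t u :: complex
  assumes nz: "x \<noteq> 0" "L \<noteq> 0" "q \<noteq> 0" "r \<noteq> 0" "s \<noteq> 0" "t \<noteq> 0" "u \<noteq> 0"
    and d: "1 - x\<^sup>2 \<noteq> 0" "1 - q\<^sup>2 * x\<^sup>2 \<noteq> 0" "q\<^sup>2 - x\<^sup>2 \<noteq> 0"
  shows "(1 + q * (s / r) * x) * (1 + q * (r * s) * x) * (1 + q * (1 / (t * u)) * x) * (1 + q * (t / u) * x) / ((1 - x\<^sup>2) * (1 - q\<^sup>2 * x\<^sup>2))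
    + (1 + q * (s / r) / x) * (1 + q * (r * s) / x) * (1 + q * (1 / (t * u)) / x) * (1 + q * (t / u) / x) / ((1 - 1 / x\<^sup>2) * (1 - q\<^sup>2 / x\<^sup>2))
    + (- q * (s / u) * (L + 1 / L) - (q * (s / u))\<^sup>2 - 1)
    = s / u * coeff_zero x L q (r + 1 / r) (s + 1 / s) (t + 1 / t) (u + 1 / u) / ((1 - x\<^sup>2) * (1 - q\<^sup>2 * x\<^sup>2) * (q\<^sup>2 - x\<^sup>2))"
proof -
  define M where "M = (1 - x\<^sup>2) * (1 - q\<^sup>2 * x\<^sup>2) * (q\<^sup>2 - x\<^sup>2)"
  have M: "M \<noteq> 0" using d by (simp add: M_def)
  define y where "y = 1 / x"
  define m where "m = 1 / L"
  define r' where "r' = 1 / r"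
  define s' where "s' = 1 / s"
  define t' where "t' = 1 / t"
  define u' where "u' = 1 / u"
  have e: "x * y = 1" "L * m = 1" "r * r' = 1" "s * s' = 1" "t * t' = 1" "u * u' = 1" 
    using nz by (auto simp: y_def m_def r'_def s'_def t'_def u'_def)
  have div: "A / x = A * y" "A / L = A * m" "A / r = A * r'" "A / s = A * s'" "A / t = A * t'" "A / u = A * u'" "A / (t * u) = A * (t' * u')" for A
    by (auto simp: y_def m_def r'_def s'_def t'_def u'_def)
  define P where "P = (1 + q * (s / r) * x) * (1 + q * (r * s) * x) * (1 + q * (1 / (t * u)) * x) * (1 + q * (t / u) * x)"
  define P' where "P' = (1 + q * (s / r) / x) * (1 + q * (r * s) / x) * (1 + q * (1 / (t * u)) / x) * (1 + q * (t / u) / x)"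
  define v where "v = - q * (s / u) * (L + 1 / L) - (q * (s / u))\<^sup>2 - 1"
  have 1: "P / ((1 - x\<^sup>2) * (1 - q\<^sup>2 * x\<^sup>2)) = P * (q\<^sup>2 - x\<^sup>2) / M"
    using d by (simp add: M_def)
  have 2: "P' / ((1 - 1 / x\<^sup>2) * (1 - q\<^sup>2 / x\<^sup>2)) = P' * x^4 * (1 - q\<^sup>2 * x\<^sup>2) / M"
  proof -
    have "(1 - 1 / x\<^sup>2) * (1 - q\<^sup>2 / x\<^sup>2) = (1 - x\<^sup>2) * (q\<^sup>2 - x\<^sup>2) / x ^ 4"
      using nz by (simp add: field_simps power4_eq_xxxx power2_eq_square)
    then show ?thesis using d nz by (simp add: M_def)
  qed
  have 3: "v = v * M / M" using M by simp
  have "P * (q\<^sup>2 - x\<^sup>2) + P' * x^4 * (1 - q\<^sup>2 * x\<^sup>2) + v * M = s / u * coeff_zero x L q (r + 1 / r) (s + 1 / s) (t + 1 / t) (u + 1 / u)"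
    unfolding P_def P'_def v_def M_def coeff_zero_def div using e by algebra
  then have "P / ((1 - x\<^sup>2) * (1 - q\<^sup>2 * x\<^sup>2)) + P' / ((1 - 1 / x\<^sup>2) * (1 - q\<^sup>2 / x\<^sup>2)) + v
    = s / u * coeff_zero x L q (r + 1 / r) (s + 1 / s) (t + 1 / t) (u + 1 / u) / M"
    by (subst 3, unfold 1 2) (simp only: add_divide_distrib[symmetric])
  then show ?thesis unfolding P_def P'_def v_def M_def .
qed

text \<open>Two of the factors come from the Askey-Wilson coefficient, the other two from a quotient
  of values of \<open>Delta_fun\<close>. Inverting r or s only permutes them, so the product is a
  polynomial in r + 1 / r and s + 1 / s.\<close>

lemma coeff_plus_factor:
  assumes "r \<noteq> 0" "s \<noteq> 0"
  shows "(1 + q * (s / r) * x) * (1 + q * (r * s) * x) * (1 + q * (r / s) * x) * (1 + q * (1 / (r * s)) * x) = coeff_plus x q (r + 1 / r) (s + 1 / s)"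
proof -
  define r' where "r' = 1 / r"
  define s' where "s' = 1 / s"
  have e: "r * r' = 1" "s * s' = 1" using assms by (auto simp: r'_def s'_def)
  have div: "A / r = A * r'" "A / s = A * s'" "A / (r * s) = A * (r' * s')" for A
    by (auto simp: r'_def s'_def)
  show ?thesis unfolding coeff_plus_def div using e by algebra
qed

lemma coeff_minus_factor:
  assumes "t \<noteq> 0" "u \<noteq> 0" "x \<noteq> 0"
  shows "(1 + q * (t * u) / x) * (1 + q * (1 / (t * u)) / x) * (1 + q * (t / u) / x) * (1 + q * (u / t) / x) = coeff_minus x q (t + 1 / t) (u + 1 / u) / x^4"
proof -
  define t' where "t' = 1 / t"
  define u' where "u' = 1 / u"
  define y where "y = 1 / x"
  have e: "t * t' = 1" "u * u' = 1" "x * y = 1" using assms by (auto simp: t'_def u'_def y_def)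
  have div: "A / t = A * t'" "A / u = A * u'" "A / (t * u) = A * (t' * u')" "A / x = A * y" "A / x^4 = A * y^4" for A
    by (auto simp: t'_def u'_def y_def power_divide)
  show ?thesis unfolding coeff_minus_def div using e by algebra
qed

text \<open>These bounds keep every gamma function below inside its strip, where it has no zeros or poles.\<close>

context
  fixes w1 w2 :: real and x l \<rho> \<sigma> \<tau> \<upsilon> :: complex
  assumes w1: "0 < w1" and w2: "40 * w1 \<le> w2"
    and small: "norm x \<le> w1" "norm l \<le> w1" "norm \<rho> \<le> w1" "norm \<sigma> \<le> w1" "norm \<tau> \<le> w1" "norm \<upsilon> \<le> w1"
begin

abbreviation (input) "E \<equiv> e2 w2"
abbreviation (input) "H \<equiv> hyp_gamma_pm (of_real w1) (of_real w2)"
abbreviation (input) "W \<equiv> (w1 + w2) / 4"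

lemma w2_pos: "0 < w2" using w1 w2 by simp

lemma W4: "4 * W = w1 + w2" by simp

lemma Re_small: "\<bar>Re \<rho>\<bar> \<le> w1" "\<bar>Re \<sigma>\<bar> \<le> w1" "\<bar>Re \<tau>\<bar> \<le> w1" "\<bar>Re \<upsilon>\<bar> \<le> w1" 
  using small abs_Re_le_cmod order_trans by blast+

lemma Gpm_step:
  assumes "\<bar>2 * Im u + w1\<bar> + 2 * \<bar>Re \<alpha>\<bar> < w2"
  shows "H (u + \<i> * of_real w1) (\<i> * \<alpha>) = 
    (E (u + \<i> * of_real w1 / 2) + 1 / E (u + \<i> * of_real w1 / 2) + (E (\<i> * \<alpha>) + 1 / E (\<i> * \<alpha>))) * H u (\<i> * \<alpha>)"
proof -
  have "\<bar>2 * Im (u + \<i> * \<alpha>) + w1\<bar> < w2" "\<bar>2 * Im (u - \<i> * \<alpha>) + w1\<bar> < w2"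
    using assms by (auto simp: abs_if split: if_splits)
  from this[THEN hyp_gamma_step[OF w1 w2_pos]]
  have "H (u + \<i> * of_real w1) (\<i> * \<alpha>) = 
     (gamma_factor (of_real w1) (of_real w2) ((u + \<i> * of_real w1 / 2) + \<i> * \<alpha>) * gamma_factor (of_real w1) (of_real w2) ((u + \<i> * of_real w1 / 2) - \<i> * \<alpha>)) * H u (\<i> * \<alpha>)"
    by (simp add: hyp_gamma_pm_def algebra_simps)
  then show ?thesis by (simp only: gamma_factor_pm)
qed

lemma Gpm_nonzero:
  assumes "2 * (\<bar>Im u\<bar> + \<bar>Re \<alpha>\<bar>) < w1 + w2"
  shows "H u (\<i> * \<alpha>) \<noteq> 0"
proof -
  have "2 * \<bar>Im (u + \<i> * \<alpha>)\<bar> < w1 + w2" "2 * \<bar>Im (u - \<i> * \<alpha>)\<bar> < w1 + w2"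
    using assms by (auto simp: abs_if split: if_splits)
  then show ?thesis by (simp add: hyp_gamma_pm_def hyp_gamma_nonzero[OF w1 w2_pos])
qed

text \<open>All arguments that occur have imaginary part close to - W or W, where the step stays
  inside the strip.\<close>

lemma Gpm_step_near:
  assumes "\<bar>Im u + W\<bar> \<le> 6 * w1 \<or> \<bar>Im u - W\<bar> \<le> 6 * w1" "\<bar>Re \<alpha>\<bar> \<le> w1"
  shows "H (u + \<i> * of_real w1) (\<i> * \<alpha>) = 
    (E (u + \<i> * of_real w1 / 2) + 1 / E (u + \<i> * of_real w1 / 2) + (E (\<i> * \<alpha>) + 1 / E (\<i> * \<alpha>))) * H u (\<i> * \<alpha>)"
proof (rule Gpm_step)
  define v where "v = W"
  have "4 * v = w1 + w2" unfolding v_def by (rule W4)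
  then show "\<bar>2 * Im u + w1\<bar> + 2 * \<bar>Re \<alpha>\<bar> < w2" 
    using assms w1 w2 unfolding v_def[symmetric] by (auto simp: abs_if split: if_splits)
qed

lemma Gpm_nonzero_near:
  assumes "\<bar>Im u - W\<bar> \<le> 6 * w1" "\<bar>Re \<alpha>\<bar> \<le> w1"
  shows "H u (\<i> * \<alpha>) \<noteq> 0"
proof (rule Gpm_nonzero)
  define v where "v = W"
  have "4 * v = w1 + w2" unfolding v_def by (rule W4)
  then show "2 * (\<bar>Im u\<bar> + \<bar>Re \<alpha>\<bar>) < w1 + w2" 
    using assms w1 w2 unfolding v_def[symmetric] by (auto simp: abs_if split: if_splits)
qed

abbreviation (input) "A0 \<equiv> x + l / 2 - \<i> * of_real W"
abbreviation (input) "B0 \<equiv> - l / 2 - \<i> * of_real W"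
abbreviation (input) "C0 \<equiv> x - l / 2 + \<i> * of_real W"
abbreviation (input) "D0 \<equiv> l / 2 + \<i> * of_real W"
abbreviation (input) "sh \<equiv> \<i> * of_real w1"
abbreviation (input) "quad A B C D \<equiv> gamma_quad w1 w2 A \<tau> B \<sigma> C \<rho> D \<upsilon>"

lemma Im_small: "\<bar>Im x\<bar> \<le> w1" "\<bar>Im l\<bar> \<le> w1"
  using small abs_Im_le_cmod order_trans by blast+

text \<open>Single steps of the difference equation reduce all integrands, shifted or not, to
  explicit multiples of one function \<open>Q\<close>; what remains is
  \<open>telescoping_identity\<close>.\<close>

lemma integrand_difference:
  fixes t :: real
  defines "X \<equiv> E x" and "L \<equiv> E l" and "q \<equiv> E (sh / 2)" and "R \<equiv> E (\<i> * \<rho>) + 1 / E (\<i> * \<rho>)" and "S \<equiv> E (\<i> * \<sigma>) + 1 / E (\<i> * \<sigma>)"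
    and "T \<equiv> E (\<i> * \<tau>) + 1 / E (\<i> * \<tau>)" and "U \<equiv> E (\<i> * \<upsilon>) + 1 / E (\<i> * \<upsilon>)"
  defines "D \<equiv> (\<lambda>z. antidiff_factor X L q R S T U (E (z + A0 + sh / 2)) * quad (A0 - sh) B0 C0 (D0 - sh) z)"
  shows "coeff_plus X q R S * (q\<^sup>2 - X\<^sup>2) * quad (A0 + sh) B0 (C0 + sh) D0 t
     + coeff_minus X q T U * (1 - q\<^sup>2 * X\<^sup>2) * quad (A0 - sh) B0 (C0 - sh) D0 t
     - coeff_zero X L q R S T U * quad A0 B0 C0 D0 t = D (t + sh) - D t"
proof -
  define z where "z = complex_of_real t"
  define V where "V = E (z + A0 + sh / 2)"
  define th where "th = V + 1 / V + T"
  define tm where "tm = V / q\<^sup>2 + q\<^sup>2 / V + T"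
  define et where "et = R - V * q / L - L / (V * q)"
  define etm where "etm = R - V / (q * L) - q * L / V"
  define th2 where "th2 = V / (X * L) + X * L / V + S"
  define eu where "eu = U - V / (q * X) - q * X / V"
  have nz: "V \<noteq> 0" "X \<noteq> 0" "L \<noteq> 0" "q \<noteq> 0" by (simp_all add: V_def X_def L_def q_def)
  have q2: "E sh = q\<^sup>2" using e2_double[of w2 "sh / 2"] by (simp add: q_def)
  \<comment> \<open>Numerator and denominator offsets differ by 2 \<i> W = \<i> w1 / 2 + \<i> w2 / 2
    up to the variables; the half period yields the minus signs in \<open>et\<close>,
    \<open>etm\<close> and \<open>eu\<close>.\<close>
  have EW: "E (\<i> * of_real (2 * W)) = - q"
  proof -
    have "\<i> * of_real (2 * W) = sh / 2 + \<i> * of_real w2 / 2" by (simp add: field_simps)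
    then show ?thesis using e2_half_period[of w2] w2_pos by (simp only: e2_add q_def) simp
  qed
  have im: "Im z = 0" by (simp add: z_def)
  have V1: "E (z + A0 - sh + sh / 2) = V / q\<^sup>2"
    by (simp only: V_def e2_add e2_diff q2) (simp add: field_simps)
  have V2: "E (z + C0 + sh / 2) = - V * q / L"
  proof -
    have "z + C0 + sh / 2 = (z + A0 + sh / 2) + (\<i> * of_real (2 * W) - l)" by (simp add: field_simps)
    then have "E (z + C0 + sh / 2) = V * (E (\<i> * of_real (2 * W)) / E l)" by (simp only: V_def e2_add e2_diff)
    then show ?thesis unfolding EW L_def by simp
  qed
  have V3: "E (z + C0 - sh + sh / 2) = - V / (q * L)"
  proof -
    have "E (z + C0 - sh + sh / 2) = E (z + C0 + sh / 2) / E sh" by (simp only: e2_add e2_diff) simp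
    then show ?thesis unfolding V2 q2 using nz by (simp add: field_simps power2_eq_square)
  qed
  have V4: "E (z + B0 + sh / 2) = V / (X * L)"
  proof -
    have "z + B0 + sh / 2 = (z + A0 + sh / 2) - (x + l)" by (simp add: field_simps)
    then show ?thesis by (simp only: V_def X_def L_def e2_add e2_diff)
  qed
  have V5: "E (z + D0 - sh + sh / 2) = - V / (q * X)"
  proof -
    have "z + D0 - sh + sh / 2 = (z + A0 + sh / 2) + (\<i> * of_real (2 * W) - x - sh)" by (simp add: field_simps)
    then have "E (z + D0 - sh + sh / 2) = V * (E (\<i> * of_real (2 * W)) / E x / E sh)" by (simp only: V_def e2_add e2_diff)
    then show ?thesis unfolding EW q2 using nz by (simp add: X_def field_simps power2_eq_square)
  qed
  have near: "\<bar>Im (z + A0 - sh) + W\<bar> \<le> 6 * w1" "\<bar>Im (z + A0) + W\<bar> \<le> 6 * w1" "\<bar>Im (z + C0) - W\<bar> \<le> 6 * w1"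
    "\<bar>Im (z + C0 - sh) - W\<bar> \<le> 6 * w1" "\<bar>Im (z + B0) + W\<bar> \<le> 6 * w1" "\<bar>Im (z + D0 - sh) - W\<bar> \<le> 6 * w1"
    "\<bar>Im (z + C0 + sh) - W\<bar> \<le> 6 * w1" "\<bar>Im (z + D0) - W\<bar> \<le> 6 * w1"
  proof -
    have e: "Im (z + A0 - sh) + W = Im x + Im l / 2 - w1" "Im (z + A0) + W = Im x + Im l / 2" "Im (z + C0) - W = Im x - Im l / 2"
      "Im (z + C0 - sh) - W = Im x - Im l / 2 - w1" "Im (z + B0) + W = - Im l / 2" "Im (z + D0 - sh) - W = Im l / 2 - w1"
      "Im (z + C0 + sh) - W = Im x - Im l / 2 + w1" "Im (z + D0) - W = Im l / 2"
      using im by simp_all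
    show "\<bar>Im (z + A0 - sh) + W\<bar> \<le> 6 * w1" "\<bar>Im (z + A0) + W\<bar> \<le> 6 * w1" "\<bar>Im (z + C0) - W\<bar> \<le> 6 * w1"
      "\<bar>Im (z + C0 - sh) - W\<bar> \<le> 6 * w1" "\<bar>Im (z + B0) + W\<bar> \<le> 6 * w1" "\<bar>Im (z + D0 - sh) - W\<bar> \<le> 6 * w1"
      "\<bar>Im (z + C0 + sh) - W\<bar> \<le> 6 * w1" "\<bar>Im (z + D0) - W\<bar> \<le> 6 * w1"
      unfolding e using Im_small w1 by (simp_all add: abs_le_iff)
  qed
  define a where "a = H (z + A0 - sh) (\<i> * \<tau>)"
  define b where "b = H (z + B0) (\<i> * \<sigma>)"
  define c where "c = H (z + C0 + sh) (\<i> * \<rho>)"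
  define d where "d = H (z + D0) (\<i> * \<upsilon>)"
  define c0 where "c0 = H (z + C0) (\<i> * \<rho>)"
  define cm where "cm = H (z + C0 - sh) (\<i> * \<rho>)"
  define dm where "dm = H (z + D0 - sh) (\<i> * \<upsilon>)"
  have g1: "H (z + A0) (\<i> * \<tau>) = tm * a"
    using Gpm_step_near[OF disjI1[OF near(1)] Re_small(3)] unfolding V1 
    by (simp add: tm_def a_def T_def)
  have g2: "H (z + A0 + sh) (\<i> * \<tau>) = th * (tm * a)"
    using Gpm_step_near[OF disjI1[OF near(2)] Re_small(3)] unfolding g1 V_def[symmetric]
    by (simp add: th_def T_def)
  have g3: "c = et * c0"
    using Gpm_step_near[OF disjI2[OF near(3)] Re_small(1)] unfolding V2
    by (simp add: et_def c_def c0_def R_def)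
  have g4: "c0 = etm * cm"
    using Gpm_step_near[OF disjI2[OF near(4)] Re_small(1)] unfolding V3
    by (simp add: etm_def c0_def cm_def R_def)
  have g5: "H (z + B0 + sh) (\<i> * \<sigma>) = th2 * b"
    using Gpm_step_near[OF disjI1[OF near(5)] Re_small(2)] unfolding V4
    by (simp add: th2_def b_def S_def)
  have g6: "d = eu * dm"
    using Gpm_step_near[OF disjI2[OF near(6)] Re_small(4)] unfolding V5
    by (simp add: eu_def d_def dm_def U_def)
  have n: "c \<noteq> 0" "d \<noteq> 0" "cm \<noteq> 0" "dm \<noteq> 0" "c0 \<noteq> 0"
    unfolding c_def d_def cm_def dm_def c0_def by (rule Gpm_nonzero_near; rule near Re_small)+
  \<comment> \<open>It takes the lowest arguments in the numerator and the highest in the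
    denominator, so that every other integrand arises by multiplication with step factors, never by
    division.\<close>
  define Q where "Q = a * b / (c * d)"
  have sp: "z + (A0 + sh) = z + A0 + sh" "z + (C0 + sh) = z + C0 + sh" by (rule add.assoc[symmetric])+
  have sm: "z + (A0 - sh) = z + A0 - sh" "z + (C0 - sh) = z + C0 - sh" "z + (D0 - sh) = z + D0 - sh" by (rule add_diff_eq)+
  have I: "quad A0 B0 C0 D0 z = tm * et * Q"
    unfolding gamma_quad_def[OF w1 w2_pos] g1 Q_def b_def[symmetric] d_def[symmetric] c0_def[symmetric] 
    using n by (simp add: g3)
  have Ip: "quad (A0 + sh) B0 (C0 + sh) D0 z = th * tm * Q"
    unfolding gamma_quad_def[OF w1 w2_pos] sp g2 Q_def b_def[symmetric] d_def[symmetric] c_def[symmetric] by simp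
  have Im: "quad (A0 - sh) B0 (C0 - sh) D0 z = et * etm * Q"
    unfolding gamma_quad_def[OF w1 w2_pos] sm a_def[symmetric] Q_def b_def[symmetric] d_def[symmetric] cm_def[symmetric]
    using n by (simp add: g3 g4)
  have Dm: "quad (A0 - sh) B0 C0 (D0 - sh) z = eu * et * Q"
    unfolding gamma_quad_def[OF w1 w2_pos] sm a_def[symmetric] Q_def b_def[symmetric] c0_def[symmetric] dm_def[symmetric]
    using n by (simp add: g3 g6)
  have Dp: "quad (A0 - sh) B0 C0 (D0 - sh) (z + sh) = th2 * tm * Q"
  proof -
    have "z + sh + (A0 - sh) = z + A0" "z + sh + B0 = z + B0 + sh" "z + sh + C0 = z + C0 + sh" "z + sh + (D0 - sh) = z + D0" by simp_all
    then show ?thesis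
      unfolding gamma_quad_def[OF w1 w2_pos] by (simp only: g1 g5 b_def[symmetric] c_def[symmetric] d_def[symmetric] Q_def) simp
  qed
  have Vp: "E (z + sh + A0 + sh / 2) = q\<^sup>2 * V"
  proof -
    have "z + sh + A0 + sh / 2 = sh + (z + A0 + sh / 2)" by simp
    then show ?thesis by (simp only: e2_add q2 V_def)
  qed
  have "coeff_plus X q R S * (q\<^sup>2 - X\<^sup>2) * quad (A0 + sh) B0 (C0 + sh) D0 z
     + coeff_minus X q T U * (1 - q\<^sup>2 * X\<^sup>2) * quad (A0 - sh) B0 (C0 - sh) D0 z
     - coeff_zero X L q R S T U * quad A0 B0 C0 D0 z =
     (coeff_plus X q R S * (q\<^sup>2 - X\<^sup>2) * (th * tm) + coeff_minus X q T U * (1 - q\<^sup>2 * X\<^sup>2) * (et * etm) - coeff_zero X L q R S T U * (et * tm)) * Q"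
    unfolding I Ip Im by (simp add: algebra_simps)
  also have "\<dots> = (antidiff_factor X L q R S T U (q\<^sup>2 * V) * (th2 * tm) - antidiff_factor X L q R S T U V * (eu * et)) * Q"
    unfolding th_def tm_def et_def etm_def th2_def eu_def by (subst telescoping_identity[OF nz]) (rule refl)
  also have "\<dots> = D (z + sh) - D z"
    unfolding D_def Vp Dp Dm V_def[symmetric] by (simp add: algebra_simps)
  finally show ?thesis by (simp only: z_def)
qed

text \<open>The factor is a Laurent polynomial in \<open>V\<close> with exponents between - 1 and 1,
  so it grows at most like a single exponential.\<close>

lemma antidiff_bounded:
  shows "exp_bounded w1 (2 * pi / w2) (\<lambda>z. antidiff_factor X L q R S T U (E (z + c)))"
    and "(\<lambda>z. antidiff_factor X L q R S T U (E (z + c))) holomorphic_on Z"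
proof -
  define a where "a = E c * ((q\<^sup>2 - X\<^sup>2) * (X\<^sup>2 * S + q * X^3 * R) + (1 - q\<^sup>2 * X\<^sup>2) * (q * X\<^sup>2 * U / L + X^3 * T / L))"
  define b where "b = ((q\<^sup>2 - X\<^sup>2) * (q^4 * X\<^sup>2 * S + q^3 * X * R) + (1 - q\<^sup>2 * X\<^sup>2) * (q^3 * X\<^sup>2 * U * L + q^4 * X * T * L)) / E c"
  define d where "d = (q\<^sup>2 - X\<^sup>2) * (q\<^sup>2 * X\<^sup>2 * S * T + X * L + q^4 * X^3 / L - q\<^sup>2 * X^3 * L - q\<^sup>2 * X / L)
    - (1 - q\<^sup>2 * X\<^sup>2) * (R * U * q\<^sup>2 * X\<^sup>2) + R * T * q * X^3 * (q^4 - 1)"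
  have ez: "E z = exp (of_real (2 * pi / w2) * z)" "1 / E z = exp (of_real (- (2 * pi / w2)) * z)" for z
    by (simp_all add: e2_def exp_minus inverse_eq_divide)
  have eq: "(\<lambda>z. antidiff_factor X L q R S T U (E (z + c))) = (\<lambda>z. a * E z + (b * (1 / E z) + d))"
    unfolding antidiff_factor_def a_def b_def d_def e2_add 
    by (rule ext) (simp add: algebra_simps add_divide_distrib diff_divide_distrib)
  have "exp_bounded w1 (0 + 2 * pi / w2) (\<lambda>z. a * E z)" 
    unfolding ez(1) using w2_pos by (intro exp_bounded_mult exp_bounded_const exp_bounded_exp) simp_all
  moreover have "exp_bounded w1 (0 + 2 * pi / w2) (\<lambda>z. b * (1 / E z))"
    unfolding ez(2) using w2_pos by (intro exp_bounded_mult exp_bounded_const exp_bounded_exp) simp_all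
  moreover have "exp_bounded w1 (2 * pi / w2) (\<lambda>_. d)" using w2_pos by (intro exp_bounded_const) simp
  ultimately show "exp_bounded w1 (2 * pi / w2) (\<lambda>z. antidiff_factor X L q R S T U (E (z + c)))" 
    unfolding eq by (simp add: exp_bounded_add)
  show "(\<lambda>z. antidiff_factor X L q R S T U (E (z + c))) holomorphic_on Z"
    unfolding eq ez(2) unfolding ez(1) by (intro holomorphic_intros)
qed

lemma psi_integral_quad:
  "psi_integral (of_real w1) (of_real w2) \<rho> \<sigma> \<tau> \<upsilon> y l = 
    (\<integral>t. quad (y + l / 2 - \<i> * of_real W) B0 (y - l / 2 + \<i> * of_real W) D0 (of_real t) \<partial>lborel)"
proof -
  have "\<i> * wmean (of_real w1) (of_real w2) / 2 = \<i> * of_real W" by (simp add: wmean_def)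
  then show ?thesis
    unfolding psi_integral_def gamma_quad_def[OF w1 w2_pos] Let_def
    by (simp only: add_diff_eq add.assoc diff_conv_add_uminus[of _ "l / 2"] minus_divide_left)
qed

text \<open>Obtained by integrating \<open>integrand_difference\<close>: the right-hand side
  contributes 0 by \<open>contour_shift\<close>, because the total rate 2 pi / w2 - 8 pi / w2 of
  \<open>D\<close> is negative.\<close>

lemma psi_difference:
  defines "X \<equiv> E x" and "L \<equiv> E l" and "q \<equiv> E (sh / 2)" and "R \<equiv> E (\<i> * \<rho>) + 1 / E (\<i> * \<rho>)" and "S \<equiv> E (\<i> * \<sigma>) + 1 / E (\<i> * \<sigma>)"
    and "T \<equiv> E (\<i> * \<tau>) + 1 / E (\<i> * \<tau>)" and "U \<equiv> E (\<i> * \<upsilon>) + 1 / E (\<i> * \<upsilon>)"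
  defines "\<psi> \<equiv> (\<lambda>y. psi_integral (of_real w1) (of_real w2) \<rho> \<sigma> \<tau> \<upsilon> y l)"
  shows "coeff_plus X q R S * (q\<^sup>2 - X\<^sup>2) * \<psi> (x + sh) + coeff_minus X q T U * (1 - q\<^sup>2 * X\<^sup>2) * \<psi> (x - sh)
     = coeff_zero X L q R S T U * \<psi> x"
proof -
  define D where "D = (\<lambda>z. antidiff_factor X L q R S T U (E (z + A0 + sh / 2)) * quad (A0 - sh) B0 C0 (D0 - sh) z)"
  have nW: "norm (x + l / 2 + s) \<le> 4 * w1" "norm (x - l / 2 + s) \<le> 4 * w1" "norm (l / 2 + s) \<le> 4 * w1" if "norm s \<le> w1" for s
  proof -
    have "norm (l / 2) \<le> w1" using small w1 by (simp add: norm_divide)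
    then show "norm (x + l / 2 + s) \<le> 4 * w1" "norm (x - l / 2 + s) \<le> 4 * w1" "norm (l / 2 + s) \<le> 4 * w1"
      using that small w1 norm_triangle_ineq[of "x + l / 2" s] norm_triangle_ineq[of x "l / 2"] 
        norm_triangle_ineq[of "x - l / 2" s] norm_triangle_ineq4[of x "l / 2"] norm_triangle_ineq[of "l / 2" s] by linarith+
  qed
  have ns: "norm sh \<le> w1" "norm (- sh) \<le> w1" "norm (0 :: complex) \<le> w1" using w1 by (simp_all add: norm_mult)
  have nn: "norm ((A0 + s) + \<i> * of_real W) \<le> 4 * w1" "norm (B0 + \<i> * of_real W) \<le> 4 * w1" "norm ((C0 + s) - \<i> * of_real W) \<le> 4 * w1" 
    "norm ((D0 + s) - \<i> * of_real W) \<le> 4 * w1" if "norm s \<le> w1" for s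
  proof -
    have "(A0 + s) + \<i> * of_real W = x + l / 2 + s" "B0 + \<i> * of_real W = - (l / 2 + 0)" "(C0 + s) - \<i> * of_real W = x - l / 2 + s"
      "(D0 + s) - \<i> * of_real W = l / 2 + s" by simp_all
    then show "norm ((A0 + s) + \<i> * of_real W) \<le> 4 * w1" "norm (B0 + \<i> * of_real W) \<le> 4 * w1" "norm ((C0 + s) - \<i> * of_real W) \<le> 4 * w1" 
      "norm ((D0 + s) - \<i> * of_real W) \<le> 4 * w1" using nW[OF that] nW(3)[OF ns(3)] by (simp_all only: norm_minus_cancel)
  qed
  note n0 = nn[OF ns(3), unfolded add_0_right]
  note np = nn[OF ns(1)]
  note nm = nn[OF ns(2), folded diff_conv_add_uminus]
  have int: "integrable lborel (\<lambda>t::real. quad (A0 + sh) B0 (C0 + sh) D0 (of_real t))"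
    "integrable lborel (\<lambda>t::real. quad (A0 - sh) B0 (C0 - sh) D0 (of_real t))"
    "integrable lborel (\<lambda>t::real. quad A0 B0 C0 D0 (of_real t))"
    by (intro gamma_quad_integrable[OF w1 w2_pos w2] n0 np nm small)+
  note Db = gamma_quad_bounded[OF w1 w2_pos w2 nm(1) n0(2) n0(3) nm(4) small(3-6)]
  have bD: "exp_bounded w1 (2 * pi / w2 + - (8 * pi / w2)) D"
    unfolding D_def add.assoc by (intro exp_bounded_mult antidiff_bounded(1) Db(1))
  have neg: "2 * pi / w2 + - (8 * pi / w2) < 0"
    using w2_pos by (simp add: divide_strict_right_mono)
  have holD: "D holomorphic_on {z. - w1 < Im z \<and> Im z < 2 * w1}"
    unfolding D_def add.assoc by (intro holomorphic_on_mult Db(2) antidiff_bounded(2))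
  have S: "convex {z. - w1 < Im z \<and> Im z < 2 * w1}" "open {z. - w1 < Im z \<and> Im z < 2 * w1}" "{z. 0 \<le> Im z \<and> Im z \<le> w1} \<subseteq> {z. - w1 < Im z \<and> Im z < 2 * w1}"
  proof -
    have S: "{z. - w1 < Im z \<and> Im z < 2 * w1} = {z. Im z > - w1} \<inter> {z. Im z < 2 * w1}" by auto
    show "convex {z. - w1 < Im z \<and> Im z < 2 * w1}" "open {z. - w1 < Im z \<and> Im z < 2 * w1}" unfolding S
      by (simp_all only: convex_Int convex_halfspace_Im_lt convex_halfspace_Im_gt open_Int open_halfspace_Im_lt open_halfspace_Im_gt)
  qed (use w1 in auto)
  have cD: "continuous_on {z. 0 \<le> Im z \<and> Im z \<le> w1} D"
    by (rule continuous_on_subset[OF holomorphic_on_imp_continuous_on[OF holD] S(3)])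
  have iD: "integrable lborel (\<lambda>t::real. D (of_real t + sh))" "integrable lborel (\<lambda>t::real. D (of_real t))"
    using exp_bounded_integrable[OF bD neg _ _ cD, of w1] exp_bounded_integrable[OF bD neg _ _ cD, of 0] w1 by simp_all
  have "(\<integral>t. D (of_real t + sh) - D (of_real t) \<partial>lborel) = 0"
    using contour_shift[OF bD neg _ holD S] w1 iD by simp
  moreover have "D (of_real t + sh) - D (of_real t) = coeff_plus X q R S * (q\<^sup>2 - X\<^sup>2) * quad (A0 + sh) B0 (C0 + sh) D0 t
     + coeff_minus X q T U * (1 - q\<^sup>2 * X\<^sup>2) * quad (A0 - sh) B0 (C0 - sh) D0 t
     - coeff_zero X L q R S T U * quad A0 B0 C0 D0 t" for t :: real
    unfolding D_def X_def L_def q_def R_def S_def T_def U_def by (rule integrand_difference[symmetric])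
  ultimately have main: "coeff_plus X q R S * (q\<^sup>2 - X\<^sup>2) * (\<integral>t. quad (A0 + sh) B0 (C0 + sh) D0 (of_real t) \<partial>lborel)
     + coeff_minus X q T U * (1 - q\<^sup>2 * X\<^sup>2) * (\<integral>t. quad (A0 - sh) B0 (C0 - sh) D0 (of_real t) \<partial>lborel)
     - coeff_zero X L q R S T U * (\<integral>t. quad A0 B0 C0 D0 (of_real t) \<partial>lborel) = 0"
    using int by simp
  have e: "(x + sh) + l / 2 - \<i> * of_real W = A0 + sh" "(x + sh) - l / 2 + \<i> * of_real W = C0 + sh"
    "(x - sh) + l / 2 - \<i> * of_real W = A0 - sh" "(x - sh) - l / 2 + \<i> * of_real W = C0 - sh" by simp_all
  show ?thesis
    using main unfolding \<psi>_def psi_integral_quad e by (simp only: right_minus_eq)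
qed

end

hide_const (open) G Gpm E H W A0 B0 C0 D0 sh quad

section \<open>From \<open>\<psi>\<close> to \<open>S\<close>: Askey-Wilson coefficients and
  quotients of \<open>Delta_fun\<close>\<close>

lemma gamma_par_simps [simp]:
  "gamma_par \<rho> \<sigma> \<tau> \<upsilon> 0 = - \<rho> + \<sigma>" "gamma_par \<rho> \<sigma> \<tau> \<upsilon> (Suc 0) = \<rho> + \<sigma>"
  "gamma_par \<rho> \<sigma> \<tau> \<upsilon> 2 = - \<tau> - \<upsilon>" "gamma_par \<rho> \<sigma> \<tau> \<upsilon> 3 = \<tau> - \<upsilon>"
  by (simp_all add: gamma_par_def)

lemma dual_par_simps [simp]:
  "dual_par \<gamma> 0 = (\<gamma> 0 + \<gamma> 1 + \<gamma> 2 + \<gamma> 3) / 2" "dual_par \<gamma> (Suc 0) = (\<gamma> 0 + \<gamma> 1 - \<gamma> 2 - \<gamma> 3) / 2"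
  "dual_par \<gamma> 2 = (\<gamma> 0 - \<gamma> 1 + \<gamma> 2 - \<gamma> 3) / 2" "dual_par \<gamma> 3 = (\<gamma> 0 - \<gamma> 1 - \<gamma> 2 + \<gamma> 3) / 2"
  by (simp_all add: dual_par_def)

text \<open>Splits off the polynomial part; the exponential prefactors combine to a constant in the
  quotients of \<open>Delta_fun\<close>.\<close>

lemma gamma_factor_e2:
  "gamma_factor w1 (of_real w2) u = (1 + e2 w2 u) * exp (- (of_real pi * u / of_real w2))"
proof -
  have "e2 w2 u * exp (- (of_real pi * u / of_real w2)) = exp (of_real pi * u / of_real w2)"
    by (simp add: e2_def exp_add[symmetric] field_simps)
  then show ?thesis by (simp add: gamma_factor_def cosh_def scaleR_conv_of_real distrib_right)
qed

text \<open>The cancellation common to both shifts: two factors of the operator disappear and two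
  others take their place. The cases where \<open>M\<close>, \<open>D\<close> or \<open>k\<close> is
  0 hold because division by 0 yields 0.\<close>

lemma coeff_ratio_cancel:
  fixes p :: complex
  assumes "P2 \<noteq> 0" "P3 \<noteq> 0" "Q0 \<noteq> 0" "Q1 \<noteq> 0" "H \<noteq> 0" 
  shows "(p * P2 * P3 / M) / ((P2 * P3 * H) / (Q0 * Q1 * (k * H)) * D) = k * (p * Q0 * Q1) / M / D"
  using assms by (cases "M = 0"; cases "D = 0"; cases "k = 0") (simp_all add: field_simps)

lemma gamma_factor_uminus: "gamma_factor w1 w2 (- u) = gamma_factor w1 w2 u"
  by (simp add: gamma_factor_def cosh_def add.commute)

context
  fixes w1 w2 :: real and x l \<rho> \<sigma> \<tau> \<upsilon> :: complex
  assumes w1: "0 < w1" and w2: "40 * w1 \<le> w2"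
    and small: "norm x \<le> w1" "norm l \<le> w1" "norm \<rho> \<le> w1" "norm \<sigma> \<le> w1" "norm \<tau> \<le> w1" "norm \<upsilon> \<le> w1"
begin

abbreviation (input) "E' \<equiv> e2 w2"
abbreviation (input) "G' \<equiv> hyp_gamma (of_real w1) (of_real w2)"
abbreviation (input) "gf \<equiv> gamma_factor (of_real w1) (of_real w2)"
abbreviation (input) "sh' \<equiv> \<i> * of_real w1"
abbreviation (input) "\<gamma> \<equiv> gamma_par \<rho> \<sigma> \<tau> \<upsilon>"

lemma w2_pos': "0 < w2" using w1 w2 by simp

lemma w2_nonzero': "complex_of_real w2 \<noteq> 0" using w1 w2 by simp

text \<open>The half period in \<i> w turns the factors 1 - exp of the definition into 1 + q times
  an exponential.\<close>

lemma AW_coeff_e2: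
  "AW_coeff (of_real w1) (of_real w2) \<gamma> y = 
    (1 + E' (sh' / 2) * (E' (\<i> * \<sigma>) / E' (\<i> * \<rho>)) * E' y) * (1 + E' (sh' / 2) * (E' (\<i> * \<rho>) * E' (\<i> * \<sigma>)) * E' y)
    * (1 + E' (sh' / 2) * (1 / (E' (\<i> * \<tau>) * E' (\<i> * \<upsilon>))) * E' y) * (1 + E' (sh' / 2) * (E' (\<i> * \<tau>) / E' (\<i> * \<upsilon>)) * E' y)
    / ((1 - (E' y)\<^sup>2) * (1 - (E' (sh' / 2))\<^sup>2 * (E' y)\<^sup>2))"
proof -
  have W: "E' (\<i> * wmean (of_real w1) (of_real w2)) = - E' (sh' / 2)"
  proof -
    have "\<i> * wmean (of_real w1) (of_real w2) = sh' / 2 + \<i> * of_real w2 / 2" by (simp add: wmean_def field_simps)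
    then show ?thesis using e2_half_period[of w2] w2_pos' by (simp only: e2_add) simp
  qed
  have 1: "exp (2 * of_real pi * (\<i> * wmean (of_real w1) (of_real w2) + \<i> * g + y) / of_real w2) = - E' (sh' / 2) * E' (\<i> * g) * E' y" for g
    using e2_add[of w2 "\<i> * wmean (of_real w1) (of_real w2) + \<i> * g" y] e2_add[of w2 "\<i> * wmean (of_real w1) (of_real w2)" "\<i> * g"]
    unfolding W by (simp only: e2_def)
  have 2: "exp (4 * of_real pi * v / of_real w2) = (E' v)\<^sup>2" for v
    unfolding e2_double[symmetric] by (simp add: e2_def mult.assoc)
  have 3: "exp (4 * of_real pi * (y + \<i> * wmean (of_real w1) (of_real w2)) / of_real w2) = (E' (sh' / 2))\<^sup>2 * (E' y)\<^sup>2"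
    unfolding 2 e2_add W by (simp add: power_mult_distrib)
  have g: "E' (\<i> * \<gamma> 0) = E' (\<i> * \<sigma>) / E' (\<i> * \<rho>)" "E' (\<i> * \<gamma> 1) = E' (\<i> * \<rho>) * E' (\<i> * \<sigma>)"
    "E' (\<i> * \<gamma> 2) = 1 / (E' (\<i> * \<tau>) * E' (\<i> * \<upsilon>))" "E' (\<i> * \<gamma> 3) = E' (\<i> * \<tau>) / E' (\<i> * \<upsilon>)"
    by (simp_all add: distrib_left right_diff_distrib e2_add e2_diff e2_uminus)
  have "{0..3::nat} = {0, 1, 2, 3}" by auto
  then show ?thesis unfolding AW_coeff_def Let_def 1 unfolding 3 unfolding 2 by (simp add: g[simplified] mult.assoc)
qed

lemma AW_eigenvalue_e2:
  "AW_eigenvalue (of_real w1) (of_real w2) \<gamma> l = 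
     - E' (sh' / 2) * (E' (\<i> * \<sigma>) / E' (\<i> * \<upsilon>)) * (E' l + 1 / E' l) - (E' (sh' / 2) * (E' (\<i> * \<sigma>) / E' (\<i> * \<upsilon>)))\<^sup>2 - 1"
proof -
  define a where "a = of_real pi * \<i> * of_real w1 / of_real w2 + 2 * of_real pi * \<i> * dual_par \<gamma> 0 / of_real w2"
  have ea: "exp a = E' (sh' / 2) * (E' (\<i> * \<sigma>) / E' (\<i> * \<upsilon>))"
  proof -
    have "a = 2 * of_real pi * (sh' / 2 + (\<i> * \<sigma> - \<i> * \<upsilon>)) / of_real w2"
      using w2_nonzero' by (simp add: a_def field_simps)
    then show ?thesis by (simp only: e2_def[symmetric] e2_add e2_diff)
  qed
  have el: "exp (2 * of_real pi * l / of_real w2) = E' l" "exp (- (2 * of_real pi * l / of_real w2)) = 1 / E' l"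
    by (simp_all add: e2_def exp_minus inverse_eq_divide)
  have "AW_eigenvalue (of_real w1) (of_real w2) \<gamma> l = - 2 * exp a * (cosh (2 * of_real pi * l / of_real w2) + cosh a)"
    by (simp add: AW_eigenvalue_def Let_def a_def)
  also have "\<dots> = - exp a * (E' l + 1 / E' l) - (exp a)\<^sup>2 - exp a * exp (- a)"
  proof -
    have c: "2 * cosh (2 * of_real pi * l / of_real w2) = E' l + 1 / E' l" "2 * cosh a = exp a + exp (- a)" 
      by (simp_all only: cosh_def scaleR_conv_of_real el) simp_all
    have "- 2 * exp a * (cosh (2 * of_real pi * l / of_real w2) + cosh a) = - (exp a * (2 * cosh (2 * of_real pi * l / of_real w2))) - exp a * (2 * cosh a)"
      by (simp add: distrib_left)
    then show ?thesis unfolding c by (simp add: distrib_left power2_eq_square)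
  qed
  also have "exp a * exp (- a) = 1" by (simp add: exp_minus)
  finally show ?thesis by (simp only: ea mult_minus_left)
qed

lemma gamma_par_small: "\<bar>Im (\<i> * \<gamma> 0)\<bar> \<le> 2 * w1" "\<bar>Im (\<i> * \<gamma> 1)\<bar> \<le> 2 * w1" "\<bar>Im (\<i> * \<gamma> 2)\<bar> \<le> 2 * w1" "\<bar>Im (\<i> * \<gamma> 3)\<bar> \<le> 2 * w1"
proof -
  have R: "\<bar>Re \<rho>\<bar> \<le> w1" "\<bar>Re \<sigma>\<bar> \<le> w1" "\<bar>Re \<tau>\<bar> \<le> w1" "\<bar>Re \<upsilon>\<bar> \<le> w1" 
    using small abs_Re_le_cmod order_trans by blast+
  show "\<bar>Im (\<i> * \<gamma> 0)\<bar> \<le> 2 * w1" "\<bar>Im (\<i> * \<gamma> 1)\<bar> \<le> 2 * w1" "\<bar>Im (\<i> * \<gamma> 2)\<bar> \<le> 2 * w1" "\<bar>Im (\<i> * \<gamma> 3)\<bar> \<le> 2 * w1"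
    using R by (auto simp: abs_le_iff)
qed

lemma Im_x: "\<bar>Im x\<bar> \<le> w1" using small(1) abs_Im_le_cmod order_trans by blast

text \<open>Both gamma values are nonzero inside the strip, and this forces the factor between them
  to be nonzero.\<close>

lemma gamma_near_step:
  assumes "\<bar>Im u\<bar> \<le> 5 * w1"
  shows "G' (u + sh') = gf (u + sh' / 2) * G' u" "gf (u + sh' / 2) \<noteq> 0" "G' u \<noteq> 0"
proof -
  have a: "\<bar>2 * Im u + w1\<bar> < w2" "2 * \<bar>Im u\<bar> < w1 + w2" "2 * \<bar>Im (u + sh')\<bar> < w1 + w2"
    using assms w1 w2 by (auto simp: abs_if split: if_splits)
  show s: "G' (u + sh') = gf (u + sh' / 2) * G' u" using hyp_gamma_step[OF w1 w2_pos' a(1)] .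
  show "G' u \<noteq> 0" using hyp_gamma_nonzero[OF w1 w2_pos' a(2)] .
  have "G' (u + sh') \<noteq> 0" using hyp_gamma_nonzero[OF w1 w2_pos' a(3)] .
  then show "gf (u + sh' / 2) \<noteq> 0" by (simp add: s)
qed

lemma Delta_step:
  assumes "\<bar>Im y\<bar> \<le> 2 * w1"
  shows "Delta_fun (of_real w1) (of_real w2) \<gamma> (y + sh') = 
    gf (y + \<i> * \<gamma> 2 + sh' / 2) * gf (y + \<i> * \<gamma> 3 + sh' / 2) / (gf (y - \<i> * \<gamma> 0 + sh' / 2) * gf (y - \<i> * \<gamma> 1 + sh' / 2)) * Delta_fun (of_real w1) (of_real w2) \<gamma> y"
    and "Delta_fun (of_real w1) (of_real w2) \<gamma> y \<noteq> 0"
    and "gf (y + \<i> * \<gamma> 2 + sh' / 2) \<noteq> 0" "gf (y + \<i> * \<gamma> 3 + sh' / 2) \<noteq> 0" "gf (y - \<i> * \<gamma> 0 + sh' / 2) \<noteq> 0" "gf (y - \<i> * \<gamma> 1 + sh' / 2) \<noteq> 0"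
proof -
  have i: "\<bar>Im (y + \<i> * \<gamma> 2)\<bar> \<le> 5 * w1" "\<bar>Im (y + \<i> * \<gamma> 3)\<bar> \<le> 5 * w1" "\<bar>Im (y - \<i> * \<gamma> 0)\<bar> \<le> 5 * w1" "\<bar>Im (y - \<i> * \<gamma> 1)\<bar> \<le> 5 * w1"
    using gamma_par_small assms w1 unfolding plus_complex.sel minus_complex.sel by linarith+
  note s = gamma_near_step[OF i(1)] gamma_near_step[OF i(2)] gamma_near_step[OF i(3)] gamma_near_step[OF i(4)]
  have e: "y + sh' + \<i> * \<gamma> 2 = y + \<i> * \<gamma> 2 + sh'" "y + sh' + \<i> * \<gamma> 3 = y + \<i> * \<gamma> 3 + sh'"
    "y + sh' - \<i> * \<gamma> 0 = y - \<i> * \<gamma> 0 + sh'" "y + sh' - \<i> * \<gamma> 1 = y - \<i> * \<gamma> 1 + sh'" by (simp_all only: add_ac diff_conv_add_uminus)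
  show "Delta_fun (of_real w1) (of_real w2) \<gamma> (y + sh') = 
    gf (y + \<i> * \<gamma> 2 + sh' / 2) * gf (y + \<i> * \<gamma> 3 + sh' / 2) / (gf (y - \<i> * \<gamma> 0 + sh' / 2) * gf (y - \<i> * \<gamma> 1 + sh' / 2)) * Delta_fun (of_real w1) (of_real w2) \<gamma> y"
    unfolding Delta_fun_def e s by (simp only: times_divide_times_eq mult_ac)
  show "Delta_fun (of_real w1) (of_real w2) \<gamma> y \<noteq> 0" unfolding Delta_fun_def using s by simp
  show "gf (y + \<i> * \<gamma> 2 + sh' / 2) \<noteq> 0" "gf (y + \<i> * \<gamma> 3 + sh' / 2) \<noteq> 0" "gf (y - \<i> * \<gamma> 0 + sh' / 2) \<noteq> 0" "gf (y - \<i> * \<gamma> 1 + sh' / 2) \<noteq> 0"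
    by (rule s)+
qed

text \<open>The two factors of the coefficient that contain t and u cancel against the quotient of
  \<open>Delta_fun\<close>, which contributes those with r / s and 1 / (r s) instead, so the product
  becomes \<open>coeff_plus\<close>.\<close>

lemma AW_coeff_Delta_plus:
  "AW_coeff (of_real w1) (of_real w2) \<gamma> x / Delta_fun (of_real w1) (of_real w2) \<gamma> (x + sh') = 
    E' (\<i> * \<sigma>) / E' (\<i> * \<upsilon>) * coeff_plus (E' x) (E' (sh' / 2)) (E' (\<i> * \<rho>) + 1 / E' (\<i> * \<rho>)) (E' (\<i> * \<sigma>) + 1 / E' (\<i> * \<sigma>))
     / ((1 - (E' x)\<^sup>2) * (1 - (E' (sh' / 2))\<^sup>2 * (E' x)\<^sup>2)) / Delta_fun (of_real w1) (of_real w2) \<gamma> x"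
proof -
  define q X r s t u where "q = E' (sh' / 2)" "X = E' x" "r = E' (\<i> * \<rho>)" "s = E' (\<i> * \<sigma>)" "t = E' (\<i> * \<tau>)" "u = E' (\<i> * \<upsilon>)"
  note defs = this
  have nz: "r \<noteq> 0" "s \<noteq> 0" "t \<noteq> 0" "u \<noteq> 0" by (simp_all add: defs)
  define h where "h = (\<lambda>u. exp (- (of_real pi * u / complex_of_real w2)))"
  have hnz: "h v \<noteq> 0" for v by (simp add: h_def)
  have ix: "\<bar>Im x\<bar> \<le> 2 * w1" using Im_x w1 by simp
  note D = Delta_step[OF ix]
  have e: "E' (x + \<i> * \<gamma> 2 + sh' / 2) = q * (1 / (t * u)) * X" "E' (x + \<i> * \<gamma> 3 + sh' / 2) = q * (t / u) * X"
    "E' (x - \<i> * \<gamma> 0 + sh' / 2) = q * (r / s) * X" "E' (x - \<i> * \<gamma> 1 + sh' / 2) = q * (1 / (r * s)) * X"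
    by (simp_all add: defs e2_add e2_diff e2_uminus distrib_left right_diff_distrib)
  have f: "gf (x + \<i> * \<gamma> 2 + sh' / 2) = (1 + q * (1 / (t * u)) * X) * h (x + \<i> * \<gamma> 2 + sh' / 2)" 
    "gf (x + \<i> * \<gamma> 3 + sh' / 2) = (1 + q * (t / u) * X) * h (x + \<i> * \<gamma> 3 + sh' / 2)"
    "gf (x - \<i> * \<gamma> 0 + sh' / 2) = (1 + q * (r / s) * X) * h (x - \<i> * \<gamma> 0 + sh' / 2)" 
    "gf (x - \<i> * \<gamma> 1 + sh' / 2) = (1 + q * (1 / (r * s)) * X) * h (x - \<i> * \<gamma> 1 + sh' / 2)"
    unfolding gamma_factor_e2 e h_def by (rule refl)+
  \<comment> \<open>The exponents of the prefactors differ by pi \<i> / w2 times the sum of all four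
    parameters, and this sum is 2 (\<open>\<sigma>\<close> - \<open>\<upsilon>\<close>); hence the
    factor s / u.\<close>
  have hh: "h (x - \<i> * \<gamma> 0 + sh' / 2) * h (x - \<i> * \<gamma> 1 + sh' / 2) = s / u * (h (x + \<i> * \<gamma> 2 + sh' / 2) * h (x + \<i> * \<gamma> 3 + sh' / 2))"
    unfolding h_def defs e2_def exp_diff[symmetric] exp_add[symmetric]
    by (rule arg_cong[of _ _ exp]) (use w2_nonzero' in \<open>simp add: field_simps\<close>)
  have nz2: "1 + q * (1 / (t * u)) * X \<noteq> 0" "1 + q * (t / u) * X \<noteq> 0" "1 + q * (r / s) * X \<noteq> 0" "1 + q * (1 / (r * s)) * X \<noteq> 0"
    using D(3-6) unfolding f by (metis mult_zero_left)+
  define P0 P1 P2 P3 where P: "P0 = 1 + q * (s / r) * X" "P1 = 1 + q * (r * s) * X" "P2 = 1 + q * (1 / (t * u)) * X" "P3 = 1 + q * (t / u) * X"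
  define Q0 Q1 where Q: "Q0 = 1 + q * (r / s) * X" "Q1 = 1 + q * (1 / (r * s)) * X"
  define H0 H2 where H: "H0 = h (x - \<i> * \<gamma> 0 + sh' / 2) * h (x - \<i> * \<gamma> 1 + sh' / 2)" "H2 = h (x + \<i> * \<gamma> 2 + sh' / 2) * h (x + \<i> * \<gamma> 3 + sh' / 2)"
  have H0: "H0 = s / u * H2" "H2 \<noteq> 0" using hh hnz by (simp_all add: H)
  have "Delta_fun (of_real w1) (of_real w2) \<gamma> (x + sh') = (P2 * P3 * H2) / (Q0 * Q1 * H0) * Delta_fun (of_real w1) (of_real w2) \<gamma> x"
    unfolding D(1) f P[symmetric] Q[symmetric] H by (simp add: mult_ac)
  moreover have "AW_coeff (of_real w1) (of_real w2) \<gamma> x = P0 * P1 * P2 * P3 / ((1 - X\<^sup>2) * (1 - q\<^sup>2 * X\<^sup>2))"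
    unfolding AW_coeff_e2 defs[symmetric] P[symmetric] by (rule refl)
  moreover have "coeff_plus X q (r + 1 / r) (s + 1 / s) = P0 * P1 * Q0 * Q1"
    unfolding P Q by (rule coeff_plus_factor[symmetric, OF nz(1,2)])
  ultimately show ?thesis
    unfolding defs[symmetric] using coeff_ratio_cancel[OF nz2[folded P Q] H0(2)] by (simp only: H0(1))
qed

lemma AW_coeff_Delta_minus:
  "AW_coeff (of_real w1) (of_real w2) \<gamma> (- x) / Delta_fun (of_real w1) (of_real w2) \<gamma> (x - sh') = 
    E' (\<i> * \<sigma>) / E' (\<i> * \<upsilon>) * (coeff_minus (E' x) (E' (sh' / 2)) (E' (\<i> * \<tau>) + 1 / E' (\<i> * \<tau>)) (E' (\<i> * \<upsilon>) + 1 / E' (\<i> * \<upsilon>)) / (E' x)^4)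
     / ((1 - (1 / E' x)\<^sup>2) * (1 - (E' (sh' / 2))\<^sup>2 * (1 / E' x)\<^sup>2)) / Delta_fun (of_real w1) (of_real w2) \<gamma> x"
proof -
  define q X r s t u where "q = E' (sh' / 2)" "X = E' x" "r = E' (\<i> * \<rho>)" "s = E' (\<i> * \<sigma>)" "t = E' (\<i> * \<tau>)" "u = E' (\<i> * \<upsilon>)"
  note defs = this
  have nz: "r \<noteq> 0" "s \<noteq> 0" "t \<noteq> 0" "u \<noteq> 0" "X \<noteq> 0" by (simp_all add: defs)
  define h where "h = (\<lambda>u. exp (- (of_real pi * u / complex_of_real w2)))"
  have hnz: "h v \<noteq> 0" for v by (simp add: h_def)
  have ix: "\<bar>Im (x - sh')\<bar> \<le> 2 * w1" using Im_x w1 by (auto simp: abs_if split: if_splits)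
  note D = Delta_step[OF ix]
  \<comment> \<open>The step leads from x - \<i> w1 up to x. As \<open>gamma_factor\<close> is even,
    its arguments may be negated, which gives exponentials with the same q and with 1 / X in place
    of X.\<close>
  define a2 a3 a0 a1 where a: "a2 = - x - \<i> * \<gamma> 2 + sh' / 2" "a3 = - x - \<i> * \<gamma> 3 + sh' / 2" "a0 = - x + \<i> * \<gamma> 0 + sh' / 2" "a1 = - x + \<i> * \<gamma> 1 + sh' / 2"
  have m: "x - sh' + \<i> * \<gamma> 2 + sh' / 2 = - a2" "x - sh' + \<i> * \<gamma> 3 + sh' / 2 = - a3"
    "x - sh' - \<i> * \<gamma> 0 + sh' / 2 = - a0" "x - sh' - \<i> * \<gamma> 1 + sh' / 2 = - a1" "x - sh' + sh' = x"
    by (simp_all add: a field_simps del: gamma_par_simps)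
  have e: "E' a2 = q * (t * u) / X" "E' a3 = q * (u / t) / X" "E' a0 = q * (s / r) / X" "E' a1 = q * (r * s) / X"
    by (simp_all add: a defs e2_add e2_diff e2_uminus distrib_left right_diff_distrib mult_ac)
  have f: "gf a2 = (1 + q * (t * u) / X) * h a2" "gf a3 = (1 + q * (u / t) / X) * h a3"
    "gf a0 = (1 + q * (s / r) / X) * h a0" "gf a1 = (1 + q * (r * s) / X) * h a1"
    unfolding gamma_factor_e2 e h_def by (rule refl)+
  have hh: "h a2 * h a3 = s / u * (h a0 * h a1)"
    unfolding h_def defs e2_def exp_diff[symmetric] exp_add[symmetric] a
    by (rule arg_cong[of _ _ exp]) (use w2_nonzero' in \<open>simp add: field_simps\<close>)
  have nz2: "1 + q * (t * u) / X \<noteq> 0" "1 + q * (u / t) / X \<noteq> 0" "1 + q * (s / r) / X \<noteq> 0" "1 + q * (r * s) / X \<noteq> 0"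
    using D(3-6) unfolding m gamma_factor_uminus f by (metis mult_zero_left)+
  define P0 P1 P2 P3 where P: "P0 = 1 + q * (s / r) / X" "P1 = 1 + q * (r * s) / X" "P2 = 1 + q * (1 / (t * u)) / X" "P3 = 1 + q * (t / u) / X"
  define Q2 Q3 where Q: "Q2 = 1 + q * (t * u) / X" "Q3 = 1 + q * (u / t) / X"
  define H0 H2 where H: "H0 = h a0 * h a1" "H2 = h a2 * h a3"
  have H0: "H2 = s / u * H0" "H0 \<noteq> 0" using hh hnz by (simp_all add: H)
  have "Delta_fun (of_real w1) (of_real w2) \<gamma> x = (Q2 * Q3 * H2) / (P0 * P1 * H0) * Delta_fun (of_real w1) (of_real w2) \<gamma> (x - sh')"
    using D(1) unfolding m gamma_factor_uminus f P[symmetric] Q[symmetric] H by (simp add: mult_ac)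
  then have "Delta_fun (of_real w1) (of_real w2) \<gamma> (x - sh') = (P0 * P1 * H0) / (Q2 * Q3 * (s / u * H0)) * Delta_fun (of_real w1) (of_real w2) \<gamma> x"
    using nz nz2 H0(2) unfolding P[symmetric] Q[symmetric] H0(1) by (simp add: field_simps)
  moreover have "AW_coeff (of_real w1) (of_real w2) \<gamma> (- x) = P2 * P3 * P0 * P1 / ((1 - (1 / X)\<^sup>2) * (1 - q\<^sup>2 * (1 / X)\<^sup>2))"
    unfolding AW_coeff_e2 e2_uminus defs[symmetric] P by (simp add: mult_ac)
  moreover have "coeff_minus X q (t + 1 / t) (u + 1 / u) / X^4 = P2 * P3 * Q2 * Q3"
    unfolding P Q coeff_minus_factor[symmetric, OF nz(3,4,5)] by (simp add: mult_ac)
  ultimately show ?thesis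
    unfolding defs[symmetric] using coeff_ratio_cancel[OF nz2(3,4,1,2)[folded P Q] H0(2), of "P2 * P3"] by (simp only:)
qed

lemma S_fun_psi_integral:
  "S_fun psi_integral (of_real w1) (of_real w2) \<rho> \<sigma> \<tau> \<upsilon> y l = 
    (N_fun (of_real w1) (of_real w2) \<gamma> / (csqrt (of_real w1 * of_real w2) * Delta_fun (of_real w1) (of_real w2) (dual_par \<gamma>) l))
     * (psi_integral (of_real w1) (of_real w2) \<rho> \<sigma> \<tau> \<upsilon> y l / Delta_fun (of_real w1) (of_real w2) \<gamma> y)"
  by (simp add: S_fun_def Let_def)

text \<open>The factor \<open>c\<close> does not involve x. After division by
  \<open>Delta_fun\<close> the equation becomes the three-term relation of
  \<open>psi_difference\<close>, whose middle coefficient is identified by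
  \<open>coeff_zero_eq\<close>. The assumptions keep the denominators of the Askey-Wilson
  coefficients away from 0.\<close>

theorem AW_op_S_fun:
  assumes d: "1 - (E' x)\<^sup>2 \<noteq> 0" "1 - (E' (sh' / 2))\<^sup>2 * (E' x)\<^sup>2 \<noteq> 0" "(E' (sh' / 2))\<^sup>2 - (E' x)\<^sup>2 \<noteq> 0"
  shows "AW_op (of_real w1) (of_real w2) \<gamma> (\<lambda>y. S_fun psi_integral (of_real w1) (of_real w2) \<rho> \<sigma> \<tau> \<upsilon> y l) x
    = AW_eigenvalue (of_real w1) (of_real w2) \<gamma> l * S_fun psi_integral (of_real w1) (of_real w2) \<rho> \<sigma> \<tau> \<upsilon> x l"
proof -
  define q X L r s t u where "q = E' (sh' / 2)" "X = E' x" "L = E' l" "r = E' (\<i> * \<rho>)" "s = E' (\<i> * \<sigma>)" "t = E' (\<i> * \<tau>)" "u = E' (\<i> * \<upsilon>)"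
  note defs = this
  have nz: "X \<noteq> 0" "L \<noteq> 0" "q \<noteq> 0" "r \<noteq> 0" "s \<noteq> 0" "t \<noteq> 0" "u \<noteq> 0" by (simp_all add: defs)
  define R S T U where "R = r + 1 / r" "S = s + 1 / s" "T = t + 1 / t" "U = u + 1 / u"
  note defs2 = this
  have d': "1 - X\<^sup>2 \<noteq> 0" "1 - q\<^sup>2 * X\<^sup>2 \<noteq> 0" "q\<^sup>2 - X\<^sup>2 \<noteq> 0" using d by (simp_all add: defs)
  define c where "c = N_fun (of_real w1) (of_real w2) \<gamma> / (csqrt (of_real w1 * of_real w2) * Delta_fun (of_real w1) (of_real w2) (dual_par \<gamma>) l)"
  define \<psi> where "\<psi> = (\<lambda>y. psi_integral (of_real w1) (of_real w2) \<rho> \<sigma> \<tau> \<upsilon> y l)"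
  define D where "D = Delta_fun (of_real w1) (of_real w2) \<gamma>"
  define A where "A = AW_coeff (of_real w1) (of_real w2) \<gamma>"
  define v where "v = AW_eigenvalue (of_real w1) (of_real w2) \<gamma> l"
  define M where "M = (1 - X\<^sup>2) * (1 - q\<^sup>2 * X\<^sup>2) * (q\<^sup>2 - X\<^sup>2)"
  have ap: "A x / D (x + sh') = s / u * (coeff_plus X q R S * (q\<^sup>2 - X\<^sup>2)) / M / D x"
    unfolding A_def D_def AW_coeff_Delta_plus defs[symmetric] defs2[symmetric] M_def using d' by simp
  have am: "A (- x) / D (x - sh') = s / u * (coeff_minus X q T U * (1 - q\<^sup>2 * X\<^sup>2)) / M / D x"
  proof -
    have "(1 - (1 / X)\<^sup>2) * (1 - q\<^sup>2 * (1 / X)\<^sup>2) = (1 - X\<^sup>2) * (q\<^sup>2 - X\<^sup>2) / X ^ 4"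
      using nz by (simp add: field_simps power4_eq_xxxx power2_eq_square)
    then show ?thesis unfolding A_def D_def AW_coeff_Delta_minus defs[symmetric] defs2[symmetric] M_def using d' nz by simp
  qed
  have a0: "A x + A (- x) + v = s / u * coeff_zero X L q R S T U / M"
    unfolding A_def v_def AW_coeff_e2 e2_uminus AW_eigenvalue_e2 defs[symmetric] M_def defs2 
    using coeff_zero_eq[OF nz d'] by (simp add: power_divide)
  have psi: "coeff_plus X q R S * (q\<^sup>2 - X\<^sup>2) * \<psi> (x + sh') + coeff_minus X q T U * (1 - q\<^sup>2 * X\<^sup>2) * \<psi> (x - sh') = coeff_zero X L q R S T U * \<psi> x"
    using psi_difference[OF w1 w2 small] by (simp only: \<psi>_def defs2 defs)
  have "AW_op (of_real w1) (of_real w2) \<gamma> (\<lambda>y. S_fun psi_integral (of_real w1) (of_real w2) \<rho> \<sigma> \<tau> \<upsilon> y l) x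
    = A x * (c * (\<psi> (x + sh') / D (x + sh')) - c * (\<psi> x / D x)) + A (- x) * (c * (\<psi> (x - sh') / D (x - sh')) - c * (\<psi> x / D x))"
    unfolding AW_op_def S_fun_psi_integral c_def \<psi>_def D_def A_def by (rule refl)
  also have "\<dots> = c * ((A x / D (x + sh')) * \<psi> (x + sh') + (A (- x) / D (x - sh')) * \<psi> (x - sh') - (A x + A (- x)) * (\<psi> x / D x))"
    by (simp add: algebra_simps)
  also have "\<dots> = c * (s / u * (coeff_plus X q R S * (q\<^sup>2 - X\<^sup>2) * \<psi> (x + sh') + coeff_minus X q T U * (1 - q\<^sup>2 * X\<^sup>2) * \<psi> (x - sh')) / M / D x - (A x + A (- x)) * (\<psi> x / D x))"
    unfolding ap am by (simp add: add_divide_distrib distrib_left mult_ac)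
  also have "\<dots> = c * ((A x + A (- x) + v) * (\<psi> x / D x) - (A x + A (- x)) * (\<psi> x / D x))"
    unfolding psi a0 by (simp add: mult_ac)
  also have "\<dots> = v * (c * (\<psi> x / D x))" by (simp add: algebra_simps)
  also have "c * (\<psi> x / D x) = S_fun psi_integral (of_real w1) (of_real w2) \<rho> \<sigma> \<tau> \<upsilon> x l"
    unfolding S_fun_psi_integral c_def \<psi>_def D_def by (rule refl)
  finally show ?thesis unfolding v_def .
qed

end

hide_const (open) E' G' gf sh' \<gamma>

section \<open>Meromorphy on the domain of all variables\<close>

lemma holomorphic_several_on_cosh:
  "holomorphic_several_on f U \<Longrightarrow> holomorphic_several_on (\<lambda>p. cosh (f p)) U"
  unfolding cosh_conv_cos
  by (rule holomorphic_several_on_compose1[of _ _ "\<lambda>z. cos (\<i> * z)" UNIV]) (auto intro!: holomorphic_intros)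

lemma holomorphic_several_on_exp:
  "holomorphic_several_on f U \<Longrightarrow> holomorphic_several_on (\<lambda>p. exp (f p)) U"
  by (rule holomorphic_several_on_compose1[of _ _ exp UNIV]) (auto intro!: holomorphic_intros)

lemma holomorphic_several_on_hyp_gamma_strip:
  assumes "holomorphic_several_on a U" "holomorphic_several_on b U" "holomorphic_several_on c U"
    and "\<And>p. p \<in> U \<Longrightarrow> 0 < Re (a p) \<and> 0 < Re (b p) \<and> 2 * \<bar>Im (c p)\<bar> < Re (a p) + Re (b p)"
  shows "holomorphic_several_on (\<lambda>p. hyp_gamma_strip (a p) (b p) (c p)) U"
proof -
  define \<Phi> :: "complex ^ 'a \<Rightarrow> complex ^ 3" where "\<Phi> = (\<lambda>p. \<chi> i. if i = 1 then a p else if i = 2 then b p else c p)"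
  have \<Phi>: "\<Phi> p $ 1 = a p" "\<Phi> p $ 2 = b p" "\<Phi> p $ 3 = c p" for p by (simp_all add: \<Phi>_def)
  have "holomorphic_several_on (\<lambda>p. \<Phi> p $ i) U" for i
    using assms(1-3) by (cases "i = 1"; cases "i = 2") (simp_all add: \<Phi>_def)
  then have "holomorphic_several_on (\<lambda>p. gamma_log (\<Phi> p $ 1) (\<Phi> p $ 2) (\<Phi> p $ 3)) U"
    by (rule holomorphic_several_on_compose[OF holomorphic_gamma_log]) 
      (use assms(4) in \<open>auto simp: gamma_domain_def \<Phi>\<close>)
  then show ?thesis unfolding hyp_gamma_strip_eq \<Phi> 
    by (intro holomorphic_several_on_exp holomorphic_several_on_mult holomorphic_several_on_const)
qed

text \<open>Near a point one admissible level can be frozen; with a fixed level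
  \<open>gamma_ext\<close> is a finite product of functions holomorphic in all variables and of
  reciprocals of such functions.\<close>

lemma meromorphic_several_on_hyp_gamma:
  assumes U: "open U" and h: "holomorphic_several_on a U" "holomorphic_several_on b U" "holomorphic_several_on c U"
    and re: "\<And>p. p \<in> U \<Longrightarrow> 0 < Re (a p) \<and> 0 < Re (b p)"
  shows "meromorphic_several_on (\<lambda>p. hyp_gamma (a p) (b p) (c p)) U"
proof (rule meromorphic_several_on_cong_locally[OF _ U])
  fix p assume p: "p \<in> U"
  define m where "m = gamma_level (a p) (c p)"
  define V where "V = {q \<in> U. 2 * \<bar>Im (c q) - of_int m * Re (a q)\<bar> < Re (a q) + Re (b q)}"
  have V: "open V" "p \<in> V" "V \<subseteq> U"
  proof -
    have "continuous_on U a" "continuous_on U b" "continuous_on U c" 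
      using h by (auto intro: holomorphic_several_on_imp_continuous_on)
    then have "open (U \<inter> (\<lambda>q. Re (a q) + Re (b q) - 2 * \<bar>Im (c q) - of_int m * Re (a q)\<bar>) -` {0<..})"
      by (intro continuous_open_preimage continuous_intros) (auto simp: U)
    then show "open V" by (simp add: V_def vimage_def Int_def)
    show "p \<in> V" "V \<subseteq> U" using p gamma_level_strip[of "a p" "b p" "c p"] re[OF p] by (auto simp: V_def m_def)
  qed
  have eq: "hyp_gamma (a q) (b q) (c q) = gamma_ext (a q) (b q) m (c q)" if "q \<in> V" for q
    by (rule hyp_gamma_eq_ext) (use that re[of q] in \<open>auto simp: V_def\<close>)
  have hV: "holomorphic_several_on a V" "holomorphic_several_on b V" "holomorphic_several_on c V"
    using h V(3) by (auto elim: holomorphic_several_on_subset)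
  have reV: "0 < Re (a q) \<and> 0 < Re (b q)" "b q \<noteq> 0" if "q \<in> V" for q using that re[of q] V(3) by auto
  have f: "meromorphic_several_on (\<lambda>q. gamma_factor (a q) (b q) (d q)) V" if "holomorphic_several_on d V" for d
    unfolding gamma_factor_def
    by (intro holomorphic_imp_meromorphic_several holomorphic_several_on_mult holomorphic_several_on_const 
        holomorphic_several_on_cosh holomorphic_several_on_divide that hV V) (use reV in auto)
  have "meromorphic_several_on (\<lambda>q. gamma_ext (a q) (b q) m (c q)) V"
    unfolding gamma_ext_def gamma_prod_def
    by (intro meromorphic_several_on_mult meromorphic_several_on_divide meromorphic_several_on_prod f
        holomorphic_several_on_add holomorphic_several_on_diff holomorphic_several_on_mult holomorphic_several_on_const 
        holomorphic_imp_meromorphic_several holomorphic_several_on_hyp_gamma_strip hV V)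
      (use reV in \<open>auto simp: V_def\<close>)
  then show "\<exists>V f'. open V \<and> p \<in> V \<and> meromorphic_several_on f' V \<and> (\<forall>q\<in>V. hyp_gamma (a q) (b q) (c q) = f' q)"
    by (rule_tac exI[of _ V], rule_tac exI[of _ "\<lambda>q. gamma_ext (a q) (b q) m (c q)"]) (simp add: V eq)
qed

section \<open>Meromorphy of the ingredients of \<open>S\<close> and of the operators on
  \<open>domain_O\<close>\<close>

lemma open_domain_O: "open domain_O"
  unfolding domain_O_def Collect_conj_eq
  by (intro open_Int open_Collect_less continuous_intros)

lemma connected_domain_O: "connected domain_O"
proof -
  have c: "convex ((\<lambda>p :: complex ^ 8. Re (p $ i)) -` {0<..})" for i
    by (intro convex_linear_vimage) (auto intro!: linearI)
  have "domain_O = (\<lambda>p. Re (p $ 1)) -` {0<..} \<inter> (\<lambda>p. Re (p $ 2)) -` {0<..}" by (auto simp: domain_O_def)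
  then show ?thesis using convex_connected[OF convex_Int[OF c c]] by metis
qed

lemmas holomorphic_several_intros = holomorphic_several_on_add holomorphic_several_on_diff holomorphic_several_on_mult 
  holomorphic_several_on_const holomorphic_several_on_nth holomorphic_several_on_uminus

lemma meromorphic_hyp_gamma_O: "holomorphic_several_on c domain_O \<Longrightarrow> 
    meromorphic_several_on (\<lambda>p. hyp_gamma (p $ 1) (p $ 2) (c p)) domain_O"
  by (intro meromorphic_several_on_hyp_gamma open_domain_O holomorphic_several_intros) (auto simp: domain_O_def)

lemma meromorphic_N_fun: 
  assumes "\<And>j. j \<in> {0..3} \<Longrightarrow> holomorphic_several_on (\<lambda>p. \<gamma> p j) domain_O"
  shows "meromorphic_several_on (\<lambda>p. N_fun (p $ 1) (p $ 2) (\<gamma> p)) domain_O"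
  unfolding N_fun_def wmean_def divide_inverse
  by (intro meromorphic_several_on_prod meromorphic_hyp_gamma_O open_domain_O holomorphic_several_intros assms) auto

lemma meromorphic_Delta_fun: 
  assumes "\<And>j. j \<in> {0..3} \<Longrightarrow> holomorphic_several_on (\<lambda>p. \<gamma> p j) domain_O" "holomorphic_several_on c domain_O"
  shows "meromorphic_several_on (\<lambda>p. Delta_fun (p $ 1) (p $ 2) (\<gamma> p) (c p)) domain_O"
  unfolding Delta_fun_def
  by (intro meromorphic_several_on_mult meromorphic_several_on_divide meromorphic_hyp_gamma_O open_domain_O holomorphic_several_intros assms) auto

lemma meromorphic_AW_coeff: 
  assumes \<gamma>: "\<And>j. j \<in> {0..3} \<Longrightarrow> holomorphic_several_on (\<lambda>p. \<gamma> p j) domain_O" and c: "holomorphic_several_on c domain_O"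
  shows "meromorphic_several_on (\<lambda>p. AW_coeff (p $ 1) (p $ 2) (\<gamma> p) (c p)) domain_O"
proof -
  have d: "p $ 2 \<noteq> 0" if "p \<in> domain_O" for p using that by (auto simp: domain_O_def)
  show ?thesis
    unfolding AW_coeff_def Let_def wmean_def divide_inverse[of _ 2]
    by (intro meromorphic_several_on_mult meromorphic_several_on_divide meromorphic_several_on_prod open_domain_O  
        holomorphic_imp_meromorphic_several holomorphic_several_on_exp holomorphic_several_on_divide holomorphic_several_intros \<gamma> c d)
qed

lemma meromorphic_AW_eigenvalue: 
  assumes \<gamma>: "\<And>j. j \<in> {0..3} \<Longrightarrow> holomorphic_several_on (\<lambda>p. \<gamma> p j) domain_O" and c: "holomorphic_several_on c domain_O"
  shows "meromorphic_several_on (\<lambda>p. AW_eigenvalue (p $ 1) (p $ 2) (\<gamma> p) (c p)) domain_O"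
proof -
  have d: "p $ 2 \<noteq> 0" if "p \<in> domain_O" for p using that by (auto simp: domain_O_def)
  show ?thesis
    unfolding AW_eigenvalue_def Let_def dual_par_simps divide_inverse[of _ 2]
    by (intro meromorphic_several_on_mult open_domain_O  
        holomorphic_imp_meromorphic_several holomorphic_several_on_exp holomorphic_several_on_cosh holomorphic_several_on_divide holomorphic_several_intros \<gamma> c d) auto
qed

text \<open>Two numbers in the right half-plane have a product off the branch cut of the square
  root.\<close>

lemma holomorphic_csqrt_periods: "holomorphic_several_on (\<lambda>p. csqrt (p $ 1 * p $ 2)) domain_O"
proof (rule holomorphic_several_on_compose1[of "\<lambda>p. p $ 1 * p $ 2" _ csqrt "- \<real>\<^sub>\<le>\<^sub>0"])
  fix p assume "p \<in> domain_O"
  then have r: "Re (p $ 1) > 0" "Re (p $ 2) > 0" by (auto simp: domain_O_def)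
  show "p $ 1 * p $ 2 \<in> - \<real>\<^sub>\<le>\<^sub>0"
  proof
    assume "p $ 1 * p $ 2 \<in> \<real>\<^sub>\<le>\<^sub>0"
    then have *: "Im (p $ 1 * p $ 2) = 0" "Re (p $ 1 * p $ 2) \<le> 0" by (auto simp: complex_nonpos_Reals_iff)
    define a b c d where "a = Re (p $ 1)" "b = Im (p $ 1)" "c = Re (p $ 2)" "d = Im (p $ 2)"
    note abcd = this
    have 1: "a * d + b * c = 0" "a * c - b * d \<le> 0" "a > 0" "c > 0" using * r by (auto simp: abcd)
    \<comment> \<open>This combination eliminates \<open>d\<close>: a product on the cut would force
      c (a^2 + b^2) \<le> 0.\<close>
    have "a * (a * c - b * d) + b * (a * d + b * c) = c * (a\<^sup>2 + b\<^sup>2)" by (simp add: power2_eq_square algebra_simps)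
    moreover have "c * (a\<^sup>2 + b\<^sup>2) > 0" using 1 by (simp add: add_pos_nonneg)
    moreover have "a * (a * c - b * d) \<le> 0" using 1 by (simp add: mult_le_0_iff)
    ultimately show False using 1(1) by simp
  qed
qed (auto intro!: holomorphic_several_intros holomorphic_intros)

lemma gamma_par_cases: "j \<in> {0..3} \<Longrightarrow> j = 0 \<or> j = Suc 0 \<or> j = 2 \<or> j = (3::nat)" by auto

lemma holomorphic_gamma_par: 
  assumes "j \<in> {0..3}" 
  shows "holomorphic_several_on (\<lambda>p. gamma_par (p $ 3) (p $ 4) (p $ 5) (p $ 6) j) U"
  using gamma_par_cases[OF assms] by (elim disjE; hypsubst) (simp_all only: gamma_par_simps; intro holomorphic_several_intros)+

lemma holomorphic_dual_par: 
  assumes j: "j \<in> {0..3}" and \<gamma>: "\<And>j. j \<in> {0..3} \<Longrightarrow> holomorphic_several_on (\<lambda>p. \<gamma> p j) U"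
  shows "holomorphic_several_on (\<lambda>p. dual_par (\<gamma> p) j) U"
proof -
  have g: "holomorphic_several_on (\<lambda>p. \<gamma> p 0) U" "holomorphic_several_on (\<lambda>p. \<gamma> p 1) U" 
    "holomorphic_several_on (\<lambda>p. \<gamma> p 2) U" "holomorphic_several_on (\<lambda>p. \<gamma> p 3) U"
    by (rule \<gamma>, simp)+
  show ?thesis
    using gamma_par_cases[OF j] by (elim disjE; hypsubst) (simp_all only: dual_par_simps divide_inverse; intro holomorphic_several_intros g)+
qed

lemma meromorphic_S_fun:
  assumes "meromorphic_on_O \<psi>" shows "meromorphic_on_O (S_fun \<psi>)"
proof -
  have \<psi>: "meromorphic_several_on (\<lambda>p. \<psi> (p $ 1) (p $ 2) (p $ 3) (p $ 4) (p $ 5) (p $ 6) (p $ 7) (p $ 8)) domain_O"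
    using assms unfolding meromorphic_on_O_def uncurry8_def .
  show ?thesis
    unfolding meromorphic_on_O_def uncurry8_def S_fun_def Let_def
    by (rule meromorphic_several_on_divide[OF meromorphic_several_on_mult[OF meromorphic_N_fun \<psi>] 
          meromorphic_several_on_mult[OF meromorphic_several_on_mult[OF 
             holomorphic_imp_meromorphic_several[OF holomorphic_csqrt_periods open_domain_O] meromorphic_Delta_fun] meromorphic_Delta_fun]])
       (intro holomorphic_several_on_nth holomorphic_dual_par holomorphic_gamma_par; assumption)+
qed

section \<open>Coordinate changes of the domain of all variables\<close>

text \<open>With \<open>k\<close> the index of a period and \<open>c\<close> equal to \<i> or - \<i>
  this is the shift of the variable \<open>j\<close> in an Askey-Wilson operator.\<close>

definition shift_coord :: "'n \<Rightarrow> 'n \<Rightarrow> complex \<Rightarrow> complex ^ 'n \<Rightarrow> complex ^ 'n::finite" where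
  "shift_coord j k c p = (\<chi> i. p $ i + (if i = j then c * p $ k else 0))"

lemma shift_coord_nth [simp]: "shift_coord j k c p $ i = p $ i + (if i = j then c * p $ k else 0)"
  by (simp add: shift_coord_def)

lemma holomorphic_shift_coord: "holomorphic_several_on (\<lambda>p. shift_coord j k c p $ i) U"
  by (cases "i = j") (auto intro!: holomorphic_several_intros)

text \<open>As \<open>j\<close> differs from \<open>k\<close>, the opposite shift is an inverse; as
  \<open>j\<close> is not the index of a period, \<open>domain_O\<close> is preserved.\<close>

lemma shift_coord_automorphism:
  fixes j k :: 8
  assumes "j \<noteq> k" "j \<noteq> 1" "j \<noteq> 2"
  shows "holomorphic_automorphism (shift_coord j k c) (shift_coord j k (- c)) domain_O"
proof
  show "holomorphic_several_on (\<lambda>p. shift_coord j k c p $ i) UNIV" for i by (rule holomorphic_shift_coord)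
  have "continuous_on UNIV (\<lambda>p. \<chi> i. shift_coord j k (- c) p $ i)"
    by (intro continuous_on_vec_lambda holomorphic_several_on_imp_continuous_on holomorphic_shift_coord)
  then show "continuous_on UNIV (shift_coord j k (- c))" by (simp del: shift_coord_nth)
  show "shift_coord j k c (shift_coord j k (- c) p) = p" "shift_coord j k (- c) (shift_coord j k c p) = p" for p
    using assms by (simp_all add: vec_eq_iff)
  show "shift_coord j k c p \<in> domain_O" if "p \<in> domain_O" for p
    using that assms by (auto simp: domain_O_def)
qed

definition permute_coord :: "('n \<Rightarrow> 'n) \<Rightarrow> complex ^ 'n \<Rightarrow> complex ^ 'n::finite" where
  "permute_coord \<pi> p = (\<chi> i. p $ \<pi> i)"

lemma permute_coord_nth [simp]: "permute_coord \<pi> p $ i = p $ \<pi> i"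
  by (simp add: permute_coord_def)

lemma permute_coord_automorphism:
  fixes \<pi> :: "8 \<Rightarrow> 8"
  assumes "\<And>i. \<pi> (\<pi> i) = i" "\<pi> ` {1, 2} = {1, 2}"
  shows "holomorphic_automorphism (permute_coord \<pi>) (permute_coord \<pi>) domain_O"
proof
  show h: "holomorphic_several_on (\<lambda>p. permute_coord \<pi> p $ i) UNIV" for i 
    unfolding permute_coord_nth by (rule holomorphic_several_on_nth)
  have "continuous_on UNIV (\<lambda>p. \<chi> i. permute_coord \<pi> p $ i)"
    by (intro continuous_on_vec_lambda holomorphic_several_on_imp_continuous_on h)
  then show "continuous_on UNIV (permute_coord \<pi>)" by (simp del: permute_coord_nth)
  show "permute_coord \<pi> (permute_coord \<pi> p) = p" for p
    using assms(1) by (simp_all add: vec_eq_iff)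
  have "\<pi> 1 \<in> {1, 2}" "\<pi> 2 \<in> {1, 2}" using assms(2) by blast+
  then show "permute_coord \<pi> p \<in> domain_O" if "p \<in> domain_O" for p
    using that by (auto simp: domain_O_def)
qed

text \<open>Shifted values become compositions with automorphisms of \<open>domain_O\<close>, along
  which meromorphy and generic identities can be transported.\<close>

lemma uncurry8_AW_x:
  "uncurry8 (AW_x f) p = 
     AW_coeff (p $ 1) (p $ 2) (gamma_par (p $ 3) (p $ 4) (p $ 5) (p $ 6)) (p $ 7) * (uncurry8 f (shift_coord 7 1 \<i> p) - uncurry8 f p)
   + AW_coeff (p $ 1) (p $ 2) (gamma_par (p $ 3) (p $ 4) (p $ 5) (p $ 6)) (- p $ 7) * (uncurry8 f (shift_coord 7 1 (- \<i>) p) - uncurry8 f p)"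
  by (simp add: uncurry8_def AW_x_def AW_op_def)

lemma uncurry8_AW_x_tilde:
  "uncurry8 (AW_x_tilde f) p = 
     AW_coeff (p $ 2) (p $ 1) (gamma_par (p $ 3) (p $ 4) (p $ 5) (p $ 6)) (p $ 7) * (uncurry8 f (shift_coord 7 2 \<i> p) - uncurry8 f p)
   + AW_coeff (p $ 2) (p $ 1) (gamma_par (p $ 3) (p $ 4) (p $ 5) (p $ 6)) (- p $ 7) * (uncurry8 f (shift_coord 7 2 (- \<i>) p) - uncurry8 f p)"
  by (simp add: uncurry8_def AW_x_tilde_def AW_op_def)

lemma dual_par_gamma_par: "dual_par (gamma_par \<rho> \<sigma> \<tau> \<upsilon>) = gamma_par \<upsilon> \<sigma> \<tau> \<rho>"
proof
  fix j
  show "dual_par (gamma_par \<rho> \<sigma> \<tau> \<upsilon>) j = gamma_par \<upsilon> \<sigma> \<tau> \<rho> j"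
    \<comment> \<open>Equality holds as functions on all of \<open>nat\<close>: beyond index 3 both
      sides are the same unspecified entry of the empty list.\<close>
    by (simp add: dual_par_def gamma_par_def nth_Cons split: nat.split)
qed

lemma uncurry8_AW_lambda:
  "uncurry8 (AW_lambda f) p = 
     AW_coeff (p $ 1) (p $ 2) (gamma_par (p $ 6) (p $ 4) (p $ 5) (p $ 3)) (p $ 8) * (uncurry8 f (shift_coord 8 1 \<i> p) - uncurry8 f p)
   + AW_coeff (p $ 1) (p $ 2) (gamma_par (p $ 6) (p $ 4) (p $ 5) (p $ 3)) (- p $ 8) * (uncurry8 f (shift_coord 8 1 (- \<i>) p) - uncurry8 f p)"
  by (simp add: uncurry8_def AW_lambda_def AW_op_def dual_par_gamma_par)

lemma uncurry8_AW_lambda_tilde: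
  "uncurry8 (AW_lambda_tilde f) p = 
     AW_coeff (p $ 2) (p $ 1) (gamma_par (p $ 6) (p $ 4) (p $ 5) (p $ 3)) (p $ 8) * (uncurry8 f (shift_coord 8 2 \<i> p) - uncurry8 f p)
   + AW_coeff (p $ 2) (p $ 1) (gamma_par (p $ 6) (p $ 4) (p $ 5) (p $ 3)) (- p $ 8) * (uncurry8 f (shift_coord 8 2 (- \<i>) p) - uncurry8 f p)"
  by (simp add: uncurry8_def AW_lambda_tilde_def AW_op_def dual_par_gamma_par)

lemma meromorphic_shift_coord:
  fixes j k :: 8
  assumes "meromorphic_several_on F domain_O" "j \<noteq> k" "j \<noteq> 1" "j \<noteq> 2"
  shows "meromorphic_several_on (\<lambda>p. F (shift_coord j k c p)) domain_O"
  using holomorphic_automorphism.meromorphic_compose[OF shift_coord_automorphism[OF assms(2-4)] assms(1) open_domain_O] .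

lemma meromorphic_AW_x:
  assumes "meromorphic_on_O f" shows "meromorphic_on_O (AW_x f)"
  using assms unfolding meromorphic_on_O_def uncurry8_AW_x[abs_def]
  by (intro meromorphic_several_on_add meromorphic_several_on_mult meromorphic_several_on_diff meromorphic_AW_coeff
        open_domain_O meromorphic_shift_coord holomorphic_several_on_nth holomorphic_several_on_uminus holomorphic_gamma_par) simp_all

definition swap_periods :: "8 \<Rightarrow> 8" where
  "swap_periods i = (if i = 1 then 2 else if i = 2 then 1 else i)"

text \<open>The positions 3, 6, 7, 8 hold \<open>\<rho>\<close>, \<open>\<upsilon>\<close>, x,
  \<open>\<lambda>\<close>; by \<open>dual_par_gamma_par\<close> the swap exchanges the parameters
  with their duals.\<close>

definition swap_dual :: "8 \<Rightarrow> 8" where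
  "swap_dual i = (if i = 3 then 6 else if i = 6 then 3 else if i = 7 then 8 else if i = 8 then 7 else i)"

lemma swap_periods_automorphism: "holomorphic_automorphism (permute_coord swap_periods) (permute_coord swap_periods) domain_O"
  by (rule permute_coord_automorphism) (auto simp: swap_periods_def)

lemma swap_dual_automorphism: "holomorphic_automorphism (permute_coord swap_dual) (permute_coord swap_dual) domain_O"
  by (rule permute_coord_automorphism) (auto simp: swap_dual_def)

text \<open>Its fixed points form a totally real subspace.\<close>

definition conj_coord :: "('n \<Rightarrow> complex) \<Rightarrow> ('n \<Rightarrow> 'n) \<Rightarrow> complex ^ 'n \<Rightarrow> complex ^ 'n::finite" where
  "conj_coord \<epsilon> \<pi> p = (\<chi> i. \<epsilon> i * cnj (p $ \<pi> i))"

lemma conj_coord_properties: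
  fixes p :: "complex ^ 'n::finite"
  assumes "\<And>i. \<pi> (\<pi> i) = i" "\<And>i. \<epsilon> i = 1 \<or> \<epsilon> i = - 1" "\<And>i. \<epsilon> (\<pi> i) = \<epsilon> i"
  shows "conj_coord \<epsilon> \<pi> (p + q) = conj_coord \<epsilon> \<pi> p + conj_coord \<epsilon> \<pi> q" 
    "conj_coord \<epsilon> \<pi> (c *s p) = cnj c *s conj_coord \<epsilon> \<pi> p" 
    "conj_coord \<epsilon> \<pi> (conj_coord \<epsilon> \<pi> p) = p" "norm (conj_coord \<epsilon> \<pi> p) = norm p"
proof -
  have e: "\<epsilon> i * cnj (\<epsilon> i) = 1" "norm (\<epsilon> i) = 1" for i using assms(2)[of i] by auto
  show "conj_coord \<epsilon> \<pi> (p + q) = conj_coord \<epsilon> \<pi> p + conj_coord \<epsilon> \<pi> q" 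
    "conj_coord \<epsilon> \<pi> (c *s p) = cnj c *s conj_coord \<epsilon> \<pi> p" 
    by (simp_all add: conj_coord_def vec_eq_iff distrib_left mult_ac)
  show "conj_coord \<epsilon> \<pi> (conj_coord \<epsilon> \<pi> p) = p"
    using e(1) by (simp add: conj_coord_def vec_eq_iff assms(1,3) mult.assoc[symmetric])
  have "(\<Sum>i\<in>UNIV. (norm (p $ \<pi> i))\<^sup>2) = (\<Sum>i\<in>UNIV. (norm (p $ i))\<^sup>2)"
    by (rule sum.reindex_bij_witness[of _ \<pi> \<pi>]) (simp_all add: assms(1))
  then show "norm (conj_coord \<epsilon> \<pi> p) = norm p"
    by (simp add: norm_vec_def L2_set_def conj_coord_def norm_mult e(2))
qed

text \<open>Periods 1 and 100 leave room for 40 w1 \<le> w2 nearby, and x = 1/2 avoids the zero of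
  the Askey-Wilson denominators at x = 0.\<close>

definition real_base :: "complex ^ 8" where
  "real_base = (\<chi> i. if i = 1 then 1 else if i = 2 then 100 else if i = 7 then 1 / 2 else 0)"

lemma cnj_fixed_imp_of_real: "cnj z = z \<Longrightarrow> \<exists>r. z = complex_of_real r"
  by (metis Reals_cnj_iff Reals_cases)

text \<open>The real points are the fixed points of coordinatewise conjugation, so the identity
  theorem for real forms applies to the difference of the two functions.\<close>

lemma meromorphic_eq_real:
  assumes fg: "meromorphic_on_O f" "meromorphic_on_O g"
    and eq: "\<And>w1 w2 \<rho> \<sigma> \<tau> \<upsilon> x l :: real. \<lbrakk>\<bar>w1 - 1\<bar> < 1/4; \<bar>w2 - 100\<bar> < 1/4; \<bar>\<rho>\<bar> < 1/4; \<bar>\<sigma>\<bar> < 1/4; \<bar>\<tau>\<bar> < 1/4; \<bar>\<upsilon>\<bar> < 1/4;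
        \<bar>x - 1/2\<bar> < 1/4; \<bar>l\<bar> < 1/4\<rbrakk> \<Longrightarrow> f (of_real w1) (of_real w2) (of_real \<rho>) (of_real \<sigma>) (of_real \<tau>) (of_real \<upsilon>) (of_real x) (of_real l)
        = g (of_real w1) (of_real w2) (of_real \<rho>) (of_real \<sigma>) (of_real \<tau>) (of_real \<upsilon>) (of_real x) (of_real l)"
  shows "meromorphic_eq f g"
proof -
  have "generically_on (\<lambda>p. uncurry8 f p - uncurry8 g p = 0) domain_O"
  proof (rule meromorphic_several_identity_real_form[OF _ open_domain_O connected_domain_O, where K = "conj_coord (\<lambda>_. 1) (\<lambda>i. i)" and p = real_base and r = "1/4"])
    show "meromorphic_several_on (\<lambda>p. uncurry8 f p - uncurry8 g p) domain_O"
      using fg unfolding meromorphic_on_O_def by (intro meromorphic_several_on_diff open_domain_O)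
    show "conj_coord (\<lambda>_. 1) (\<lambda>i. i) real_base = real_base" by (simp add: conj_coord_def real_base_def vec_eq_iff)
    show "real_base \<in> domain_O" by (simp add: domain_O_def real_base_def)
    fix q :: "complex ^ 8" assume q: "dist real_base q < 1/4" "conj_coord (\<lambda>_. 1) (\<lambda>i. i) q = q"
    have "cnj (q $ i) = q $ i" for i using arg_cong[OF q(2), of "\<lambda>q. q $ i"] by (simp add: conj_coord_def)
    then have "\<exists>r. q $ i = complex_of_real r" for i by (rule cnj_fixed_imp_of_real)
    then obtain r where r: "\<And>i. q $ i = complex_of_real (r i)" by metis
    have "norm (q $ i - real_base $ i) < 1/4" for i
      using dist_vec_nth_le[of q i real_base] q(1) by (simp add: dist_norm norm_minus_commute)
    from this[of 1] this[of 2] this[of 3] this[of 4] this[of 5] this[of 6] this[of 7] this[of 8]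
    have "norm (of_real (r 1 - 1) :: complex) < 1/4" "norm (of_real (r 2 - 100) :: complex) < 1/4" "norm (of_real (r 7 - 1/2) :: complex) < 1/4"
      "\<bar>r 3\<bar> < 1/4" "\<bar>r 4\<bar> < 1/4" "\<bar>r 5\<bar> < 1/4" "\<bar>r 6\<bar> < 1/4" "\<bar>r 8\<bar> < 1/4"
      by (simp_all add: r real_base_def)
    then have "uncurry8 f q = uncurry8 g q" unfolding uncurry8_def r norm_of_real by (intro eq)
    then show "uncurry8 f q - uncurry8 g q = 0" by simp
  qed (use conj_coord_properties[of "\<lambda>i. i" "\<lambda>_. 1"] in auto)
  then show ?thesis unfolding meromorphic_eq_def right_minus_eq .
qed

section \<open>Symmetries and the difference equations\<close>

lemma hyp_gamma_commute: "hyp_gamma w1 w2 = hyp_gamma w2 w1"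
proof -
  have "hyp_gamma_strip w1 w2 = hyp_gamma_strip w2 w1" "wmean w1 w2 = wmean w2 w1"
    by (simp_all add: hyp_gamma_strip_def wmean_def mult_ac add_ac fun_eq_iff)
  then show ?thesis unfolding hyp_gamma_def by simp
qed

lemma wmean_commute: "wmean w1 w2 = wmean w2 w1" by (simp add: wmean_def add.commute)

lemma S_fun_commute:
  assumes "\<psi> w1 w2 \<rho> \<sigma> \<tau> \<upsilon> x l = \<psi> w2 w1 \<rho> \<sigma> \<tau> \<upsilon> x l"
  shows "S_fun \<psi> w1 w2 \<rho> \<sigma> \<tau> \<upsilon> x l = S_fun \<psi> w2 w1 \<rho> \<sigma> \<tau> \<upsilon> x l"
  unfolding S_fun_def N_fun_def Delta_fun_def Let_def assms hyp_gamma_commute[of w1] wmean_commute[of w1] 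
    mult.commute[of w1] by (rule refl)

lemma psi_integral_commute: "psi_integral w1 w2 \<rho> \<sigma> \<tau> \<upsilon> x l = psi_integral w2 w1 \<rho> \<sigma> \<tau> \<upsilon> x l"
  unfolding psi_integral_def hyp_gamma_pm_def hyp_gamma_commute[of w1] wmean_commute[of w1] by (rule refl)

text \<open>The integration variable is translated by (l - x) / 2, which is a real translation
  because x and l are real.\<close>

lemma psi_integral_dual:
  "psi_integral w1 w2 \<rho> \<sigma> \<tau> \<upsilon> (of_real x) (of_real l) = psi_integral w1 w2 \<upsilon> \<sigma> \<tau> \<rho> (of_real l) (of_real x)"
  unfolding psi_integral_def Let_def
  by (subst lborel_integral_real_affine[of 1 _ "(l - x) / 2"])
     (simp_all add: algebra_simps add_divide_distrib diff_divide_distrib)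

text \<open>The three sums in \<open>N_fun\<close> are 2 \<open>\<sigma>\<close>,
  \<open>\<sigma>\<close> - \<open>\<rho>\<close> - \<open>\<upsilon>\<close> -
  \<open>\<tau>\<close> and \<open>\<sigma>\<close> - \<open>\<rho>\<close> -
  \<open>\<upsilon>\<close> + \<open>\<tau>\<close>, all symmetric in \<open>\<rho>\<close> and
  \<open>\<upsilon>\<close>.\<close>

lemma N_fun_dual: "N_fun w1 w2 (gamma_par \<rho> \<sigma> \<tau> \<upsilon>) = N_fun w1 w2 (gamma_par \<upsilon> \<sigma> \<tau> \<rho>)"
proof -
  have "{1..3::nat} = {Suc 0, 2, 3}" by auto
  then show ?thesis by (simp add: N_fun_def algebra_simps)
qed

lemma S_fun_dual:
  assumes "\<psi> w1 w2 \<rho> \<sigma> \<tau> \<upsilon> x l = \<psi> w1 w2 \<upsilon> \<sigma> \<tau> \<rho> l x"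
  shows "S_fun \<psi> w1 w2 \<rho> \<sigma> \<tau> \<upsilon> x l = S_fun \<psi> w1 w2 \<upsilon> \<sigma> \<tau> \<rho> l x"
  unfolding S_fun_def Let_def dual_par_gamma_par assms N_fun_dual[of w1 w2 \<rho>] by (simp only: mult_ac)

text \<open>Conjugation by the permutation turns a shift of variable \<open>j\<close> by period
  \<open>k'\<close> into one of variable 7 by period \<open>k\<close>. The invariance of
  \<open>F\<close> is used at the point and at both shifted points.\<close>

lemma transport_difference_equation:
  fixes F :: "complex ^ 8 \<Rightarrow> complex"
  assumes \<pi>: "holomorphic_automorphism (permute_coord \<pi>) (permute_coord \<pi>) domain_O"
    and sym: "generically_on (\<lambda>p. F p = F (permute_coord \<pi> p)) domain_O"
    and L: "\<And>p. L p = a p * (F (shift_coord 7 k \<i> p) - F p) + b p * (F (shift_coord 7 k (- \<i>) p) - F p)"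
    and eq: "generically_on (\<lambda>p. L p = \<mu> p * F p) domain_O"
    and jk: "\<And>i. \<pi> i = j \<longleftrightarrow> i = 7" "\<pi> k = k'" "j \<noteq> k'" "j \<noteq> 1" "j \<noteq> 2"
  shows "generically_on (\<lambda>p. a (permute_coord \<pi> p) * (F (shift_coord j k' \<i> p) - F p) 
     + b (permute_coord \<pi> p) * (F (shift_coord j k' (- \<i>) p) - F p) = \<mu> (permute_coord \<pi> p) * F p) domain_O"
proof -
  have sh: "generically_on (\<lambda>p. F (shift_coord j k' c p) = F (permute_coord \<pi> (shift_coord j k' c p))) domain_O" for c
    by (rule holomorphic_automorphism.generically_compose[OF shift_coord_automorphism sym open_domain_O]) (fact jk)+
  have comm: "permute_coord \<pi> (shift_coord j k' c p) = shift_coord 7 k c (permute_coord \<pi> p)" for c p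
    by (simp add: vec_eq_iff jk)
  note eq' = holomorphic_automorphism.generically_compose[OF \<pi> eq open_domain_O]
  show ?thesis
    by (rule generically_on_mono[OF generically_on_conj[OF eq' generically_on_conj[OF sym generically_on_conj[OF sh[of \<i>] sh[of "- \<i>"]]]]])
       (simp add: L comm)
qed

lemma uncurry8_mult: "uncurry8 (\<lambda>w1 w2 \<rho> \<sigma> \<tau> \<upsilon> x l. f w1 w2 \<rho> \<sigma> \<tau> \<upsilon> x l * g w1 w2 \<rho> \<sigma> \<tau> \<upsilon> x l) p = uncurry8 f p * uncurry8 g p"
  by (simp add: uncurry8_def)

context
  fixes \<psi> :: cfun8
  assumes \<psi>: "psi_continuation \<psi>"
begin

lemma meromorphic_S: "meromorphic_on_O (S_fun \<psi>)"
  using \<psi> by (simp add: psi_continuation_def meromorphic_S_fun)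

text \<open>Here \<open>psi_zeta\<close> is at least 21 w1 / 4 - 2 w1, which exceeds w1, so the
  integral still represents \<open>\<psi>\<close> after shifting a real x by \<i> w1 up or
  down.\<close>

lemma psi_eq_integral:
  fixes w1 w2 :: real
  assumes w: "0 < w1" "20 * w1 \<le> w2" 
    and small: "\<bar>Re \<rho>\<bar> \<le> w1" "\<bar>Re \<sigma>\<bar> \<le> w1" "\<bar>Re \<tau>\<bar> \<le> w1" "\<bar>Re \<upsilon>\<bar> \<le> w1" "\<bar>Im x\<bar> \<le> w1" "\<bar>Im l\<bar> \<le> w1"
  shows "\<psi> (of_real w1) (of_real w2) \<rho> \<sigma> \<tau> \<upsilon> x l = psi_integral (of_real w1) (of_real w2) \<rho> \<sigma> \<tau> \<upsilon> x l"
    and "\<psi> (of_real w2) (of_real w1) \<rho> \<sigma> \<tau> \<upsilon> x l = psi_integral (of_real w2) (of_real w1) \<rho> \<sigma> \<tau> \<upsilon> x l"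
proof -
  define \<xi> where "\<xi> = Max {\<bar>Re \<rho>\<bar>, \<bar>Re \<sigma>\<bar>, \<bar>Re \<tau>\<bar>, \<bar>Re \<upsilon>\<bar>}"
  have "\<xi> \<le> w1" using small by (simp add: \<xi>_def)
  moreover have "\<bar>Im (l / 2)\<bar> \<le> w1" using small(6) by simp
  ultimately have "w1 < psi_zeta w1 w2 \<rho> \<sigma> \<tau> \<upsilon> l" "w1 < psi_zeta w2 w1 \<rho> \<sigma> \<tau> \<upsilon> l" 
    using w unfolding psi_zeta_def \<xi>_def[symmetric] by (simp_all add: field_simps)
  then have z: "0 < psi_zeta w1 w2 \<rho> \<sigma> \<tau> \<upsilon> l" "\<bar>Im x\<bar> < psi_zeta w1 w2 \<rho> \<sigma> \<tau> \<upsilon> l"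
     "0 < psi_zeta w2 w1 \<rho> \<sigma> \<tau> \<upsilon> l" "\<bar>Im x\<bar> < psi_zeta w2 w1 \<rho> \<sigma> \<tau> \<upsilon> l" using w small(5) by linarith+
  have w2: "0 < w2" using w by linarith
  show "\<psi> (of_real w1) (of_real w2) \<rho> \<sigma> \<tau> \<upsilon> x l = psi_integral (of_real w1) (of_real w2) \<rho> \<sigma> \<tau> \<upsilon> x l"
    using \<psi> w(1) w2 z(1,2) unfolding psi_continuation_def by blast
  show "\<psi> (of_real w2) (of_real w1) \<rho> \<sigma> \<tau> \<upsilon> x l = psi_integral (of_real w2) (of_real w1) \<rho> \<sigma> \<tau> \<upsilon> x l"
    using \<psi> w(1) w2 z(3,4) unfolding psi_continuation_def by blast
qed

lemma meromorphic_permute: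
  assumes "meromorphic_on_O f" "holomorphic_automorphism (permute_coord \<pi>) (permute_coord \<pi>) domain_O"
    "\<And>p. uncurry8 g p = uncurry8 f (permute_coord \<pi> p)"
  shows "meromorphic_on_O g"
  using holomorphic_automorphism.meromorphic_compose[OF assms(2) assms(1)[unfolded meromorphic_on_O_def] open_domain_O]
  unfolding meromorphic_on_O_def assms(3)[abs_def] .

lemma S_swap_periods: "generically_on (\<lambda>p. uncurry8 (S_fun \<psi>) p = uncurry8 (S_fun \<psi>) (permute_coord swap_periods p)) domain_O"
proof -
  define g :: cfun8 where "g = (\<lambda>w1 w2. S_fun \<psi> w2 w1)"
  have g: "uncurry8 g p = uncurry8 (S_fun \<psi>) (permute_coord swap_periods p)" for p
    by (simp add: uncurry8_def g_def swap_periods_def)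
  have "meromorphic_eq (S_fun \<psi>) g"
  proof (rule meromorphic_eq_real[OF meromorphic_S])
    show "meromorphic_on_O g" by (rule meromorphic_permute[OF meromorphic_S swap_periods_automorphism g])
  next
    fix w1 w2 \<rho> \<sigma> \<tau> \<upsilon> x l :: real
    assume "\<bar>w1 - 1\<bar> < 1/4" "\<bar>w2 - 100\<bar> < 1/4" 
      "\<bar>\<rho>\<bar> < 1/4" "\<bar>\<sigma>\<bar> < 1/4" "\<bar>\<tau>\<bar> < 1/4" "\<bar>\<upsilon>\<bar> < 1/4" "\<bar>x - 1/2\<bar> < 1/4" "\<bar>l\<bar> < 1/4"
    then have w: "0 < w1" "20 * w1 \<le> w2" "\<bar>\<rho>\<bar> \<le> w1" "\<bar>\<sigma>\<bar> \<le> w1" "\<bar>\<tau>\<bar> \<le> w1" "\<bar>\<upsilon>\<bar> \<le> w1" by linarith+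
    show "S_fun \<psi> (of_real w1) (of_real w2) (of_real \<rho>) (of_real \<sigma>) (of_real \<tau>) (of_real \<upsilon>) (of_real x) (of_real l)
      = g (of_real w1) (of_real w2) (of_real \<rho>) (of_real \<sigma>) (of_real \<tau>) (of_real \<upsilon>) (of_real x) (of_real l)"
      unfolding g_def
      by (rule S_fun_commute, subst psi_eq_integral(1)[OF w(1,2)], use w in simp_all)
         (subst psi_eq_integral(2)[OF w(1,2)], use w in \<open>simp_all add: psi_integral_commute\<close>)
  qed
  then show ?thesis unfolding meromorphic_eq_def g .
qed

lemma S_swap_dual: "generically_on (\<lambda>p. uncurry8 (S_fun \<psi>) p = uncurry8 (S_fun \<psi>) (permute_coord swap_dual p)) domain_O"
proof -
  define g :: cfun8 where "g = (\<lambda>w1 w2 \<rho> \<sigma> \<tau> \<upsilon> x l. S_fun \<psi> w1 w2 \<upsilon> \<sigma> \<tau> \<rho> l x)"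
  have g: "uncurry8 g p = uncurry8 (S_fun \<psi>) (permute_coord swap_dual p)" for p
    by (simp add: uncurry8_def g_def swap_dual_def)
  have "meromorphic_eq (S_fun \<psi>) g"
  proof (rule meromorphic_eq_real[OF meromorphic_S])
    show "meromorphic_on_O g" by (rule meromorphic_permute[OF meromorphic_S swap_dual_automorphism g])
  next
    fix w1 w2 \<rho> \<sigma> \<tau> \<upsilon> x l :: real
    assume "\<bar>w1 - 1\<bar> < 1/4" "\<bar>w2 - 100\<bar> < 1/4" 
      "\<bar>\<rho>\<bar> < 1/4" "\<bar>\<sigma>\<bar> < 1/4" "\<bar>\<tau>\<bar> < 1/4" "\<bar>\<upsilon>\<bar> < 1/4" "\<bar>x - 1/2\<bar> < 1/4" "\<bar>l\<bar> < 1/4"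
    then have w: "0 < w1" "20 * w1 \<le> w2" "\<bar>\<rho>\<bar> \<le> w1" "\<bar>\<sigma>\<bar> \<le> w1" "\<bar>\<tau>\<bar> \<le> w1" "\<bar>\<upsilon>\<bar> \<le> w1" by linarith+
    show "S_fun \<psi> (of_real w1) (of_real w2) (of_real \<rho>) (of_real \<sigma>) (of_real \<tau>) (of_real \<upsilon>) (of_real x) (of_real l)
      = g (of_real w1) (of_real w2) (of_real \<rho>) (of_real \<sigma>) (of_real \<tau>) (of_real \<upsilon>) (of_real x) (of_real l)"
      unfolding g_def
      by (rule S_fun_dual) (use w in \<open>simp add: psi_eq_integral(1)[OF w(1,2)] psi_integral_dual\<close>)
  qed
  then show ?thesis unfolding meromorphic_eq_def g .
qed

lemma AW_x_S: "meromorphic_eq (AW_x (S_fun \<psi>))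
  (\<lambda>w1 w2 \<rho> \<sigma> \<tau> \<upsilon> x l. AW_eigenvalue w1 w2 (gamma_par \<rho> \<sigma> \<tau> \<upsilon>) l * S_fun \<psi> w1 w2 \<rho> \<sigma> \<tau> \<upsilon> x l)"
proof (rule meromorphic_eq_real[OF meromorphic_AW_x[OF meromorphic_S]])
  show "meromorphic_on_O (\<lambda>w1 w2 \<rho> \<sigma> \<tau> \<upsilon> x l. AW_eigenvalue w1 w2 (gamma_par \<rho> \<sigma> \<tau> \<upsilon>) l * S_fun \<psi> w1 w2 \<rho> \<sigma> \<tau> \<upsilon> x l)"
    using meromorphic_S unfolding meromorphic_on_O_def uncurry8_def
    by (intro meromorphic_several_on_mult meromorphic_AW_eigenvalue holomorphic_gamma_par holomorphic_several_on_nth)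
next
  fix w1 w2 \<rho> \<sigma> \<tau> \<upsilon> x l :: real
  assume w: "\<bar>w1 - 1\<bar> < 1/4" "\<bar>w2 - 100\<bar> < 1/4"
    and p: "\<bar>\<rho>\<bar> < 1/4" "\<bar>\<sigma>\<bar> < 1/4" "\<bar>\<tau>\<bar> < 1/4" "\<bar>\<upsilon>\<bar> < 1/4" "\<bar>x - 1/2\<bar> < 1/4" "\<bar>l\<bar> < 1/4"
  have w': "0 < w1" "40 * w1 \<le> w2" "20 * w1 \<le> w2" "0 < w2" using w by linarith+
  have p': "\<bar>\<rho>\<bar> \<le> w1" "\<bar>\<sigma>\<bar> \<le> w1" "\<bar>\<tau>\<bar> \<le> w1" "\<bar>\<upsilon>\<bar> \<le> w1" "\<bar>x\<bar> \<le> w1" "\<bar>l\<bar> \<le> w1" "0 < x" using w(1) p by linarith+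
  have e: "S_fun \<psi> (of_real w1) (of_real w2) (of_real \<rho>) (of_real \<sigma>) (of_real \<tau>) (of_real \<upsilon>) y (of_real l)
     = S_fun psi_integral (of_real w1) (of_real w2) (of_real \<rho>) (of_real \<sigma>) (of_real \<tau>) (of_real \<upsilon>) y (of_real l)"
    if "\<bar>Im y\<bar> \<le> w1" for y
    unfolding S_fun_def using psi_eq_integral(1)[of w1 w2 "of_real \<rho>" "of_real \<sigma>" "of_real \<tau>" "of_real \<upsilon>" y "of_real l"] w' p' that by simp
  define X q where "X = e2 w2 (of_real x)" and "q = e2 w2 (\<i> * of_real w1 / 2)"
  \<comment> \<open>x is positive and \<i> w1 / 2 is imaginary. The modulus of X^2 thus differs from
    that of 1 and of q^2, which keeps all three denominators from vanishing.\<close>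
  have X: "norm X > 1" and q: "norm q = 1"
    using w' p' by (simp_all add: X_def q_def e2_def)
  have X2: "norm (X\<^sup>2) > 1" and q2: "norm (q\<^sup>2) = 1" using X q by (simp_all add: norm_power one_less_power)
  have d: "1 - X\<^sup>2 \<noteq> 0" "1 - q\<^sup>2 * X\<^sup>2 \<noteq> 0" "q\<^sup>2 - X\<^sup>2 \<noteq> 0"
  proof -
    have "norm (1::complex) \<noteq> norm (X\<^sup>2)" "norm (1::complex) \<noteq> norm (q\<^sup>2 * X\<^sup>2)" "norm (q\<^sup>2) \<noteq> norm (X\<^sup>2)"
      using X2 q2 by (simp_all add: norm_mult)
    then show "1 - X\<^sup>2 \<noteq> 0" "1 - q\<^sup>2 * X\<^sup>2 \<noteq> 0" "q\<^sup>2 - X\<^sup>2 \<noteq> 0" by (metis eq_iff_diff_eq_0)+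
  qed
  have "AW_op (of_real w1) (of_real w2) (gamma_par (of_real \<rho>) (of_real \<sigma>) (of_real \<tau>) (of_real \<upsilon>)) 
     (\<lambda>y. S_fun psi_integral (of_real w1) (of_real w2) (of_real \<rho>) (of_real \<sigma>) (of_real \<tau>) (of_real \<upsilon>) y (of_real l)) (of_real x)
    = AW_eigenvalue (of_real w1) (of_real w2) (gamma_par (of_real \<rho>) (of_real \<sigma>) (of_real \<tau>) (of_real \<upsilon>)) (of_real l) 
      * S_fun psi_integral (of_real w1) (of_real w2) (of_real \<rho>) (of_real \<sigma>) (of_real \<tau>) (of_real \<upsilon>) (of_real x) (of_real l)"
    by (rule AW_op_S_fun[OF w'(1,2)]) (use p' d in \<open>simp_all add: X_def q_def\<close>)
  then show "AW_x (S_fun \<psi>) (of_real w1) (of_real w2) (of_real \<rho>) (of_real \<sigma>) (of_real \<tau>) (of_real \<upsilon>) (of_real x) (of_real l)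
    = AW_eigenvalue (of_real w1) (of_real w2) (gamma_par (of_real \<rho>) (of_real \<sigma>) (of_real \<tau>) (of_real \<upsilon>)) (of_real l) 
      * S_fun \<psi> (of_real w1) (of_real w2) (of_real \<rho>) (of_real \<sigma>) (of_real \<tau>) (of_real \<upsilon>) (of_real x) (of_real l)"
    unfolding AW_x_def AW_op_def using w'(1) by (simp add: e)
qed

lemma AW_x_tilde_S: "meromorphic_eq (AW_x_tilde (S_fun \<psi>))
  (\<lambda>w1 w2 \<rho> \<sigma> \<tau> \<upsilon> x l. AW_eigenvalue w2 w1 (gamma_par \<rho> \<sigma> \<tau> \<upsilon>) l * S_fun \<psi> w1 w2 \<rho> \<sigma> \<tau> \<upsilon> x l)"
  using transport_difference_equation[OF swap_periods_automorphism S_swap_periods uncurry8_AW_x[of "S_fun \<psi>"]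
      AW_x_S[unfolded meromorphic_eq_def uncurry8_mult], of 7 2]
  by (simp add: meromorphic_eq_def uncurry8_AW_x_tilde uncurry8_mult) (simp add: uncurry8_def swap_periods_def)

lemma AW_lambda_S: "meromorphic_eq (AW_lambda (S_fun \<psi>))
    (\<lambda>w1 w2 \<rho> \<sigma> \<tau> \<upsilon> x l. AW_eigenvalue w1 w2 (dual_par (gamma_par \<rho> \<sigma> \<tau> \<upsilon>)) x * S_fun \<psi> w1 w2 \<rho> \<sigma> \<tau> \<upsilon> x l)"
  using transport_difference_equation[OF swap_dual_automorphism S_swap_dual uncurry8_AW_x[of "S_fun \<psi>"]
      AW_x_S[unfolded meromorphic_eq_def uncurry8_mult], of 8 1]
  by (simp add: meromorphic_eq_def uncurry8_AW_lambda uncurry8_mult) (simp add: uncurry8_def swap_dual_def dual_par_gamma_par)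

text \<open>The dual symmetry fixes both periods, so it carries the equation with exchanged periods
  from x to \<open>\<lambda>\<close>.\<close>

lemma AW_lambda_tilde_S: "meromorphic_eq (AW_lambda_tilde (S_fun \<psi>))
    (\<lambda>w1 w2 \<rho> \<sigma> \<tau> \<upsilon> x l. AW_eigenvalue w2 w1 (dual_par (gamma_par \<rho> \<sigma> \<tau> \<upsilon>)) x * S_fun \<psi> w1 w2 \<rho> \<sigma> \<tau> \<upsilon> x l)"
  using transport_difference_equation[OF swap_dual_automorphism S_swap_dual uncurry8_AW_x_tilde[of "S_fun \<psi>"]
      AW_x_tilde_S[unfolded meromorphic_eq_def uncurry8_mult], of 8 2]
  by (simp add: meromorphic_eq_def uncurry8_AW_lambda_tilde uncurry8_mult) (simp add: uncurry8_def swap_dual_def dual_par_gamma_par)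

end

section \<open>Nonvanishing\<close>

text \<open>One step of the difference equation reaches the arguments in \<open>N_fun\<close>; its
  factor is a cosh that can vanish only for Re z = 0.\<close>

lemma hyp_gamma_nonzero_off_axis:
  fixes w1 w2 :: real
  assumes w: "0 < w1" "0 < w2" and "Re z \<noteq> 0" "2 * \<bar>Im z - w1\<bar> < w1 + w2"
  shows "hyp_gamma (of_real w1) (of_real w2) z \<noteq> 0"
proof -
  have "hyp_gamma (of_real w1) (of_real w2) z = gamma_ext (of_real w1) (of_real w2) 1 z"
    by (rule hyp_gamma_eq_ext) (use assms in simp_all)
  also have "\<dots> \<noteq> 0"
  proof -
    have "Re (of_real pi * (z - \<i> * of_real w1 / 2) / of_real w2) \<noteq> 0" using assms by simp
    from cosh_nonzero[OF this] show ?thesis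
      by (simp add: gamma_ext_def gamma_prod_def gamma_factor_def)
  qed
  finally show ?thesis .
qed

context
  fixes w1 w2 x m :: real and \<sigma> \<tau> \<rho> \<upsilon> l :: complex
  assumes w: "0 < w1" "40 * w1 \<le> w2" 
    and x: "\<bar>x\<bar> \<le> w1" and \<sigma>: "norm \<sigma> \<le> w1" "4 * \<bar>Re \<sigma>\<bar> < w1" and \<tau>: "norm \<tau> \<le> w1" "4 * \<bar>Re \<tau>\<bar> < w1"  and m: "\<bar>m\<bar> \<le> w1"
    and l: "l = \<i> * of_real m" and \<rho>: "\<rho> = cnj \<tau>" and \<upsilon>: "\<upsilon> = cnj \<sigma>"
begin

text \<open>Under these assumptions the arguments in the denominator are the complex conjugates of
  those in the numerator, and for real periods the reciprocal of \<open>hyp_gamma\<close> at a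
  conjugate argument is the conjugate value. An integrable function that is positive everywhere has
  nonzero integral.\<close>

lemma psi_integral_nonzero: "psi_integral (of_real w1) (of_real w2) \<rho> \<sigma> \<tau> \<upsilon> (of_real x) l \<noteq> 0"
proof -
  let ?G = "hyp_gamma (of_real w1) (of_real w2)"
  have w2: "0 < w2" using w by linarith
  have nl: "norm l \<le> w1" and n\<rho>: "norm \<rho> \<le> w1" and n\<upsilon>: "norm \<upsilon> \<le> w1" using m \<sigma> \<tau> by (simp_all add: l \<rho> \<upsilon> norm_mult)
  have nx: "norm (complex_of_real x) \<le> w1" using x by simp
  define q where "q = \<i> * complex_of_real ((w1 + w2) / 4)"
  have q: "\<i> * wmean (of_real w1) (of_real w2) / 2 = q" by (simp add: q_def wmean_def)
  define f where "f = (\<lambda>t::real. gamma_quad w1 w2 (of_real x + l / 2 - q) \<tau> (- l / 2 - q) \<sigma> (of_real x - l / 2 + q) \<rho> (l / 2 + q) \<upsilon> (of_real t))"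
  have psi: "psi_integral (of_real w1) (of_real w2) \<rho> \<sigma> \<tau> \<upsilon> (of_real x) l = (\<integral>t. f t \<partial>lborel)"
    unfolding psi_integral_def gamma_quad_def[OF w(1) w2] Let_def q f_def by (simp add: algebra_simps)
  have nl2: "norm (l / 2) \<le> w1" using nl w(1) by (simp add: norm_divide)
  have int: "integrable lborel f"
    unfolding f_def
  proof (rule gamma_quad_integrable[OF w(1) w2 w(2)])
    have "norm (of_real x + l / 2) \<le> 2 * w1" "norm (of_real x - l / 2) \<le> 2 * w1"
      using norm_triangle_ineq[of "of_real x" "l / 2"] norm_triangle_ineq4[of "of_real x" "l / 2"] nl2 nx by linarith+
    then show "norm (of_real x + l / 2 - q + \<i> * of_real ((w1 + w2) / 4)) \<le> 4 * w1" 
      "norm (of_real x - l / 2 + q - \<i> * of_real ((w1 + w2) / 4)) \<le> 4 * w1"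
      "norm (- l / 2 - q + \<i> * of_real ((w1 + w2) / 4)) \<le> 4 * w1" 
      "norm (l / 2 + q - \<i> * of_real ((w1 + w2) / 4)) \<le> 4 * w1"
      using nl2 w(1) by (simp_all add: q_def)
  qed (use n\<rho> n\<upsilon> \<sigma> \<tau> in simp_all)
  define g where "g = (\<lambda>t::real. norm (?G (of_real t + of_real x + l / 2 - q + \<i> * \<tau>)
     * ?G (of_real t + of_real x + l / 2 - q - \<i> * \<tau>) * (?G (of_real t - l / 2 - q + \<i> * \<sigma>) * ?G (of_real t - l / 2 - q - \<i> * \<sigma>))) ^ 2)"
  have im: "\<bar>Im l\<bar> \<le> w1" "\<bar>Re \<sigma>\<bar> \<le> w1" "\<bar>Re \<tau>\<bar> \<le> w1" "Im q = (w1 + w2) / 4" 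
    using \<sigma> \<tau> m w(1) by (simp_all add: l q_def)
  have nz: "2 * \<bar>Im z\<bar> < w1 + w2" 
    if "z \<in> {of_real t + of_real x + l / 2 - q + \<i> * \<tau>, of_real t + of_real x + l / 2 - q - \<i> * \<tau>, of_real t - l / 2 - q + \<i> * \<sigma>, of_real t - l / 2 - q - \<i> * \<sigma>}" for t :: real and z
  proof -
    define L k where "L = Im l / 2" and "k = (w1 + w2) / 4"
    have k: "w1 + w2 = 4 * k" "10 * w1 \<le> k" using w by (simp_all add: k_def)
    have "Im z = L - k + Re \<tau> \<or> Im z = L - k - Re \<tau> \<or> Im z = - L - k + Re \<sigma> \<or> Im z = - L - k - Re \<sigma>"
      using that by (auto simp: im(4) L_def k_def)
    moreover have "\<bar>L\<bar> \<le> w1" using im(1) by (simp add: L_def)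
    ultimately show ?thesis using im(2,3) w k unfolding abs_le_iff by (elim disjE) (auto simp: abs_if)
  qed
  have cnj_inv: "inverse (?G (cnj z)) = cnj (?G z)" if "2 * \<bar>Im z\<bar> < w1 + w2" for z
    using that by (simp add: hyp_gamma_real_strip[OF w(1) w2] hyp_gamma_strip_cnj)
  have cl: "cnj l = - l" "cnj q = - q" by (simp_all add: l q_def)
  have fg: "f t = of_real (g t)" for t
  proof -
    define a b c d where ab: "a = of_real t + of_real x + l / 2 - q + \<i> * \<tau>" "b = of_real t + of_real x + l / 2 - q - \<i> * \<tau>"
      "c = of_real t - l / 2 - q + \<i> * \<sigma>" "d = of_real t - l / 2 - q - \<i> * \<sigma>"
    have e: "of_real t + (of_real x + l / 2 - q) + \<i> * \<tau> = a" "of_real t + (of_real x + l / 2 - q) - \<i> * \<tau> = b"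
      "of_real t + (- l / 2 - q) + \<i> * \<sigma> = c" "of_real t + (- l / 2 - q) - \<i> * \<sigma> = d"
      "of_real t + (of_real x - l / 2 + q) + \<i> * \<rho> = cnj b" "of_real t + (of_real x - l / 2 + q) - \<i> * \<rho> = cnj a"
      "of_real t + (l / 2 + q) + \<i> * \<upsilon> = cnj d" "of_real t + (l / 2 + q) - \<i> * \<upsilon> = cnj c"
      by (simp_all add: ab cl \<rho> \<upsilon>)
    have s: "2 * \<bar>Im a\<bar> < w1 + w2" "2 * \<bar>Im b\<bar> < w1 + w2" "2 * \<bar>Im c\<bar> < w1 + w2" "2 * \<bar>Im d\<bar> < w1 + w2"
      by (rule nz[of _ t]; simp add: ab)+
    have "f t = ?G a * ?G b * (?G c * ?G d) * (inverse (?G (cnj a)) * inverse (?G (cnj b)) * (inverse (?G (cnj c)) * inverse (?G (cnj d))))"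
      unfolding f_def gamma_quad_def[OF w(1) w2] hyp_gamma_pm_def e by (simp add: divide_inverse mult_ac)
    also have "\<dots> = (?G a * ?G b * (?G c * ?G d)) * cnj (?G a * ?G b * (?G c * ?G d))"
      unfolding cnj_inv[OF s(1)] cnj_inv[OF s(2)] cnj_inv[OF s(3)] cnj_inv[OF s(4)] by simp
    also have "\<dots> = of_real (g t)" unfolding complex_norm_square[symmetric] g_def ab by simp
    finally show ?thesis .
  qed
  have g: "g t > 0" for t
  proof -
    have "?G (of_real t + of_real x + l / 2 - q + \<i> * \<tau>) \<noteq> 0" "?G (of_real t + of_real x + l / 2 - q - \<i> * \<tau>) \<noteq> 0" 
      "?G (of_real t - l / 2 - q + \<i> * \<sigma>) \<noteq> 0" "?G (of_real t - l / 2 - q - \<i> * \<sigma>) \<noteq> 0"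
      by (rule hyp_gamma_nonzero[OF w(1) w2], rule nz[of _ t], simp)+
    then show ?thesis by (simp add: g_def)
  qed
  have intg: "integrable lborel g" using integrable_Re[OF int] by (simp add: fg)
  have "(\<integral>t. g t \<partial>lborel) \<noteq> 0"
  proof
    assume "(\<integral>t. g t \<partial>lborel) = 0"
    then have "AE t in lborel. g t = 0" 
      using integral_nonneg_eq_0_iff_AE[OF intg] g by (simp add: less_imp_le)
    then have "AE t in (lborel :: real measure). False" by (rule AE_mp) (use g in \<open>simp add: less_imp_neq[symmetric]\<close>)
    then have "ae_filter (lborel :: real measure) = bot" by (simp add: trivial_limit_def)
    then show False by (simp add: ae_filter_eq_bot_iff)
  qed
  then show ?thesis unfolding psi fg by simp
qed

text \<open>The arguments in \<open>N_fun\<close> have real parts - 2 Im \<open>\<sigma>\<close>,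
  twice, and - 2 (Im \<open>\<sigma>\<close> + Im \<open>\<tau>\<close>), nonzero by assumption; the
  bounds on Re \<open>\<sigma>\<close> and Re \<open>\<tau>\<close> keep them in the strip of level
  1.\<close>

lemma S_fun_nonzero:
  assumes "Im \<sigma> \<noteq> 0" "Im \<sigma> + Im \<tau> \<noteq> 0"
  shows "S_fun psi_integral (of_real w1) (of_real w2) \<rho> \<sigma> \<tau> \<upsilon> (of_real x) l \<noteq> 0"
proof -
  have w2: "0 < w2" using w by linarith
  have n: "norm l \<le> w1" "norm \<rho> \<le> w1" "norm \<upsilon> \<le> w1" "norm (complex_of_real x) \<le> w1" 
    using m \<sigma> \<tau> x by (simp_all add: l \<rho> \<upsilon> norm_mult)
  have D: "Delta_fun (of_real w1) (of_real w2) (gamma_par \<rho> \<sigma> \<tau> \<upsilon>) (of_real x) \<noteq> 0"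
    by (rule Delta_step(2)[OF w n(4,1,2) \<sigma>(1) \<tau>(1) n(3)]) (use w in simp)
  have D': "Delta_fun (of_real w1) (of_real w2) (dual_par (gamma_par \<rho> \<sigma> \<tau> \<upsilon>)) l \<noteq> 0"
    unfolding dual_par_gamma_par
    by (rule Delta_step(2)[OF w n(4,1,3) \<sigma>(1) \<tau>(1) n(2)]) (use w m in \<open>simp add: l\<close>)
  have N: "N_fun (of_real w1) (of_real w2) (gamma_par \<rho> \<sigma> \<tau> \<upsilon>) \<noteq> 0"
  proof -
    have "hyp_gamma (of_real w1) (of_real w2) (\<i> * gamma_par \<rho> \<sigma> \<tau> \<upsilon> 0 + \<i> * gamma_par \<rho> \<sigma> \<tau> \<upsilon> j + \<i> * wmean (of_real w1) (of_real w2)) \<noteq> 0"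
      if "j \<in> {1..3}" for j
    proof (rule hyp_gamma_nonzero_off_axis[OF w(1) w2])
      have j: "j = Suc 0 \<or> j = 2 \<or> j = 3" using that by auto
      then show "Re (\<i> * gamma_par \<rho> \<sigma> \<tau> \<upsilon> 0 + \<i> * gamma_par \<rho> \<sigma> \<tau> \<upsilon> j + \<i> * wmean (of_real w1) (of_real w2)) \<noteq> 0"
        using assms by (auto simp: wmean_def \<rho> \<upsilon>)
      show "2 * \<bar>Im (\<i> * gamma_par \<rho> \<sigma> \<tau> \<upsilon> 0 + \<i> * gamma_par \<rho> \<sigma> \<tau> \<upsilon> j + \<i> * wmean (of_real w1) (of_real w2)) - w1\<bar> < w1 + w2"
        using j \<sigma> \<tau> w by (auto simp: wmean_def \<rho> \<upsilon> abs_if field_simps split: if_splits)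
    qed
    then show ?thesis by (simp add: N_fun_def)
  qed
  show ?thesis
    unfolding S_fun_def Let_def using N D D' psi_integral_nonzero w w2 by simp
qed

end

text \<open>Where \<open>\<rho> = cnj \<tau>\<close>, \<open>\<upsilon> = cnj \<sigma>\<close>, \<open>\<lambda>\<close> is imaginary and the other variables are real, the integrand
  of \<open>\<psi>\<close> is a squared absolute value. The imaginary parts of \<open>\<sigma>\<close> and \<open>\<tau>\<close> keep the arguments in \<open>N\<close> away
  from the zeros on the imaginary axis.\<close>

definition conj_sign :: "8 \<Rightarrow> complex" where
  "conj_sign i = (if i = 8 then - 1 else 1)"

definition conj_perm :: "8 \<Rightarrow> 8" where
  "conj_perm i = (if i = 3 then 5 else if i = 5 then 3 else if i = 4 then 6 else if i = 6 then 4 else i)"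

definition conj_base :: "complex ^ 8" where
  "conj_base = (\<chi> i. if i = 1 then 1 else if i = 2 then 100 else if i = 3 then - \<i> / 2 else if i = 5 then \<i> / 2
     else if i = 4 then \<i> / 2 else if i = 6 then - \<i> / 2 else 0)"

lemma S_fun_not_generically_zero:
  assumes \<psi>: "psi_continuation \<psi>"
  shows "\<not> meromorphic_eq (S_fun \<psi>) (\<lambda>w1 w2 \<rho> \<sigma> \<tau> \<upsilon> x l. 0)"
proof -
  let ?K = "conj_coord conj_sign conj_perm"
  have "\<not> generically_on (\<lambda>p. uncurry8 (S_fun \<psi>) p = 0) domain_O"
  proof (rule not_generically_zero_real_form[where K = ?K and p = conj_base and r = "1/8"])
    show "?K conj_base = conj_base" by (auto simp: conj_coord_def conj_base_def conj_perm_def conj_sign_def vec_eq_iff)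
    show "conj_base \<in> domain_O" by (simp add: domain_O_def conj_base_def)
    fix q :: "complex ^ 8" assume q: "dist conj_base q < 1/8" "?K q = q"
    have c: "conj_sign i * cnj (q $ conj_perm i) = q $ i" for i 
      using arg_cong[OF q(2), of "\<lambda>q. q $ i"] by (simp add: conj_coord_def)
    have c': "cnj (q $ 1) = q $ 1" "cnj (q $ 2) = q $ 2" "q $ 3 = cnj (q $ 5)" "q $ 6 = cnj (q $ 4)" "cnj (q $ 7) = q $ 7" "- cnj (q $ 8) = q $ 8"
      using c[of 1] c[of 2] c[of 3] c[of 6] c[of 7] c[of 8] by (simp_all add: conj_sign_def conj_perm_def)
    obtain w1 w2 x where r: "q $ 1 = of_real w1" "q $ 2 = of_real w2" "q $ 7 = of_real x"
      using cnj_fixed_imp_of_real[OF c'(1)] cnj_fixed_imp_of_real[OF c'(2)] cnj_fixed_imp_of_real[OF c'(5)] by auto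
    define m where "m = Im (q $ 8)"
    have l: "q $ 8 = \<i> * of_real m" using arg_cong[OF c'(6), of Re] by (simp add: m_def complex_eq_iff)
    have d: "norm (q $ i - conj_base $ i) < 1/8" for i
      using dist_vec_nth_le[of q i conj_base] q(1) by (simp add: dist_norm norm_minus_commute)
    have "norm (of_real (w1 - 1) :: complex) < 1/8" "norm (of_real (w2 - 100) :: complex) < 1/8" "norm (of_real x :: complex) < 1/8" "\<bar>m\<bar> < 1/8"
      using d[of 1] d[of 2] d[of 7] d[of 8] by (simp_all add: r l conj_base_def norm_mult)
    then have rb: "\<bar>w1 - 1\<bar> < 1/8" "\<bar>w2 - 100\<bar> < 1/8" "\<bar>x\<bar> < 1/8" "\<bar>m\<bar> < 1/8" unfolding norm_of_real .
    have d4: "norm (q $ 4 - \<i> / 2) < 1/8" and d5: "norm (q $ 5 - \<i> / 2) < 1/8"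
      using d[of 4] d[of 5] by (simp_all add: conj_base_def)
    \<comment> \<open>The radius 1/8 about \<i> / 2 gives norm s < 5/8 and 4 |Re s| < 1/2, both
      below w1 > 7/8, while Im s stays positive as \<open>S_fun_nonzero\<close> needs.\<close>
    have st: "norm s < 5/8 \<and> \<bar>Re s\<bar> < 1/8 \<and> 3/8 < Im s" if "norm (s - \<i> / 2) < 1/8" for s
    proof -
      have "norm s \<le> norm (s - \<i> / 2) + norm (\<i> / 2)" using norm_triangle_ineq[of "s - \<i> / 2" "\<i> / 2"] by simp
      moreover have "norm (\<i> / 2 :: complex) = 1/2" by (simp add: norm_divide)
      moreover have "\<bar>Re s\<bar> < 1/8" "\<bar>Im s - 1/2\<bar> < 1/8" 
        using abs_Re_le_cmod[of "s - \<i> / 2"] abs_Im_le_cmod[of "s - \<i> / 2"] that by simp_all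
      ultimately show ?thesis using that by linarith
    qed
    note s4 = st[OF d4] and s5 = st[OF d5]
    have w: "0 < w1" "40 * w1 \<le> w2" "20 * w1 \<le> w2" "\<bar>x\<bar> \<le> w1" "\<bar>m\<bar> \<le> w1" "7/8 < w1" using rb by linarith+
    have n: "norm (q $ 4) \<le> w1" "4 * \<bar>Re (q $ 4)\<bar> < w1" "norm (q $ 5) \<le> w1" "4 * \<bar>Re (q $ 5)\<bar> < w1"
      using s4 s5 w by linarith+
    have "S_fun psi_integral (of_real w1) (of_real w2) (q $ 3) (q $ 4) (q $ 5) (q $ 6) (of_real x) (q $ 8) \<noteq> 0"
      by (rule S_fun_nonzero[OF w(1,2,4) n w(5) l c'(3,4)]) (use s4 s5 in linarith)+
    moreover have "\<psi> (of_real w1) (of_real w2) (q $ 3) (q $ 4) (q $ 5) (q $ 6) (of_real x) (q $ 8)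
       = psi_integral (of_real w1) (of_real w2) (q $ 3) (q $ 4) (q $ 5) (q $ 6) (of_real x) (q $ 8)"
      by (rule psi_eq_integral(1)[OF \<psi> w(1,3)]) (use n w in \<open>simp_all add: c' l\<close>)
    ultimately show "uncurry8 (S_fun \<psi>) q \<noteq> 0" by (simp add: uncurry8_def r S_fun_def)
  qed (use conj_coord_properties[of conj_perm conj_sign] in \<open>auto simp: conj_perm_def conj_sign_def\<close>)
  then show ?thesis unfolding meromorphic_eq_def by (simp add: uncurry8_def)
qed

theorem corollary6p6:
  fixes \<psi> :: cfun8
  assumes "psi_continuation \<psi>"
  shows "is_eigenfunction AW_x (S_fun \<psi>)
           (\<lambda>w1 w2 \<rho> \<sigma> \<tau> \<upsilon> x l. AW_eigenvalue w1 w2 (gamma_par \<rho> \<sigma> \<tau> \<upsilon>) l) \<and>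
         is_eigenfunction AW_x_tilde (S_fun \<psi>)
           (\<lambda>w1 w2 \<rho> \<sigma> \<tau> \<upsilon> x l. AW_eigenvalue w2 w1 (gamma_par \<rho> \<sigma> \<tau> \<upsilon>) l) \<and>
         is_eigenfunction AW_lambda (S_fun \<psi>)
           (\<lambda>w1 w2 \<rho> \<sigma> \<tau> \<upsilon> x l. AW_eigenvalue w1 w2 (dual_par (gamma_par \<rho> \<sigma> \<tau> \<upsilon>)) x) \<and>
         is_eigenfunction AW_lambda_tilde (S_fun \<psi>)
           (\<lambda>w1 w2 \<rho> \<sigma> \<tau> \<upsilon> x l. AW_eigenvalue w2 w1 (dual_par (gamma_par \<rho> \<sigma> \<tau> \<upsilon>)) x)"
  unfolding is_eigenfunction_def
  using meromorphic_S[OF assms] S_fun_not_generically_zero[OF assms] AW_x_S[OF assms] AW_x_tilde_S[OF assms] 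
    AW_lambda_S[OF assms] AW_lambda_tilde_S[OF assms] by (intro conjI)

end
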